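(* Let $n$ be a natural number, let $X$ be a connected CW-complex of dimension $2n$, and let $F$ be a field with $\operatorname{char}(F)\neq 2$. Assume that there exist atoroidal cohomology classes $u_1,\dots,u_n\in H^2(X;F)$ such that $u_j^2=0$ for $j=1,\dots,n$ and $u_1\cup\dots\cup u_n\neq 0\in H^{2n}(X;F)$. Then $\operatorname{TC}(X)=2\dim(X)$.
   Context: $H^*(-;F)$ is singular cohomology. A class $u\in H^k(X;F)$ is called atoroidal if $f^*u=0$ for every continuous map $f\colon T^k\to X$, where $T^k$ is the $k$-dimensional torus. Topological complexity (reduced convention): for a path-connected space $X$ let $PX=C([0,1],X)$ with the compact-open topology and $\pi\colon PX\to X\times X$, $\pi(\gamma)=(\gamma(0),\gamma(1))$. Then $\operatorname{TC}(X)$ is the minimal $k\ge 0$ such that there is an open cover $U_0,\dots,U_k$ of $X\times X$ (that is, $k+1$ open sets) and continuous maps $s_j\colon U_j\to PX$ with $\pi\circ s_j$ equal to the inclusion $U_j\hookrightarrow X\times X$ for each $j$; $\operatorname{TC}(X)=\infty$ if no such $k$ exists. *)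

theory Defs
  imports "HOL-Homology.Homology_Groups" "HOL-Library.Extended_Nat"
begin

section \<open>Singular cohomology\<close>

text \<open>
  A singular cochain of degree p with coefficients in F is an F-valued function on the singular
  p-simplices of X, normalised to vanish on everything that is not a singular p-simplex of X, so
  that equal cochains are equal as functions and sums of cochains are pointwise.
\<close>

type_synonym ('a, 'f) cochain = "((nat \<Rightarrow> real) \<Rightarrow> 'a) \<Rightarrow> 'f"

definition singular_cochains :: "nat \<Rightarrow> 'a topology \<Rightarrow> ('a, 'f::comm_ring_1) cochain set" where
  "singular_cochains p X = {\<phi>. \<forall>\<sigma>. \<not> singular_simplex p X \<sigma> \<longrightarrow> \<phi> \<sigma> = 0}"

definition coboundary :: "nat \<Rightarrow> 'a topology \<Rightarrow> ('a, 'f::comm_ring_1) cochain \<Rightarrow> ('a, 'f) cochain" where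
  "coboundary p X \<phi> =
     (\<lambda>\<sigma>. if singular_simplex (Suc p) X \<sigma>
          then \<Sum>k\<le>Suc p. (-1) ^ k * \<phi> (singular_face (Suc p) k \<sigma>) else 0)"

definition cocycles :: "nat \<Rightarrow> 'a topology \<Rightarrow> ('a, 'f::comm_ring_1) cochain set" where
  "cocycles p X = {\<phi> \<in> singular_cochains p X. coboundary p X \<phi> = (\<lambda>\<sigma>. 0)}"

definition coboundaries :: "nat \<Rightarrow> 'a topology \<Rightarrow> ('a, 'f::comm_ring_1) cochain set" where
  "coboundaries p X =
     (case p of 0 \<Rightarrow> {\<lambda>\<sigma>. 0} | Suc q \<Rightarrow> coboundary q X ` singular_cochains q X)"

definition cocycle_group :: "nat \<Rightarrow> 'a topology \<Rightarrow> ('a, 'f::comm_ring_1) cochain monoid" where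
  "cocycle_group p X =
     \<lparr>carrier = cocycles p X, monoid.mult = (\<lambda>\<phi> \<psi> \<sigma>. \<phi> \<sigma> + \<psi> \<sigma>), one = (\<lambda>\<sigma>. 0)\<rparr>"

text \<open>
  As for the homology groups of the library, cohomology classes are cosets and the group is
  written multiplicatively: the zero class is \<open>\<one>\<^bsub>cohomology_group p X\<^esub>\<close>.
\<close>

definition cohomology_group :: "nat \<Rightarrow> 'a topology \<Rightarrow> ('a, 'f::comm_ring_1) cochain set monoid" where
  "cohomology_group p X = cocycle_group p X Mod coboundaries p X"

definition cohomology_class ::
    "nat \<Rightarrow> 'a topology \<Rightarrow> ('a, 'f::comm_ring_1) cochain \<Rightarrow> ('a, 'f) cochain set" where
  "cohomology_class p X \<phi> = coboundaries p X #>\<^bsub>cocycle_group p X\<^esub> \<phi>"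

text \<open>
  Operations on classes are lifted from cochains by taking the union of the classes obtained from
  all representatives; these are all the same class, see \<open>cohomology_map_cohomology_class\<close> and
  \<open>cup_cohomology_class\<close> below.
\<close>

definition cochain_map ::
    "nat \<Rightarrow> 'b topology \<Rightarrow> ('b \<Rightarrow> 'a) \<Rightarrow> ('a, 'f::comm_ring_1) cochain \<Rightarrow> ('b, 'f) cochain" where
  "cochain_map p Y f \<phi> =
     (\<lambda>\<sigma>. if singular_simplex p Y \<sigma> then \<phi> (simplex_map p f \<sigma>) else 0)"

definition cohomology_map ::
    "nat \<Rightarrow> 'b topology \<Rightarrow> ('b \<Rightarrow> 'a) \<Rightarrow> ('a, 'f::comm_ring_1) cochain set \<Rightarrow> ('b, 'f) cochain set" where
  "cohomology_map p Y f u = (\<Union>\<phi>\<in>u. cohomology_class p Y (cochain_map p Y f \<phi>))"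

text \<open>
  The restrictions of a singular (p+q)-simplex to the face spanned by the first p+1 vertices and
  to the face spanned by the last q+1 vertices.
\<close>

definition front_face :: "nat \<Rightarrow> ((nat \<Rightarrow> real) \<Rightarrow> 'a) \<Rightarrow> (nat \<Rightarrow> real) \<Rightarrow> 'a" where
  "front_face p \<sigma> = restrict \<sigma> (standard_simplex p)"

definition back_face :: "nat \<Rightarrow> nat \<Rightarrow> ((nat \<Rightarrow> real) \<Rightarrow> 'a) \<Rightarrow> (nat \<Rightarrow> real) \<Rightarrow> 'a" where
  "back_face p q \<sigma> =
     restrict (\<lambda>x. \<sigma> (\<lambda>i. if i < p then 0 else x (i - p))) (standard_simplex q)"

definition cochain_cup ::
    "nat \<Rightarrow> nat \<Rightarrow> 'a topology \<Rightarrow> ('a, 'f::comm_ring_1) cochain \<Rightarrow> ('a, 'f) cochain \<Rightarrow> ('a, 'f) cochain" where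
  "cochain_cup p q X \<phi> \<psi> =
     (\<lambda>\<sigma>. if singular_simplex (p + q) X \<sigma>
          then \<phi> (front_face p \<sigma>) * \<psi> (back_face p q \<sigma>) else 0)"

definition cup ::
    "nat \<Rightarrow> nat \<Rightarrow> 'a topology \<Rightarrow> ('a, 'f::comm_ring_1) cochain set \<Rightarrow> ('a, 'f) cochain set \<Rightarrow>
     ('a, 'f) cochain set" where
  "cup p q X u v = (\<Union>\<phi>\<in>u. \<Union>\<psi>\<in>v. cohomology_class (p + q) X (cochain_cup p q X \<phi> \<psi>))"

definition unit_cochain :: "'a topology \<Rightarrow> ('a, 'f::comm_ring_1) cochain" where
  "unit_cochain X = (\<lambda>\<sigma>. if singular_simplex 0 X \<sigma> then 1 else 0)"

text \<open>
  \<open>iterated_cup p X u m\<close> is \<open>u 1 \<union> \<dots> \<union> u m\<close> in degree \<open>m * p\<close>, for classes \<open>u j\<close> of degree p;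
  the empty product is the unit in degree 0.
\<close>

primrec iterated_cup ::
    "nat \<Rightarrow> 'a topology \<Rightarrow> (nat \<Rightarrow> ('a, 'f::comm_ring_1) cochain set) \<Rightarrow> nat \<Rightarrow> ('a, 'f) cochain set" where
  "iterated_cup p X u 0 = cohomology_class 0 X (unit_cochain X)"
| "iterated_cup p X u (Suc m) = cup (m * p) p X (iterated_cup p X u m) (u (Suc m))"


section \<open>Well-definedness of the operations on classes\<close>

lemma singular_simplex_front_face:
  assumes "singular_simplex (p + q) X \<sigma>"
  shows "singular_simplex p X (front_face p \<sigma>)"
proof -
  have "continuous_map (subtopology (powertop_real UNIV) (standard_simplex p)) X \<sigma>"
    using assms standard_simplex_mono[of p "p+q"]
    unfolding singular_simplex_def by (meson continuous_map_from_subtopology_mono le_add1)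
  then show ?thesis
    unfolding singular_simplex_def front_face_def
    by (auto intro: continuous_map_eq)
qed

lemma shift_in_standard_simplex:
  assumes "x \<in> standard_simplex q"
  shows "(\<lambda>i. if i < p then 0 else x (i - p)) \<in> standard_simplex (p + q)"
proof -
  have "(\<Sum>i\<le>p+q. if i < p then 0 else x (i - p)) = (\<Sum>i\<in>{p..p+q}. x (i - p))"
    by (rule sum.mono_neutral_cong_right) auto
  also have "\<dots> = (\<Sum>i\<in>{0..q}. x i)"
    using sum.shift_bounds_cl_nat_ivl[of "\<lambda>i. x (i - p)" 0 p q] by (simp add: add.commute)
  also have "\<dots> = 1"
    using assms by (simp add: standard_simplex_def atLeast0AtMost)
  finally show ?thesis
    using assms by (auto simp: standard_simplex_def)
qed

lemma singular_simplex_back_face: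
  assumes "singular_simplex (p + q) X \<sigma>"
  shows "singular_simplex q X (back_face p q \<sigma>)"
proof -
  let ?P = "powertop_real UNIV" and ?s = "\<lambda>(x::nat\<Rightarrow>real) i. if i < p then 0 else x (i - p)"
  have "continuous_map ?P euclideanreal (\<lambda>x. ?s x i)" for i
    by (cases "i < p") (auto intro: continuous_map_product_projection)
  then have "continuous_map (subtopology ?P (standard_simplex q)) euclideanreal (\<lambda>x. ?s x i)" for i
    by (rule continuous_map_from_subtopology)
  then have "continuous_map (subtopology ?P (standard_simplex q)) (subtopology ?P (standard_simplex (p+q))) ?s"
    by (auto simp: continuous_map_in_subtopology continuous_map_componentwise shift_in_standard_simplex)
  then have "continuous_map (subtopology ?P (standard_simplex q)) X (\<sigma> \<circ> ?s)"
    using assms unfolding singular_simplex_def by (blast intro: continuous_map_compose)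
  then show ?thesis
    unfolding singular_simplex_def back_face_def
    by (auto simp: o_def intro: continuous_map_eq)
qed

definition cochain_eval :: "('a,'f::comm_ring_1) cochain \<Rightarrow> 'a chain \<Rightarrow> 'f" where
  "cochain_eval \<phi> c = (\<Sum>\<sigma>\<in>Poly_Mapping.keys c. of_int (Poly_Mapping.lookup c \<sigma>) * \<phi> \<sigma>)"

lemma cochain_eval_superset: "finite S \<Longrightarrow> Poly_Mapping.keys c \<subseteq> S \<Longrightarrow> cochain_eval \<phi> c = (\<Sum>\<sigma>\<in>S. of_int (Poly_Mapping.lookup c \<sigma>) * \<phi> \<sigma>)"
  unfolding cochain_eval_def by (rule sum.mono_neutral_left) (auto simp: in_keys_iff)

lemma cochain_eval_add: "cochain_eval \<phi> (a + b) = cochain_eval \<phi> a + cochain_eval \<phi> b"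
proof -
  let ?S = "Poly_Mapping.keys a \<union> Poly_Mapping.keys b"
  have "finite ?S" by simp
  then show ?thesis
    using keys_add[of a b] by (simp add: cochain_eval_superset[of ?S] lookup_add sum.distrib ring_distribs)
qed

lemma cochain_eval_0: "cochain_eval \<phi> 0 = 0" by (simp add: cochain_eval_def)
lemma cochain_eval_of: "cochain_eval \<phi> (frag_of x) = \<phi> x" by (simp add: cochain_eval_def)
lemma cochain_eval_cmul: "cochain_eval \<phi> (frag_cmul k c) = of_int k * cochain_eval \<phi> c"
proof -
  have "finite (Poly_Mapping.keys c)" by simp
  then show ?thesis using keys_cmul[of k c]
    by (simp add: cochain_eval_superset[of "Poly_Mapping.keys c"] sum_distrib_left mult.assoc)
qed
lemma cochain_eval_sum: "cochain_eval \<phi> (sum f I) = (\<Sum>i\<in>I. cochain_eval \<phi> (f i))"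
  by (induction I rule: infinite_finite_induct) (simp_all add: cochain_eval_0 cochain_eval_add)

lemma cochain_eval_boundary_of:
  "singular_simplex (Suc p) X \<sigma> \<Longrightarrow> cochain_eval \<phi> (chain_boundary (Suc p) (frag_of \<sigma>)) = coboundary p X \<phi> \<sigma>"
  by (simp add: chain_boundary_of cochain_eval_sum cochain_eval_cmul cochain_eval_of coboundary_def del: sum.atMost_Suc)

lemma cochain_eval_boundary:
  assumes "singular_chain (Suc p) X c"
  shows "cochain_eval \<phi> (chain_boundary (Suc p) c) = cochain_eval (coboundary p X \<phi>) c"
proof -
  have "cochain_eval \<phi> (chain_boundary (Suc p) c) =
     (\<Sum>\<sigma>\<in>Poly_Mapping.keys c. of_int (Poly_Mapping.lookup c \<sigma>) * cochain_eval \<phi> (chain_boundary (Suc p) (frag_of \<sigma>)))"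
    by (simp add: chain_boundary_def frag_extend_def cochain_eval_sum cochain_eval_cmul)
  also have "\<dots> = cochain_eval (coboundary p X \<phi>) c"
    unfolding cochain_eval_def[of "coboundary p X \<phi>"]
    using assms by (intro sum.cong) (auto simp: singular_chain_def cochain_eval_boundary_of)
  finally show ?thesis .
qed

lemma coboundary_coboundary: "coboundary (Suc p) X (coboundary p X \<phi>) = (\<lambda>\<sigma>. 0)"
proof
  fix \<sigma>
  show "coboundary (Suc p) X (coboundary p X \<phi>) \<sigma> = 0"
  proof (cases "singular_simplex (Suc (Suc p)) X \<sigma>")
    case True
    then have c: "singular_chain (Suc (Suc p)) X (frag_of \<sigma>)" by (simp add: singular_chain_of)
    have "coboundary (Suc p) X (coboundary p X \<phi>) \<sigma> = cochain_eval \<phi> (chain_boundary (Suc p) (chain_boundary (Suc (Suc p)) (frag_of \<sigma>)))"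
      using True c by (metis cochain_eval_boundary_of cochain_eval_boundary singular_chain_boundary_alt)
    also have "\<dots> = 0" by (metis c chain_boundary_boundary_alt cochain_eval_0)
    finally show ?thesis .
  qed (simp add: coboundary_def)
qed

lemma coboundary_in: "coboundary p X \<phi> \<in> singular_cochains (Suc p) X"
  by (simp add: coboundary_def singular_cochains_def)

lemma coboundary_add: "coboundary p X (\<lambda>\<sigma>. \<phi> \<sigma> + \<psi> \<sigma>) = (\<lambda>\<sigma>. coboundary p X \<phi> \<sigma> + coboundary p X \<psi> \<sigma>)"
  by (auto simp: coboundary_def sum.distrib ring_distribs fun_eq_iff)

lemma coboundary_uminus: "coboundary p X (\<lambda>\<sigma>. - \<phi> \<sigma>) = (\<lambda>\<sigma>. - coboundary p X \<phi> \<sigma>)"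
  by (auto simp: coboundary_def sum_negf fun_eq_iff)

lemma coboundary_zero: "coboundary p X (\<lambda>\<sigma>. 0) = (\<lambda>\<sigma>. 0)"
  by (auto simp: coboundary_def fun_eq_iff)

lemma comm_group_cocycle_group: "comm_group (cocycle_group p X)"
proof (rule comm_groupI)
  fix \<phi> assume "\<phi> \<in> carrier (cocycle_group p X)"
  then show "\<exists>\<psi>\<in>carrier (cocycle_group p X). \<psi> \<otimes>\<^bsub>cocycle_group p X\<^esub> \<phi> = \<one>\<^bsub>cocycle_group p X\<^esub>"
    by (intro bexI[of _ "\<lambda>\<sigma>. - \<phi> \<sigma>"])
      (auto simp: cocycle_group_def cocycles_def singular_cochains_def coboundary_uminus)
qed (auto simp: cocycle_group_def cocycles_def singular_cochains_def coboundary_add coboundary_zero add_ac)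

lemma coboundaries_add: "\<phi> \<in> coboundaries p X \<Longrightarrow> \<psi> \<in> coboundaries p X \<Longrightarrow> (\<lambda>\<sigma>. \<phi> \<sigma> + \<psi> \<sigma>) \<in> coboundaries p X"
  by (cases p) (auto simp: coboundaries_def simp flip: coboundary_add intro!: imageI simp: singular_cochains_def)

lemma coboundaries_uminus: "\<phi> \<in> coboundaries p X \<Longrightarrow> (\<lambda>\<sigma>. - \<phi> \<sigma>) \<in> coboundaries p X"
  by (cases p) (auto simp: coboundaries_def simp flip: coboundary_uminus intro!: imageI simp: singular_cochains_def)

lemma coboundaries_zero: "(\<lambda>\<sigma>. 0) \<in> coboundaries p X"
proof (cases p)
  case (Suc q) then show ?thesis
    using imageI[of "\<lambda>\<sigma>. 0" "singular_cochains q X" "coboundary q X"] by (simp add: coboundaries_def coboundary_zero singular_cochains_def)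
qed (simp add: coboundaries_def)

lemma coboundaries_sub: "coboundaries p X \<subseteq> cocycles p X"
  by (cases p) (auto simp: coboundaries_def cocycles_def coboundary_in coboundary_coboundary,
    auto simp: singular_cochains_def coboundary_zero)

lemma inv_cocycle: "\<phi> \<in> cocycles p X \<Longrightarrow> inv\<^bsub>cocycle_group p X\<^esub> \<phi> = (\<lambda>\<sigma>. - \<phi> \<sigma>)"
  by (rule comm_group.axioms(2)[OF comm_group_cocycle_group, THEN group.inv_equality])
    (auto simp: cocycle_group_def cocycles_def singular_cochains_def coboundary_uminus)

lemma normal_coboundaries: "coboundaries p X \<lhd> cocycle_group p X"
proof (rule comm_group.subgroup_imp_normal[OF comm_group_cocycle_group])
  interpret comm_group "cocycle_group p X" by (rule comm_group_cocycle_group)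
  show "subgroup (coboundaries p X) (cocycle_group p X)"
  proof (rule subgroupI)
    show "coboundaries p X \<subseteq> carrier (cocycle_group p X)" 
      using coboundaries_sub by (simp add: cocycle_group_def)
    show "inv\<^bsub>cocycle_group p X\<^esub> a \<in> coboundaries p X" if "a \<in> coboundaries p X" for a
      using that subsetD[OF coboundaries_sub that] by (simp add: inv_cocycle coboundaries_uminus)
  qed (use coboundaries_zero[of p X] in \<open>auto simp: cocycle_group_def coboundaries_add\<close>)
qed

lemma mem_cohomology_class: "\<psi> \<in> cohomology_class p X \<phi> \<longleftrightarrow> (\<lambda>\<sigma>. \<psi> \<sigma> - \<phi> \<sigma>) \<in> coboundaries p X"
proof
  assume "(\<lambda>\<sigma>. \<psi> \<sigma> - \<phi> \<sigma>) \<in> coboundaries p X"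
  then show "\<psi> \<in> cohomology_class p X \<phi>"
    unfolding cohomology_class_def r_coset_def cocycle_group_def
    by (auto intro!: bexI[of _ "\<lambda>\<sigma>. \<psi> \<sigma> - \<phi> \<sigma>"])
qed (auto simp: cohomology_class_def r_coset_def cocycle_group_def)

lemma cohomology_class_eq:
  assumes a: "\<psi> \<in> cohomology_class p X \<phi>"
  shows "cohomology_class p X \<psi> = cohomology_class p X \<phi>"
proof (intro Set.set_eqI iffI)
  fix \<theta>
  { assume "\<theta> \<in> cohomology_class p X \<psi>" with a show "\<theta> \<in> cohomology_class p X \<phi>"
      unfolding mem_cohomology_class using coboundaries_add[of "\<lambda>\<sigma>. \<theta> \<sigma> - \<psi> \<sigma>" p X "\<lambda>\<sigma>. \<psi> \<sigma> - \<phi> \<sigma>"] by simp }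
  { assume "\<theta> \<in> cohomology_class p X \<phi>" with a show "\<theta> \<in> cohomology_class p X \<psi>"
      unfolding mem_cohomology_class using coboundaries_add[OF _ coboundaries_uminus, of "\<lambda>\<sigma>. \<theta> \<sigma> - \<phi> \<sigma>" p X "\<lambda>\<sigma>. \<psi> \<sigma> - \<phi> \<sigma>"] by simp }
qed

lemma cohomology_class_self: "\<phi> \<in> cohomology_class p X \<phi>"
  by (simp add: mem_cohomology_class coboundaries_zero)

lemma carrier_cohomology_group: "carrier (cohomology_group p X) = cohomology_class p X ` cocycles p X"
  by (auto simp: cohomology_group_def carrier_FactGroup cohomology_class_def cocycle_group_def)

lemma one_cohomology_group: "\<one>\<^bsub>cohomology_group p X\<^esub> = cohomology_class p X (\<lambda>\<sigma>. 0)"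
  by (auto simp: cohomology_group_def mem_cohomology_class)

lemma simplex_map_face:
  assumes "singular_simplex (Suc p) Y \<sigma>" "k \<le> Suc p"
  shows "singular_face (Suc p) k (simplex_map (Suc p) f \<sigma>) = simplex_map p f (singular_face (Suc p) k \<sigma>)"
  using assms simplical_face_in_standard_simplex[of "Suc p" k]
  by (auto simp: simplex_map_def singular_face_def restrict_def fun_eq_iff)

lemma cochain_map_coboundary:
  assumes "continuous_map Y X f"
  shows "cochain_map (Suc p) Y f (coboundary p X \<phi>) = coboundary p Y (cochain_map p Y f \<phi>)"
proof
  fix \<sigma>
  show "cochain_map (Suc p) Y f (coboundary p X \<phi>) \<sigma> = coboundary p Y (cochain_map p Y f \<phi>) \<sigma>"
  proof (cases "singular_simplex (Suc p) Y \<sigma>")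
    case True
    have "singular_simplex p Y (singular_face (Suc p) k \<sigma>)" if "k \<le> Suc p" for k
      using singular_simplex_singular_face[OF True _ that] by simp
    with True assms show ?thesis
      by (simp add: cochain_map_def coboundary_def singular_simplex_simplex_map simplex_map_face)
  qed (simp add: cochain_map_def coboundary_def)
qed

lemma cochain_map_in: "cochain_map p Y f \<phi> \<in> singular_cochains p Y"
  by (simp add: cochain_map_def singular_cochains_def)

lemma cochain_map_coboundaries:
  assumes "continuous_map Y X f" "\<phi> \<in> coboundaries p X"
  shows "cochain_map p Y f \<phi> \<in> coboundaries p Y"
proof (cases p)
  case 0 with assms show ?thesis by (auto simp: coboundaries_def cochain_map_def fun_eq_iff)
next
  case (Suc q) with assms show ?thesis
    by (auto simp: coboundaries_def cochain_map_coboundary cochain_map_in)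
qed

lemma cohomology_map_cohomology_class:
  assumes "continuous_map Y X f"
  shows "cohomology_map p Y f (cohomology_class p X \<phi>) = cohomology_class p Y (cochain_map p Y f \<phi>)"
proof -
  have "cohomology_class p Y (cochain_map p Y f \<psi>) = cohomology_class p Y (cochain_map p Y f \<phi>)"
    if "\<psi> \<in> cohomology_class p X \<phi>" for \<psi>
  proof (rule cohomology_class_eq)
    have "cochain_map p Y f (\<lambda>\<sigma>. \<psi> \<sigma> - \<phi> \<sigma>) \<in> coboundaries p Y"
      by (rule cochain_map_coboundaries[OF assms that[unfolded mem_cohomology_class]])
    moreover have "cochain_map p Y f (\<lambda>\<sigma>. \<psi> \<sigma> - \<phi> \<sigma>) = (\<lambda>\<sigma>. cochain_map p Y f \<psi> \<sigma> - cochain_map p Y f \<phi> \<sigma>)"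
      by (auto simp: cochain_map_def)
    ultimately show "cochain_map p Y f \<psi> \<in> cohomology_class p Y (cochain_map p Y f \<phi>)" by (simp add: mem_cohomology_class)
  qed
  then show ?thesis
    unfolding cohomology_map_def
    by (intro equalityI UN_least UN_upper[OF cohomology_class_self]) simp
qed

lemma front_face_low:
  assumes "k \<le> Suc p"
  shows "front_face p (singular_face (Suc (p + q)) k \<sigma>) = singular_face (Suc p) k (front_face (Suc p) \<sigma>)"
proof
  fix x show "front_face p (singular_face (Suc (p + q)) k \<sigma>) x = singular_face (Suc p) k (front_face (Suc p) \<sigma>) x"
    using assms subsetD[OF standard_simplex_mono[of p "p+q"], of x] simplical_face_in_standard_simplex[of "Suc p" k x]
    by (simp add: front_face_def singular_face_def restrict_def)
qed

lemma front_face_high: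
  assumes "p < k"
  shows "front_face p (singular_face (Suc (p + q)) k \<sigma>) = front_face p \<sigma>"
proof -
  have "simplical_face k x = x" if "x \<in> standard_simplex p" for x
    using that assms by (auto simp: simplical_face_def standard_simplex_def fun_eq_iff)
  then show ?thesis
    using standard_simplex_mono[of p "p+q"]
    by (intro ext) (simp add: front_face_def singular_face_def restrict_def subset_iff)
qed

lemma back_face_low:
  assumes "k \<le> p"
  shows "back_face p q (singular_face (Suc (p + q)) k \<sigma>) = back_face (Suc p) q \<sigma>"
proof -
  have "simplical_face k (\<lambda>i. if i < p then 0 else x (i - p)) = (\<lambda>i. if i < Suc p then 0 else x (i - Suc p))" for x :: "nat \<Rightarrow> real"
    using assms by (auto simp: simplical_face_def fun_eq_iff)
  then show ?thesis
    by (intro ext) (simp add: back_face_def singular_face_def shift_in_standard_simplex restrict_def)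
qed

lemma back_face_high:
  assumes "k \<le> Suc q"
  shows "back_face p q (singular_face (Suc (p + q)) (p + k) \<sigma>) = singular_face (Suc q) k (back_face p (Suc q) \<sigma>)"
proof -
  have "simplical_face (p + k) (\<lambda>i. if i < p then 0 else x (i - p)) = (\<lambda>i. if i < p then 0 else simplical_face k x (i - p))" for x :: "nat \<Rightarrow> real"
    using assms by (auto simp: simplical_face_def fun_eq_iff)
  then show ?thesis
    using assms simplical_face_in_standard_simplex[of "Suc q" k]
    by (intro ext) (simp add: back_face_def singular_face_def shift_in_standard_simplex restrict_def)
qed

lemma coboundary_cup:
  "coboundary (p + q) X (cochain_cup p q X \<phi> \<psi>) =
   (\<lambda>\<sigma>. cochain_cup (Suc p) q X (coboundary p X \<phi>) \<psi> \<sigma> + (-1) ^ p * cochain_cup p (Suc q) X \<phi> (coboundary q X \<psi>) \<sigma>)"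
proof
  fix \<sigma>
  show "coboundary (p + q) X (cochain_cup p q X \<phi> \<psi>) \<sigma> =
   cochain_cup (Suc p) q X (coboundary p X \<phi>) \<psi> \<sigma> + (-1) ^ p * cochain_cup p (Suc q) X \<phi> (coboundary q X \<psi>) \<sigma>"
  proof (cases "singular_simplex (Suc (p + q)) X \<sigma>")
    case True
    have F: "singular_simplex (Suc p) X (front_face (Suc p) \<sigma>)" "singular_simplex (Suc q) X (back_face p (Suc q) \<sigma>)"
      using True singular_simplex_front_face[of "Suc p" q X \<sigma>] singular_simplex_back_face[of p "Suc q" X \<sigma>] by auto
    have S: "singular_simplex (p + q) X (singular_face (Suc (p + q)) k \<sigma>)" if "k \<le> Suc (p + q)" for k
      using singular_simplex_singular_face[OF True _ that] by simp
    define a where "a k = (-1) ^ k * \<phi> (singular_face (Suc p) k (front_face (Suc p) \<sigma>)) * \<psi> (back_face (Suc p) q \<sigma>)" for k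
    define b where "b k = (-1) ^ (p + k) * \<phi> (front_face p \<sigma>) * \<psi> (singular_face (Suc q) k (back_face p (Suc q) \<sigma>))" for k
    define g where "g k = (-1) ^ k * cochain_cup p q X \<phi> \<psi> (singular_face (Suc (p + q)) k \<sigma>)" for k
    have ga: "g k = a k" if "k \<le> p" for k
      using that S[of k] by (simp add: g_def a_def cochain_cup_def front_face_low back_face_low)
    have gb: "g (p + Suc k) = b (Suc k)" if "k \<le> q" for k
      using that S[of "p + Suc k"] front_face_high[of p "p + Suc k" q \<sigma>] back_face_high[of "Suc k" q p \<sigma>]
      by (simp add: g_def b_def cochain_cup_def del: add_Suc_right) 
    have c1: "front_face p \<sigma> = singular_face (Suc p) (Suc p) (front_face (Suc p) \<sigma>)"
      by (metis front_face_high front_face_low lessI order_refl)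
    have c2: "back_face (Suc p) q \<sigma> = singular_face (Suc q) 0 (back_face p (Suc q) \<sigma>)"
      by (metis back_face_high back_face_low add_0_right le0 order_refl)
    have cancel: "a (Suc p) + b 0 = 0"
      by (simp add: a_def b_def c1 c2)
    have "coboundary (p + q) X (cochain_cup p q X \<phi> \<psi>) \<sigma> = (\<Sum>k\<le>Suc (p + q). g k)"
      using True by (simp add: coboundary_def g_def del: sum.atMost_Suc)
    also have "\<dots> = (\<Sum>k\<le>p. g k) + (\<Sum>k\<le>q. g (p + Suc k))"
    proof -
      have "{..Suc (p+q)} = {..p} \<union> (\<lambda>k. p + Suc k) ` {..q}"
        by (auto simp: image_iff) (metis add_Suc_right atMost_iff le_Suc_ex nat_add_left_cancel_le not_less_eq_eq add_Suc)
      then show ?thesis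
        by (simp only:) (subst sum.union_disjoint, auto simp: sum.reindex inj_on_def)
    qed
    also have "\<dots> = (\<Sum>k\<le>p. a k) + (\<Sum>k\<le>q. b (Suc k))"
      by (simp add: ga gb del: add_Suc_right)
    also have "\<dots> = (\<Sum>k\<le>Suc p. a k) + (\<Sum>k\<le>Suc q. b k)"
      using cancel unfolding sum.atMost_Suc_shift[of b] by (simp add: algebra_simps)
    also have "(\<Sum>k\<le>Suc p. a k) = cochain_cup (Suc p) q X (coboundary p X \<phi>) \<psi> \<sigma>"
      using True F by (simp add: cochain_cup_def coboundary_def a_def sum_distrib_right del: sum.atMost_Suc)
    also have "(\<Sum>k\<le>Suc q. b k) = (-1) ^ p * cochain_cup p (Suc q) X \<phi> (coboundary q X \<psi>) \<sigma>"
      using True F by (simp add: cochain_cup_def coboundary_def b_def sum_distrib_left power_add mult_ac del: sum.atMost_Suc)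
    finally show ?thesis .
  qed (simp add: cochain_cup_def coboundary_def)
qed

lemma cochain_cup_in: "cochain_cup p q X \<phi> \<psi> \<in> singular_cochains (p + q) X"
  by (simp add: cochain_cup_def singular_cochains_def)

lemma cochain_cup_zero: "cochain_cup p q X (\<lambda>_. 0) \<psi> = (\<lambda>_. 0)" "cochain_cup p q X \<phi> (\<lambda>_. 0) = (\<lambda>_. 0)"
  by (auto simp: cochain_cup_def)

lemma cochain_cup_cocycle: "\<phi> \<in> cocycles p X \<Longrightarrow> \<psi> \<in> cocycles q X \<Longrightarrow> cochain_cup p q X \<phi> \<psi> \<in> cocycles (p + q) X"
  by (simp add: cocycles_def cochain_cup_in coboundary_cup cochain_cup_zero)

lemma cochain_cup_coboundary_left:
  assumes "\<phi> \<in> coboundaries p X" "\<psi> \<in> cocycles q X"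
  shows "cochain_cup p q X \<phi> \<psi> \<in> coboundaries (p + q) X"
proof (cases p)
  case 0 then show ?thesis using assms coboundaries_zero by (auto simp: coboundaries_def cochain_cup_zero)
next
  case (Suc r)
  then obtain \<beta> where "\<phi> = coboundary r X \<beta>" using assms by (auto simp: coboundaries_def)
  then have "cochain_cup p q X \<phi> \<psi> = coboundary (r + q) X (cochain_cup r q X \<beta> \<psi>)"
    using assms Suc by (simp add: coboundary_cup cocycles_def cochain_cup_zero)
  then show ?thesis using Suc by (auto simp: coboundaries_def cochain_cup_in)
qed

lemma cochain_cup_coboundary_right:
  assumes "\<phi> \<in> cocycles p X" "\<psi> \<in> coboundaries q X"
  shows "cochain_cup p q X \<phi> \<psi> \<in> coboundaries (p + q) X"
proof (cases q)
  case 0 then show ?thesis using assms coboundaries_zero by (auto simp: coboundaries_def cochain_cup_zero)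
next
  case (Suc r)
  then obtain \<beta> where b: "\<psi> = coboundary r X \<beta>" using assms by (auto simp: coboundaries_def)
  have "cochain_cup p q X \<phi> \<psi> = coboundary (p + r) X (cochain_cup p r X \<phi> (\<lambda>\<sigma>. (-1) ^ p * \<beta> \<sigma>))"
  proof -
    have "coboundary r X (\<lambda>\<sigma>. (-1) ^ p * \<beta> \<sigma>) = (\<lambda>\<sigma>. (-1)^p * coboundary r X \<beta> \<sigma>)"
      by (auto simp: coboundary_def sum_distrib_left mult_ac fun_eq_iff simp del: sum.atMost_Suc)
    moreover have "(-1) ^ p * cochain_cup p (Suc r) X \<phi> (\<lambda>\<sigma>. (-1)^p * \<psi> \<sigma>) \<sigma> = cochain_cup p (Suc r) X \<phi> \<psi> \<sigma>" for \<sigma>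
      by (cases "even p") (auto simp: cochain_cup_def)
    ultimately show ?thesis
      using assms Suc b by (simp add: coboundary_cup cocycles_def cochain_cup_zero)
  qed
  then show ?thesis using Suc by (auto simp: coboundaries_def cochain_cup_in)
qed

lemma cup_cohomology_class:
  assumes "\<phi> \<in> cocycles p X" "\<psi> \<in> cocycles q X"
  shows "cup p q X (cohomology_class p X \<phi>) (cohomology_class q X \<psi>) = cohomology_class (p + q) X (cochain_cup p q X \<phi> \<psi>)"
proof -
  have "cohomology_class (p + q) X (cochain_cup p q X \<phi>' \<psi>') = cohomology_class (p + q) X (cochain_cup p q X \<phi> \<psi>)"
    if "\<phi>' \<in> cohomology_class p X \<phi>" "\<psi>' \<in> cohomology_class q X \<psi>" for \<phi>' \<psi>'
  proof (rule cohomology_class_eq)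
    have *: "(\<lambda>\<sigma>. \<phi>' \<sigma> - \<phi> \<sigma>) \<in> coboundaries p X" "(\<lambda>\<sigma>. \<psi>' \<sigma> - \<psi> \<sigma>) \<in> coboundaries q X"
      using that by (auto simp: mem_cohomology_class)
    have "\<phi>' = (\<lambda>\<sigma>. (\<phi>' \<sigma> - \<phi> \<sigma>) + \<phi> \<sigma>)" by simp
    moreover have "\<dots> \<in> cocycles p X"
      using *(1) assms(1) coboundaries_sub monoid.m_closed[OF group.is_monoid[OF comm_group.axioms(2)[OF comm_group_cocycle_group[of p X]]]]
      unfolding cocycle_group_def by fastforce
    ultimately have "\<phi>' \<in> cocycles p X" by simp
    then have "(\<lambda>\<sigma>. cochain_cup p q X (\<lambda>\<sigma>. \<phi>' \<sigma> - \<phi> \<sigma>) \<psi> \<sigma> + cochain_cup p q X \<phi>' (\<lambda>\<sigma>. \<psi>' \<sigma> - \<psi> \<sigma>) \<sigma>) \<in> coboundaries (p + q) X"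
      using * assms by (intro coboundaries_add cochain_cup_coboundary_left cochain_cup_coboundary_right)
    moreover have "(\<lambda>\<sigma>. cochain_cup p q X (\<lambda>\<sigma>. \<phi>' \<sigma> - \<phi> \<sigma>) \<psi> \<sigma> + cochain_cup p q X \<phi>' (\<lambda>\<sigma>. \<psi>' \<sigma> - \<psi> \<sigma>) \<sigma>)
       = (\<lambda>\<sigma>. cochain_cup p q X \<phi>' \<psi>' \<sigma> - cochain_cup p q X \<phi> \<psi> \<sigma>)"
      by (auto simp: cochain_cup_def algebra_simps fun_eq_iff)
    ultimately show "cochain_cup p q X \<phi>' \<psi>' \<in> cohomology_class (p + q) X (cochain_cup p q X \<phi> \<psi>)"
      by (simp add: mem_cohomology_class)
  qed
  then show ?thesis
    unfolding cup_def
    by (intro equalityI UN_least order_trans[OF UN_upper[OF cohomology_class_self]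
          UN_upper[OF cohomology_class_self]]) simp
qed

lemma unit_cocycle: "unit_cochain X \<in> cocycles 0 X"
  using singular_simplex_singular_face[of "Suc 0" X]
  by (auto simp: unit_cochain_def cocycles_def singular_cochains_def coboundary_def fun_eq_iff)

lemma cochain_cup_unit: "\<phi> \<in> singular_cochains p X \<Longrightarrow> cochain_cup 0 p X (unit_cochain X) \<phi> = \<phi>"
proof
  fix \<sigma> assume \<phi>: "\<phi> \<in> singular_cochains p X"
  show "cochain_cup 0 p X (unit_cochain X) \<phi> \<sigma> = \<phi> \<sigma>"
  proof (cases "singular_simplex p X \<sigma>")
    case True
    then have "back_face 0 p \<sigma> = \<sigma>" by (auto simp: back_face_def singular_simplex_def extensional_restrict)
    then show ?thesis using True singular_simplex_front_face[of 0 p X \<sigma>] by (simp add: cochain_cup_def unit_cochain_def)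
  qed (use \<phi> in \<open>simp add: cochain_cup_def singular_cochains_def\<close>)
qed

lemma iterated_cup_1:
  assumes "u 1 \<in> carrier (cohomology_group p X)"
  shows "iterated_cup p X u 1 = u 1"
proof -
  obtain \<phi> where "\<phi> \<in> cocycles p X" "u 1 = cohomology_class p X \<phi>" using assms by (auto simp: carrier_cohomology_group)
  then show ?thesis using cup_cohomology_class[OF unit_cocycle, of \<phi> p] cochain_cup_unit[of \<phi> p X]
    by (simp add: cocycles_def)
qed

lemma iterated_cup_carrier:
  assumes "\<And>j. j \<in> {1..m} \<Longrightarrow> u j \<in> carrier (cohomology_group p X)"
  shows "iterated_cup p X u m \<in> carrier (cohomology_group (m * p) X)"
  using assms
proof (induction m)
  case 0 then show ?case by (auto simp: carrier_cohomology_group unit_cocycle)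
next
  case (Suc m)
  then have "iterated_cup p X u m \<in> carrier (cohomology_group (m * p) X)" "u (Suc m) \<in> carrier (cohomology_group p X)" by auto
  then show ?case by (auto simp: carrier_cohomology_group cup_cohomology_class add.commute[of p] intro!: imageI cochain_cup_cocycle)
qed


section \<open>Atoroidal classes\<close>

definition torus :: "nat \<Rightarrow> (nat \<Rightarrow> complex) topology" where
  "torus k = product_topology (\<lambda>i. top_of_set (sphere 0 1)) {..<k}"

definition atoroidal :: "nat \<Rightarrow> 'a topology \<Rightarrow> ('a, 'f::comm_ring_1) cochain set \<Rightarrow> bool" where
  "atoroidal k X u \<longleftrightarrow>
     u \<in> carrier (cohomology_group k X) \<and>
     (\<forall>f. continuous_map (torus k) X f \<longrightarrow>
          cohomology_map k (torus k) f u = \<one>\<^bsub>cohomology_group k (torus k)\<^esub>)"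


section \<open>CW complexes\<close>

definition closed_disk :: "nat \<Rightarrow> (nat \<Rightarrow> real) set" where
  "closed_disk m = {x \<in> topspace (Euclidean_space m). (\<Sum>i<m. (x i)\<^sup>2) \<le> 1}"

definition open_disk :: "nat \<Rightarrow> (nat \<Rightarrow> real) set" where
  "open_disk m = {x \<in> topspace (Euclidean_space m). (\<Sum>i<m. (x i)\<^sup>2) < 1}"

text \<open>
  Whitehead's definition. A cell structure on X consists of the set E of its open cells, their
  dimensions d, and a characteristic map \<open>\<Phi> e\<close> for each cell e. Indexing by the cells
  themselves loses nothing, since distinct cells are disjoint and nonempty. The last two conditions
  are closure-finiteness and the weak topology.
\<close>

definition cw_complex ::
    "'a topology \<Rightarrow> 'a set set \<Rightarrow> ('a set \<Rightarrow> nat) \<Rightarrow> ('a set \<Rightarrow> (nat \<Rightarrow> real) \<Rightarrow> 'a) \<Rightarrow> bool" where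
  "cw_complex X E d \<Phi> \<longleftrightarrow>
     Hausdorff_space X \<and>
     pairwise disjnt E \<and> \<Union>E = topspace X \<and>
     (\<forall>e\<in>E.
        continuous_map (subtopology (Euclidean_space (d e)) (closed_disk (d e))) X (\<Phi> e) \<and>
        homeomorphic_map (subtopology (Euclidean_space (d e)) (open_disk (d e)))
                         (subtopology X e) (\<Phi> e) \<and>
        (\<exists>C. finite C \<and> C \<subseteq> {c \<in> E. d c < d e} \<and>
             \<Phi> e ` (closed_disk (d e) - open_disk (d e)) \<subseteq> \<Union>C)) \<and>
     (\<forall>A\<subseteq>topspace X. closedin X A \<longleftrightarrow> (\<forall>e\<in>E. closedin X (A \<inter> Abstract_Topology.closure_of X e)))"

text \<open>By the convention for suprema in \<open>enat\<close>, the empty complex gets dimension 0.\<close>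

definition cw_dim :: "'a set set \<Rightarrow> ('a set \<Rightarrow> nat) \<Rightarrow> enat" where
  "cw_dim E d = (SUP e\<in>E. enat (d e))"


section \<open>Topological complexity\<close>

definition compact_open_topology :: "'b topology \<Rightarrow> 'a topology \<Rightarrow> ('b \<Rightarrow> 'a) topology" where
  "compact_open_topology Y X =
     topology_generated_by
       {{g \<in> extensional (topspace Y). continuous_map Y X g \<and> g ` K \<subseteq> U} | K U.
          compactin Y K \<and> openin X U}"

definition path_space :: "'a topology \<Rightarrow> (real \<Rightarrow> 'a) topology" where
  "path_space X = compact_open_topology (top_of_set {0..1}) X"

lemma topspace_path_space: "topspace (path_space X) = {g \<in> extensional {0..1}. pathin X g}"
  unfolding path_space_def compact_open_topology_def topology_generated_by_topspace pathin_def
  by auto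

definition path_ends :: "(real \<Rightarrow> 'a) \<Rightarrow> 'a \<times> 'a" where
  "path_ends \<gamma> = (\<gamma> 0, \<gamma> 1)"

text \<open>The infimum in \<open>enat\<close> of the empty set is \<open>\<infinity>\<close>.\<close>

definition topological_complexity :: "'a topology \<Rightarrow> enat" where
  "topological_complexity X =
     Inf {enat k | k. \<exists>U :: nat \<Rightarrow> ('a \<times> 'a) set.
            (\<Union>j\<le>k. U j) = topspace (prod_topology X X) \<and>
            (\<forall>j\<le>k. openin (prod_topology X X) (U j) \<and>
                   (\<exists>s. continuous_map (subtopology (prod_topology X X) (U j)) (path_space X) s \<and>
                        (\<forall>z\<in>U j. path_ends (s z) = z)))}"

end

theory Submission
  imports Defs "HOL-Analysis.Analysis" "HOL-Library.Function_Algebras"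
begin

text \<open>
  A class u of degree two on X yields the zero-divisor 1 x u - u x 1 on X x X. Over an open set with
  a motion planner the zero-divisor is the coboundary of a cochain given by a prism operator. Over
  the intersection of two such sets, the two cochains differ by a cocycle of degree one whose value
  on a loop is the value of u on a torus. So if u is atoroidal, the zero-divisor is cohomologous to a
  cocycle that vanishes on the simplices of both sets, and a product of 2n such zero-divisors vanishes
  if X x X is covered by 4n open sets with motion planners. However, the product of the squares of
  the zero-divisors of the classes u j takes the value (-2)^n c^2 on the cross product of z with
  itself, where z is a cycle on which the product of the u j takes the value c. Indeed, in the shuffle
  formula for the cross product only the lattice paths that consist of double steps contribute, and
  among these only the ones in which each u j is used once horizontally and once vertically, since
  the square of u j is zero. This gives the lower bound.

  For the upper bound, collars of the cells provide functions f 0, ..., f (2n) with sum one such that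
  the points with f i > 0 form a disjoint union of open sets contractible in X. The 4n + 1 open sets
  are the unions over i + j = l of the sets where the i-th and the j-th interval of the two resulting
  subdivisions of the unit interval overlap.
\<close>

section \<open>Shuffles\<close>

text \<open>Giving each zero-divisor two open sets is what makes the bound sharp: 2n factors of
  degree two absorb 4n sets, whereas one set per factor, as for arbitrary classes, would give half
  the bound. The torus arises because two motion planners on the same domain have the same end
  points, so along a loop they close up to a map from a product of two circles. The factor -2 is the
  square of 1 x u - u x 1 modulo the square of u: the two mixed terms have sign -1 and add up
  instead of cancelling because u has even degree, so 2 must be invertible. All products are
  computed with cochains rather than classes, so lattice paths with a turn also produce degenerate
  simplices; normalised representatives make these contribute nothing. Hence all functions and
  contractions are built on X, where maps can be checked cell by cell, and are pulled back along the
  projections.\<close>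

definition remove_nth :: "nat \<Rightarrow> 'b list \<Rightarrow> 'b list" where
  "remove_nth k l = take k l @ drop (Suc k) l"

lemma remove_nth_0 [simp]: "remove_nth 0 (a # l) = l"
  and remove_nth_Suc [simp]: "remove_nth (Suc k) (a # l) = a # remove_nth k l"
  by (simp_all add: remove_nth_def)

lemma length_remove_nth: "k < length l \<Longrightarrow> length (remove_nth k l) = length l - 1"
  by (simp add: remove_nth_def)

lemma remove_nth_map: "remove_nth k (map f l) = map f (remove_nth k l)"
  by (simp add: remove_nth_def take_map drop_map)

lemma nth_remove_nth:
  "k < length l \<Longrightarrow> j < length l - 1 \<Longrightarrow> remove_nth k l ! j = l ! (if j < k then j else Suc j)"
  by (auto simp: remove_nth_def nth_append)

definition list_coboundary :: "('b list \<Rightarrow> 'f::comm_ring_1) \<Rightarrow> 'b list \<Rightarrow> 'f" where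
  "list_coboundary G l = (\<Sum>k<length l. (-1) ^ k * G (remove_nth k l))"

lemma list_coboundary_Cons:
  "list_coboundary G (a # l) = G l - list_coboundary (\<lambda>l. G (a # l)) l"
  by (simp add: list_coboundary_def sum.lessThan_Suc_shift sum_negf del: sum.lessThan_Suc)

text \<open>The Eilenberg--Zilber map in dual form: the sum of G over the lattice paths through the grid of
  the vertices I and J, with the sign of the corresponding shuffle.\<close>

function shuffle_sum :: "'i list \<Rightarrow> 'j list \<Rightarrow> (('i \<times> 'j) list \<Rightarrow> 'f::comm_ring_1) \<Rightarrow> 'f" where
  "shuffle_sum [] J G = 0"
| "shuffle_sum (i # I) [] G = 0"
| "shuffle_sum (i # I) (j # J) G =
     (if I = [] \<and> J = [] then G [(i, j)]
      else shuffle_sum I (j # J) (\<lambda>l. G ((i, j) # l))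
         + (-1) ^ length I * shuffle_sum (i # I) J (\<lambda>l. G ((i, j) # l)))"
  by pat_completeness auto
termination by (relation "Wellfounded.measure (\<lambda>(I, J, G). length I + length J)") auto

lemma shuffle_sum_Nil2 [simp]: "shuffle_sum I [] G = 0"
  by (cases I) auto

lemma shuffle_sum_cong:
  assumes "\<And>l. length l + 1 = length I + length J \<Longrightarrow> set l \<subseteq> set I \<times> set J \<Longrightarrow> G l = G' l"
  shows "shuffle_sum I J G = shuffle_sum I J G'"
  using assms
proof (induction I J G arbitrary: G' rule: shuffle_sum.induct)
  case (3 i I j J G)
  show ?case
  proof (cases "I = [] \<and> J = []")
    case True then show ?thesis using 3(3) by simp
  next
    case False
    have "shuffle_sum I (j # J) (\<lambda>l. G ((i, j) # l)) = shuffle_sum I (j # J) (\<lambda>l. G' ((i, j) # l))"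
      by (rule 3(1)[OF False]) (use 3(3) in \<open>fastforce intro!: 3(3)\<close>)
    moreover have "shuffle_sum (i # I) J (\<lambda>l. G ((i, j) # l)) = shuffle_sum (i # I) J (\<lambda>l. G' ((i, j) # l))"
      by (rule 3(2)[OF False]) (use 3(3) in \<open>fastforce intro!: 3(3)\<close>)
    ultimately show ?thesis using False by auto
  qed
qed auto

lemma shuffle_sum_add:
  "shuffle_sum I J (\<lambda>l. G l + G' l) = shuffle_sum I J G + shuffle_sum I J G'"
proof (induction I J G arbitrary: G' rule: shuffle_sum.induct)
  case (3 i I j J G) then show ?case by (simp add: algebra_simps)
qed auto

lemma shuffle_sum_mult: "shuffle_sum I J (\<lambda>l. c * G l) = c * shuffle_sum I J G"
proof (induction I J G rule: shuffle_sum.induct)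
  case (3 i I j J G) then show ?case by (simp add: algebra_simps)
qed auto

lemma shuffle_sum_uminus: "shuffle_sum I J (\<lambda>l. - G l) = - shuffle_sum I J G"
  using shuffle_sum_mult[of I J "-1" G] by simp

lemma shuffle_sum_diff:
  "shuffle_sum I J (\<lambda>l. G l - G' l) = shuffle_sum I J G - shuffle_sum I J G'"
  using shuffle_sum_add[of I J G "\<lambda>l. - G' l"] by (simp add: shuffle_sum_uminus)

lemma shuffle_sum_zero [simp]: "shuffle_sum I J (\<lambda>l. 0) = 0"
  using shuffle_sum_mult[of I J 0 "\<lambda>l. 0"] by simp

text \<open>Dual form of the fact that the shuffle map is a chain map. Deleting the vertex at a
  corner cancels against the path with the opposite corner; every other deletion leaves a path in a
  grid with one row or column removed. The induction follows the first step of the path, and the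
  sign \<open>- (-1) ^ length I\<close> is (-1)^p for the dimension p = \<open>length I - 1\<close>
  of the first simplex.\<close>

lemma shuffle_sum_list_coboundary:
  assumes "length I + length J > 2" "I \<noteq> []" "J \<noteq> []"
  shows "shuffle_sum I J (list_coboundary G) =
     (\<Sum>k<length I. (-1) ^ k * shuffle_sum (remove_nth k I) J G)
     - (-1) ^ length I * (\<Sum>k<length J. (-1) ^ k * shuffle_sum I (remove_nth k J) G)"
  using assms
proof (induction I J G rule: shuffle_sum.induct)
  case (3 i I j J G)
  define Ga where "Ga = (\<lambda>l. G ((i, j) # l))"
  have ne: "\<not> (I = [] \<and> J = [])" using 3(3) by auto
  \<comment> \<open>The exceptional value covers the grid with one point, which the induction
    hypothesis excludes: there the coboundary deletes the only vertex and leaves the empty list. The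
    same value reappears in C1 and, symmetrically, in B and C2.\<close>
  have A: "shuffle_sum I (j # J) (list_coboundary Ga) =
     (if J = [] \<and> length I = 1 then Ga [] else
     (\<Sum>k<length I. (-1) ^ k * shuffle_sum (remove_nth k I) (j # J) Ga)
     - (-1) ^ length I * (\<Sum>k<Suc (length J). (-1) ^ k * shuffle_sum I (remove_nth k (j # J)) Ga))"
  proof (cases "I = []")
    case False
    show ?thesis
    proof (cases "J = [] \<and> length I = 1")
      case True
      then obtain i' where "I = [i']" by (cases I) auto
      with True show ?thesis by (simp add: list_coboundary_def)
    next
      case F: False
      then have "length I + length (j # J) > 2" using False by (cases I; cases J) auto
      then show ?thesis using 3(1)[OF ne] False F by (auto simp add: Ga_def simp del: sum.lessThan_Suc)
    qed
  qed (use ne in simp)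
  have B: "shuffle_sum (i # I) J (list_coboundary Ga) =
     (if I = [] \<and> length J = 1 then Ga [] else
     (\<Sum>k<Suc (length I). (-1) ^ k * shuffle_sum (remove_nth k (i # I)) J Ga)
     + (-1) ^ length I * (\<Sum>k<length J. (-1) ^ k * shuffle_sum (i # I) (remove_nth k J) Ga))"
  proof (cases "J = []")
    case False
    show ?thesis
    proof (cases "I = [] \<and> length J = 1")
      case True
      then obtain j' where "J = [j']" by (cases J) auto
      with True show ?thesis by (simp add: list_coboundary_def)
    next
      case F: False
      then have "length (i # I) + length J > 2" using False by (cases I; cases J) auto
      then show ?thesis using 3(2)[OF ne] False F by (auto simp add: Ga_def simp del: sum.lessThan_Suc)
    qed
  qed (use ne in simp)
  have C1: "(\<Sum>k<length I. (-1) ^ k * shuffle_sum (i # remove_nth k I) (j # J) G)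
     = (if J = [] \<and> length I = 1 then Ga [] else
        (\<Sum>k<length I. (-1) ^ k * shuffle_sum (remove_nth k I) (j # J) Ga)
      - (-1) ^ length I * (\<Sum>k<length I. (-1) ^ k * shuffle_sum (i # remove_nth k I) J Ga))"
  proof (cases "J = [] \<and> length I = 1")
    case True
    then obtain i' where "I = [i']" by (cases I) auto
    with True show ?thesis by (simp add: Ga_def)
  next
    case False
    have "(-1) ^ k * shuffle_sum (i # remove_nth k I) (j # J) G =
        (-1) ^ k * shuffle_sum (remove_nth k I) (j # J) Ga
      - (-1) ^ length I * ((-1) ^ k * shuffle_sum (i # remove_nth k I) J Ga)" if "k < length I" for k
    proof -
      have "\<not> (remove_nth k I = [] \<and> J = [])"
        using False that length_remove_nth[OF that] by auto
      moreover have "(-1::'c) ^ length I = - ((-1) ^ (length I - 1))" using that by (cases I) auto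
      ultimately show ?thesis
        using length_remove_nth[OF that] by (auto simp add: Ga_def algebra_simps)
    qed
    then have "(\<Sum>k<length I. (-1) ^ k * shuffle_sum (i # remove_nth k I) (j # J) G)
       = (\<Sum>k<length I. (-1) ^ k * shuffle_sum (remove_nth k I) (j # J) Ga
      - (-1) ^ length I * ((-1) ^ k * shuffle_sum (i # remove_nth k I) J Ga))"
      by (intro sum.cong) auto
    then show ?thesis using False by (auto simp: sum_subtractf sum_distrib_left simp del: shuffle_sum.simps)
  qed
  have C2: "(\<Sum>k<length J. (-1) ^ k * shuffle_sum (i # I) (j # remove_nth k J) G)
     = (if I = [] \<and> length J = 1 then Ga [] else
        (\<Sum>k<length J. (-1) ^ k * shuffle_sum I (j # remove_nth k J) Ga)
      + (-1) ^ length I * (\<Sum>k<length J. (-1) ^ k * shuffle_sum (i # I) (remove_nth k J) Ga))"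
  proof (cases "I = [] \<and> length J = 1")
    case True
    then obtain i' where "J = [i']" by (cases J) auto
    with True show ?thesis by (simp add: Ga_def)
  next
    case False
    have "(-1) ^ k * shuffle_sum (i # I) (j # remove_nth k J) G =
        (-1) ^ k * shuffle_sum I (j # remove_nth k J) Ga
      + (-1) ^ length I * ((-1) ^ k * shuffle_sum (i # I) (remove_nth k J) Ga)" if "k < length J" for k
    proof -
      have "\<not> (I = [] \<and> remove_nth k J = [])"
        using False that length_remove_nth[OF that] by auto
      then show ?thesis by (auto simp add: Ga_def algebra_simps)
    qed
    then have "(\<Sum>k<length J. (-1) ^ k * shuffle_sum (i # I) (j # remove_nth k J) G)
       = (\<Sum>k<length J. (-1) ^ k * shuffle_sum I (j # remove_nth k J) Ga
      + (-1) ^ length I * ((-1) ^ k * shuffle_sum (i # I) (remove_nth k J) Ga))"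
      by (intro sum.cong) auto
    then show ?thesis using False by (auto simp: sum.distrib sum_distrib_left simp del: shuffle_sum.simps)
  qed
  have L: "shuffle_sum (i # I) (j # J) (list_coboundary G) =
     shuffle_sum I (j # J) G - shuffle_sum I (j # J) (list_coboundary Ga)
     + (-1) ^ length I * (shuffle_sum (i # I) J G - shuffle_sum (i # I) J (list_coboundary Ga))"
    using ne by (auto simp add: list_coboundary_Cons shuffle_sum_diff simp flip: Ga_def)
  show ?case
    unfolding L A B
    by (auto simp add: sum.lessThan_Suc_shift sum_negf C1 C2 algebra_simps ne shuffle_sum.simps(1)
        simp del: sum.lessThan_Suc shuffle_sum.simps(2,3))
qed auto

section \<open>Affine simplices in a simplex and in a product of two simplices, given by vertex
  lists\<close>

definition vertex_map :: "nat list \<Rightarrow> (nat \<Rightarrow> real) \<Rightarrow> nat \<Rightarrow> real" where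
  "vertex_map l x = (\<lambda>i. \<Sum>j<length l. if l ! j = i then x j else 0)"

lemma vertex_map_in_standard_simplex:
  assumes "x \<in> standard_simplex r" "length l = Suc r" "set l \<subseteq> {..p}"
  shows "vertex_map l x \<in> standard_simplex p"
proof -
  have x: "\<And>i. 0 \<le> x i" "(\<Sum>i\<le>r. x i) = 1" using assms by (auto simp: standard_simplex_def)
  have len: "{..<length l} = {..r}" using assms by auto
  have "vertex_map l x i \<le> (\<Sum>j<length l. x j)" for i
    unfolding vertex_map_def by (rule sum_mono) (use x in auto)
  moreover have "vertex_map l x i = 0" if "i > p" for i
    unfolding vertex_map_def using assms(3) that
    by (intro sum.neutral) (metis atMost_iff lessThan_iff not_le nth_mem subset_iff)
  moreover have "(\<Sum>i\<le>p. vertex_map l x i) = (\<Sum>j<length l. \<Sum>i\<le>p. if l ! j = i then x j else 0)"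
    unfolding vertex_map_def by (rule sum.swap)
  moreover have "\<dots> = (\<Sum>j<length l. x j)"
    using assms(3) by (intro sum.cong refl) (auto simp: sum.delta nth_mem subset_iff)
  ultimately show ?thesis
    using x len by (auto simp: standard_simplex_def) (auto simp: vertex_map_def intro: sum_nonneg)
qed

lemma continuous_map_vertex_map:
  assumes "length l = Suc r" "set l \<subseteq> {..p}"
  shows "continuous_map (subtopology (powertop_real UNIV) (standard_simplex r))
           (subtopology (powertop_real UNIV) (standard_simplex p)) (vertex_map l)"
proof -
  have "continuous_map (powertop_real UNIV) euclideanreal (\<lambda>x. if l ! j = i then x j else 0)" for i j
    by (cases "l ! j = i") (auto intro: continuous_map_product_projection)
  then have "continuous_map (powertop_real UNIV) euclideanreal (\<lambda>x. vertex_map l x i)" for i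
    unfolding vertex_map_def by (intro continuous_map_sum) auto
  then show ?thesis
    using assms by (auto simp: continuous_map_in_subtopology continuous_map_componentwise
        vertex_map_in_standard_simplex intro!: continuous_map_from_subtopology)
qed

lemma vertex_map_simplical_face:
  assumes "k < length l"
  shows "vertex_map l (simplical_face k x) = vertex_map (remove_nth k l) x"
proof
  fix i
  obtain m where m: "length l = Suc m" using assms by (cases l) auto
  have "vertex_map l (simplical_face k x) i = (\<Sum>j\<le>m. (if j < k then (if l!j=i then x j else 0)
        else if j = k then 0 else (if l ! Suc (j - 1) = i then x (j - Suc 0) else 0)))"
    unfolding vertex_map_def m simplical_face_def lessThan_Suc_atMost by (intro sum.cong) auto
  also have "\<dots> = (\<Sum>j<m. if (remove_nth k l) ! j = i then x j else 0)"
  proof (cases "m = 0")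
    case True with assms m show ?thesis by simp
  next
    case False
    have "(\<Sum>j\<le>m. (if j < k then (if l!j=i then x j else 0)
        else if j = k then 0 else (if l ! Suc (j - Suc 0) = i then x (j - Suc 0) else 0)))
       = (\<Sum>j\<le>m - Suc 0. if j < k then (if l!j=i then x j else 0) else (if l ! Suc j = i then x j else 0))"
      using sum.zero_middle[of m k "\<lambda>j. if l!j=i then x j else 0" "\<lambda>j. if l ! Suc j = i then x j else 0"]
        False assms m by simp
    also have "\<dots> = (\<Sum>j<m. if (remove_nth k l) ! j = i then x j else 0)"
      using False assms m by (intro sum.cong) (auto simp: nth_remove_nth)
    finally show ?thesis unfolding One_nat_def .
  qed
  finally show "vertex_map l (simplical_face k x) i = vertex_map (remove_nth k l) x i"
    using m assms by (simp add: vertex_map_def length_remove_nth)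
qed

lemma vertex_map_take:
  assumes "x \<in> standard_simplex r" "Suc r \<le> length l"
  shows "vertex_map l x = vertex_map (take (Suc r) l) x"
proof
  fix i
  have "(\<Sum>j<length l. if l ! j = i then x j else 0) = (\<Sum>j<Suc r. if l ! j = i then x j else 0)"
    using assms by (intro sum.mono_neutral_cong_right) (auto simp: standard_simplex_def)
  then show "vertex_map l x i = vertex_map (take (Suc r) l) x i"
    using assms by (simp add: vertex_map_def min_absorb2 del: sum.lessThan_Suc)
qed

lemma vertex_map_drop:
  assumes "m \<le> length l"
  shows "vertex_map l (\<lambda>i. if i < m then 0 else x (i - m)) = vertex_map (drop m l) x"
proof
  fix i
  have "(\<Sum>j<length l. if l ! j = i then if j < m then 0 else x (j - m) else 0)
     = (\<Sum>j\<in>{m..<length l}. if l ! j = i then x (j - m) else 0)"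
    by (rule sum.mono_neutral_cong_right) auto
  also have "\<dots> = (\<Sum>j<length l - m. if l ! (m + j) = i then x j else 0)"
    using assms sum.shift_bounds_nat_ivl[of "\<lambda>j. if l ! j = i then x (j - m) else 0" 0 m "length l - m"]
    by (simp add: lessThan_atLeast0 add.commute cong: if_cong)
  finally show "vertex_map l (\<lambda>i. if i < m then 0 else x (i - m)) i = vertex_map (drop m l) x i"
    using assms by (simp add: vertex_map_def)
qed

text \<open>If \<open>l\<close> is a lattice path, this is K on one simplex of the standard
  triangulation of a product of two simplices. With simplices encoded as lists, faces become
  deletions and the faces in a cup product become \<open>take\<close> and \<open>drop\<close>;
  repeated vertices are allowed.\<close>

definition bisimplex ::
    "((nat \<Rightarrow> real) \<Rightarrow> (nat \<Rightarrow> real) \<Rightarrow> 'a) \<Rightarrow> (nat \<times> nat) list \<Rightarrow> (nat \<Rightarrow> real) \<Rightarrow> 'a" where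
  "bisimplex K l =
     restrict (\<lambda>x. K (vertex_map (map fst l) x) (vertex_map (map snd l) x)) (standard_simplex (length l - 1))"

definition bicontinuous :: "nat \<Rightarrow> nat \<Rightarrow> 'a topology \<Rightarrow> ((nat \<Rightarrow> real) \<Rightarrow> (nat \<Rightarrow> real) \<Rightarrow> 'a) \<Rightarrow> bool" where
  "bicontinuous p q Y K \<longleftrightarrow>
     continuous_map (prod_topology (subtopology (powertop_real UNIV) (standard_simplex p))
                                   (subtopology (powertop_real UNIV) (standard_simplex q))) Y (\<lambda>(x, y). K x y)"

lemma singular_simplex_bisimplex:
  assumes "bicontinuous p q Y K" "length l = Suc r" "set l \<subseteq> {..p} \<times> {..q}"
  shows "singular_simplex r Y (bisimplex K l)"
proof -
  have "set (map fst l) \<subseteq> {..p}" "set (map snd l) \<subseteq> {..q}" using assms(3) by auto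
  then have "continuous_map (subtopology (powertop_real UNIV) (standard_simplex r))
     (prod_topology (subtopology (powertop_real UNIV) (standard_simplex p))
        (subtopology (powertop_real UNIV) (standard_simplex q)))
     (\<lambda>x. (vertex_map (map fst l) x, vertex_map (map snd l) x))"
    using continuous_map_vertex_map[of "map fst l" r p] continuous_map_vertex_map[of "map snd l" r q] assms(2)
    by (simp add: continuous_map_paired)
  from continuous_map_compose[OF this assms(1)[unfolded bicontinuous_def]]
  have "continuous_map (subtopology (powertop_real UNIV) (standard_simplex r)) Y
     (\<lambda>x. K (vertex_map (map fst l) x) (vertex_map (map snd l) x))"
    by (simp add: o_def)
  then show ?thesis
    using assms(2) unfolding singular_simplex_def bisimplex_def
    by (auto intro: continuous_map_eq)
qed

lemma singular_face_bisimplex: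
  assumes "length l = Suc r" "r > 0" "k \<le> r"
  shows "singular_face r k (bisimplex K l) = bisimplex K (remove_nth k l)"
proof -
  have "singular_face r k (bisimplex K l) x = bisimplex K (remove_nth k l) x" for x
    using assms simplical_face_in_standard_simplex[of r k x]
    by (simp add: singular_face_def bisimplex_def length_remove_nth vertex_map_simplical_face remove_nth_map restrict_def)
  then show ?thesis by blast
qed

lemma coboundary_bisimplex:
  assumes "bicontinuous p q Y K" "length l = Suc (Suc r)" "set l \<subseteq> {..p} \<times> {..q}"
  shows "coboundary r Y \<phi> (bisimplex K l) = list_coboundary (\<lambda>l. \<phi> (bisimplex K l)) l"
  using assms singular_simplex_bisimplex[OF assms]
  by (simp add: coboundary_def list_coboundary_def singular_face_bisimplex lessThan_Suc_atMost
      del: sum.lessThan_Suc sum.atMost_Suc)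

lemma cochain_cup_bisimplex:
  assumes "bicontinuous m n Y K" "length l = Suc (p + q)" "set l \<subseteq> {..m} \<times> {..n}"
  shows "cochain_cup p q Y \<phi> \<psi> (bisimplex K l) =
    \<phi> (bisimplex K (take (Suc p) l)) * \<psi> (bisimplex K (drop p l))"
proof -
  have 1: "front_face p (bisimplex K l) x = bisimplex K (take (Suc p) l) x" for x
    using assms(2) subsetD[OF standard_simplex_mono[of p "p+q"], of x]
      vertex_map_take[of x p "map fst l"] vertex_map_take[of x p "map snd l"]
    by (simp add: front_face_def bisimplex_def restrict_def take_map)
  have 2: "back_face p q (bisimplex K l) x = bisimplex K (drop p l) x" for x
    using assms(2) shift_in_standard_simplex[of x q p]
      vertex_map_drop[of p "map fst l" x] vertex_map_drop[of p "map snd l" x]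
    by (simp add: back_face_def bisimplex_def restrict_def drop_map)
  show ?thesis
    using singular_simplex_bisimplex[OF assms] by (simp add: cochain_cup_def ext[OF 1] ext[OF 2])
qed

text \<open>Stokes' formula on a product of two simplices. The prism formula, the evaluation on the
  two halves of a torus and the boundary of a cross product are all instances of it.\<close>

lemma shuffle_sum_bisimplex_coboundary:
  assumes "bicontinuous p q Y K" "p + q = Suc r"
  shows "shuffle_sum [0..<Suc p] [0..<Suc q] (\<lambda>l. coboundary r Y \<phi> (bisimplex K l)) =
     (\<Sum>k\<le>p. (-1) ^ k * shuffle_sum (remove_nth k [0..<Suc p]) [0..<Suc q] (\<lambda>l. \<phi> (bisimplex K l)))
     + (-1) ^ p * (\<Sum>k\<le>q. (-1) ^ k * shuffle_sum [0..<Suc p] (remove_nth k [0..<Suc q]) (\<lambda>l. \<phi> (bisimplex K l)))"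
proof -
  have "shuffle_sum [0..<Suc p] [0..<Suc q] (\<lambda>l. coboundary r Y \<phi> (bisimplex K l))
      = shuffle_sum [0..<Suc p] [0..<Suc q] (list_coboundary (\<lambda>l. \<phi> (bisimplex K l)))"
    using assms(2) by (intro shuffle_sum_cong coboundary_bisimplex[OF assms(1)]) auto
  also have "\<dots> = (\<Sum>k\<le>p. (-1) ^ k * shuffle_sum (remove_nth k [0..<Suc p]) [0..<Suc q] (\<lambda>l. \<phi> (bisimplex K l)))
     + (-1) ^ p * (\<Sum>k\<le>q. (-1) ^ k * shuffle_sum [0..<Suc p] (remove_nth k [0..<Suc q]) (\<lambda>l. \<phi> (bisimplex K l)))"
    using assms(2)
    by (subst shuffle_sum_list_coboundary) (auto simp del: upt_Suc sum.lessThan_Suc sum.atMost_Suc simp: lessThan_Suc_atMost)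
  finally show ?thesis .
qed

section \<open>Linear algebra, and detection of cohomology classes by cycles over the field\<close>

lemma function_vector_space: "vector_space (\<lambda>(c::'f::field) (v::'t \<Rightarrow> 'f) t. c * v t)"
  by unfold_locales (auto simp: fun_eq_iff algebra_simps)

lemma field_vector_space: "vector_space ((*) :: 'f::field \<Rightarrow> 'f \<Rightarrow> 'f)"
  by unfold_locales (auto simp: algebra_simps)

lemma sum_apply_fun: "(\<Sum>i\<in>I. f i) x = (\<Sum>i\<in>I. f i x)" for f :: "'i \<Rightarrow> 't \<Rightarrow> 'f::comm_monoid_add"
  by (induction I rule: infinite_finite_induct) auto

text \<open>Prescribing \<Lambda> on a basis chosen among the vectors \<open>r s\<close> settles all
  remaining equations: the expansion of \<open>r s\<close> in the basis is a finite relation, so by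
  consistency it also holds between the right-hand sides. The system may be infinite.\<close>

lemma linear_system_solvable:
  fixes r :: "'s \<Rightarrow> 't \<Rightarrow> 'f::field" and b :: "'s \<Rightarrow> 'f"
  assumes consistent: "\<And>S a. finite S \<Longrightarrow> S \<subseteq> T \<Longrightarrow> (\<And>t. (\<Sum>s\<in>S. a s * r s t) = 0) \<Longrightarrow> (\<Sum>s\<in>S. a s * b s) = 0"
  obtains \<Lambda> :: "('t \<Rightarrow> 'f) \<Rightarrow> 'f" where
    "Vector_Spaces.linear (\<lambda>c v t. c * v t) (*) \<Lambda>" "\<And>s. s \<in> T \<Longrightarrow> \<Lambda> (r s) = b s"
proof -
  interpret V: vector_space "\<lambda>(c::'f) (v::'t \<Rightarrow> 'f) t. c * v t" by (rule function_vector_space)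
  interpret F: vector_space "(*) :: 'f \<Rightarrow> 'f \<Rightarrow> 'f" by (rule field_vector_space)
  interpret P: vector_space_pair "\<lambda>(c::'f) (v::'t \<Rightarrow> 'f) t. c * v t" "(*) :: 'f \<Rightarrow> 'f \<Rightarrow> 'f" ..
  obtain B where B: "B \<subseteq> r ` T" "V.independent B" "r ` T \<subseteq> V.span B"
    using V.maximal_independent_subset by blast
  obtain s0 where s0: "\<And>v. v \<in> B \<Longrightarrow> s0 v \<in> T \<and> r (s0 v) = v"
    using B(1) by (metis image_iff subsetD)
  define \<Lambda> where "\<Lambda> = P.construct B (b \<circ> s0)"
  have lin: "Vector_Spaces.linear (\<lambda>c v t. c * v t) (*) \<Lambda>"
    unfolding \<Lambda>_def by (rule P.linear_construct[OF B(2)])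
  interpret L: Vector_Spaces.linear "\<lambda>(c::'f) (v::'t \<Rightarrow> 'f) t. c * v t" "(*) :: 'f \<Rightarrow> 'f \<Rightarrow> 'f" \<Lambda> by (rule lin)
  have on_B: "\<Lambda> v = b (s0 v)" if "v \<in> B" for v
    unfolding \<Lambda>_def using P.construct_basis[OF B(2) that] by simp
  have "\<Lambda> (r s) = b s" if s: "s \<in> T" for s
  proof -
    obtain t c where t: "finite t" "t \<subseteq> B" "r s = (\<Sum>v\<in>t. (\<lambda>x. c v * v x))"
      using s B(3) unfolding V.span_explicit by blast
    \<comment> \<open>The relation that expands \<open>r s\<close> in the basis, with coefficients
      moved from basis vectors to their indices \<open>s0 v\<close>. The index s may itself be one
      of these, so the two contributions are added.\<close>
    define a where "a s' = (\<Sum>v\<in>t. if s0 v = s' then c v else 0) - (if s' = s then 1 else 0)" for s'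
    define S where "S = insert s (s0 ` t)"
    have fin: "finite S" using t(1) by (simp add: S_def)
    have eval: "(\<Sum>s'\<in>S. a s' * g s') = (\<Sum>v\<in>t. c v * g (s0 v)) - g s" for g :: "'s \<Rightarrow> 'f"
    proof -
      have "a s' * g s' = (\<Sum>v\<in>t. if s0 v = s' then c v * g s' else 0) - (if s' = s then g s' else 0)" for s'
        unfolding a_def left_diff_distrib sum_distrib_right
        by (intro arg_cong2[of _ _ _ _ "(-)"] sum.cong) auto
      then have "(\<Sum>s'\<in>S. a s' * g s') = (\<Sum>s'\<in>S. \<Sum>v\<in>t. if s0 v = s' then c v * g s' else 0)
            - (\<Sum>s'\<in>S. if s' = s then g s' else 0)"
        by (simp only: sum_subtractf)
      also have "(\<Sum>s'\<in>S. \<Sum>v\<in>t. if s0 v = s' then c v * g s' else 0) = (\<Sum>v\<in>t. \<Sum>s'\<in>S. if s0 v = s' then c v * g s' else 0)"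
        by (rule sum.swap)
      also have "\<dots> = (\<Sum>v\<in>t. c v * g (s0 v))"
        using fin by (intro sum.cong) (auto simp: S_def)
      also have "(\<Sum>s'\<in>S. if s' = s then g s' else 0) = g s"
        using fin by (simp add: S_def)
      finally show ?thesis .
    qed
    have "(\<Sum>s'\<in>S. a s' * r s' x) = 0" for x
    proof -
      have "(\<Sum>v\<in>t. c v * r (s0 v) x) = (\<Sum>v\<in>t. c v * v x)"
        using s0 t(2) by (intro sum.cong) auto
      then show ?thesis unfolding eval t(3) by (simp add: sum_apply_fun)
    qed
    moreover have "S \<subseteq> T" using s s0 t(2) by (auto simp: S_def)
    ultimately have "(\<Sum>s'\<in>S. a s' * b s') = 0" using consistent fin by blast
    then have "b s = (\<Sum>v\<in>t. c v * b (s0 v))" unfolding eval by simp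
    also have "\<dots> = (\<Sum>v\<in>t. c v * \<Lambda> v)" using on_B t(2) by (intro sum.cong) auto
    also have "\<dots> = \<Lambda> (r s)" unfolding t(3) by (simp add: L.sum L.scale)
    finally show ?thesis by simp
  qed
  with lin that show ?thesis by blast
qed

text \<open>Integral cycles do not detect all cohomology classes with coefficients in a field, hence cycles
  with coefficients in the field are needed. They are given by their coefficients on a finite set of
  simplices, with the cycle condition in dual form.\<close>

definition field_cycle :: "nat \<Rightarrow> 'a topology \<Rightarrow> ((nat \<Rightarrow> real) \<Rightarrow> 'a) set \<Rightarrow> ('a, 'f::comm_ring_1) cochain \<Rightarrow> bool" where
  "field_cycle p X S a \<longleftrightarrow> finite S \<and> S \<subseteq> singular_simplex_set (Suc p) X \<and>
     (\<forall>\<beta>. (\<Sum>\<sigma>\<in>S. a \<sigma> * coboundary p X \<beta> \<sigma>) = 0)"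

text \<open>The equation \<open>coboundary p X \<beta> = \<phi>\<close> is a linear system with one
  equation for each simplex and the values of \<beta> as unknowns. A finite relation between the
  left-hand sides is precisely a cycle over the field, so if every cycle annihilated \<phi>, the
  system would be consistent and \<phi> a coboundary.\<close>

lemma field_cycle_detects:
  fixes \<phi> :: "('a, 'f::field) cochain"
  assumes "\<phi> \<in> singular_cochains (Suc p) X" "\<phi> \<notin> coboundaries (Suc p) X"
  obtains S a where "field_cycle p X S a" "(\<Sum>\<sigma>\<in>S. a \<sigma> * \<phi> \<sigma>) \<noteq> 0"
proof (rule ccontr)
  note detects = that
  assume none: "\<not> thesis"
  let ?T = "singular_simplex_set (Suc p) X"
  define r :: "((nat \<Rightarrow> real) \<Rightarrow> 'a) \<Rightarrow> ((nat \<Rightarrow> real) \<Rightarrow> 'a) \<Rightarrow> 'f" where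
    "r \<sigma> \<tau> = (\<Sum>k\<le>Suc p. (-1) ^ k * (if \<tau> = singular_face (Suc p) k \<sigma> then 1 else 0))" for \<sigma> \<tau>
  obtain \<Lambda> where \<Lambda>: "Vector_Spaces.linear (\<lambda>c v t. c * v t) (*) \<Lambda>"
      and \<Lambda>r: "\<And>\<sigma>. \<sigma> \<in> ?T \<Longrightarrow> \<Lambda> (r \<sigma>) = \<phi> \<sigma>"
  proof (rule linear_system_solvable[of ?T r \<phi>, rotated])
    fix \<Lambda> assume "Vector_Spaces.linear (\<lambda>c v t. c * v t) (*) \<Lambda>" "\<And>\<sigma>. \<sigma> \<in> ?T \<Longrightarrow> \<Lambda> (r \<sigma>) = \<phi> \<sigma>"
    then show thesis by (rule that)
  next
    fix S :: "((nat \<Rightarrow> real) \<Rightarrow> 'a) set" and a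
    assume S: "finite S" "S \<subseteq> ?T" and a: "\<And>\<tau>. (\<Sum>\<sigma>\<in>S. a \<sigma> * r \<sigma> \<tau>) = 0"
    have "(\<Sum>\<sigma>\<in>S. a \<sigma> * coboundary p X \<beta> \<sigma>) = 0" for \<beta> :: "('a, 'f) cochain"
    proof -
      define U where "U = (\<Union>\<sigma>\<in>S. (\<lambda>k. singular_face (Suc p) k \<sigma>) ` {..Suc p})"
      have U: "finite U" using S by (simp add: U_def)
      have "coboundary p X \<beta> \<sigma> = (\<Sum>\<tau>\<in>U. r \<sigma> \<tau> * \<beta> \<tau>)" if "\<sigma> \<in> S" for \<sigma>
      proof -
        have "(\<Sum>\<tau>\<in>U. r \<sigma> \<tau> * \<beta> \<tau>) = (\<Sum>k\<le>Suc p. \<Sum>\<tau>\<in>U. (if \<tau> = singular_face (Suc p) k \<sigma> then (-1) ^ k * \<beta> \<tau> else 0))"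
          unfolding r_def sum_distrib_right by (subst sum.swap) (intro sum.cong refl, simp)
        also have "\<dots> = (\<Sum>k\<le>Suc p. (-1) ^ k * \<beta> (singular_face (Suc p) k \<sigma>))"
          using U that by (intro sum.cong refl) (auto simp: U_def)
        also have "\<dots> = coboundary p X \<beta> \<sigma>"
          using that S by (auto simp: coboundary_def simp del: sum.atMost_Suc)
        finally show ?thesis by simp
      qed
      then have "(\<Sum>\<sigma>\<in>S. a \<sigma> * coboundary p X \<beta> \<sigma>) = (\<Sum>\<sigma>\<in>S. \<Sum>\<tau>\<in>U. a \<sigma> * r \<sigma> \<tau> * \<beta> \<tau>)"
        by (simp add: sum_distrib_left mult.assoc)
      also have "\<dots> = (\<Sum>\<tau>\<in>U. (\<Sum>\<sigma>\<in>S. a \<sigma> * r \<sigma> \<tau>) * \<beta> \<tau>)"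
        by (subst sum.swap) (simp add: sum_distrib_right)
      finally show ?thesis by (simp add: a)
    qed
    then have "field_cycle p X S a" using S by (simp add: field_cycle_def)
    then show "(\<Sum>\<sigma>\<in>S. a \<sigma> * \<phi> \<sigma>) = 0" using detects none by blast
  qed
  interpret L: Vector_Spaces.linear "\<lambda>(c::'f) (v::((nat \<Rightarrow> real) \<Rightarrow> 'a) \<Rightarrow> 'f) t. c * v t" "(*) :: 'f \<Rightarrow> 'f \<Rightarrow> 'f" \<Lambda> by (rule \<Lambda>)
  define \<beta> where "\<beta> \<tau> = (if singular_simplex p X \<tau> then \<Lambda> (\<lambda>\<tau>'. if \<tau>' = \<tau> then 1 else 0) else 0)" for \<tau>
  have "coboundary p X \<beta> = \<phi>"
  proof
    fix \<sigma>
    show "coboundary p X \<beta> \<sigma> = \<phi> \<sigma>"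
    proof (cases "singular_simplex (Suc p) X \<sigma>")
      case True
      have "coboundary p X \<beta> \<sigma> = (\<Sum>k\<le>Suc p. (-1) ^ k * \<Lambda> (\<lambda>\<tau>'. if \<tau>' = singular_face (Suc p) k \<sigma> then 1 else 0))"
        using True singular_simplex_singular_face[OF True]
        by (auto simp: coboundary_def \<beta>_def simp del: sum.atMost_Suc intro!: sum.cong)
      also have "\<dots> = \<Lambda> (\<Sum>k\<le>Suc p. (\<lambda>\<tau>'. (-1) ^ k * (if \<tau>' = singular_face (Suc p) k \<sigma> then 1 else 0)))"
        by (simp only: L.sum L.scale)
      also have "(\<Sum>k\<le>Suc p. (\<lambda>\<tau>'. (-1) ^ k * (if \<tau>' = singular_face (Suc p) k \<sigma> then 1 else 0))) = r \<sigma>"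
        by (simp only: r_def fun_eq_iff sum_apply_fun) simp
      finally show ?thesis using \<Lambda>r True by simp
    qed (use assms(1) in \<open>simp add: coboundary_def singular_cochains_def\<close>)
  qed
  moreover have "\<beta> \<in> singular_cochains p X" by (simp add: \<beta>_def singular_cochains_def)
  ultimately show False using assms(2) by (auto simp: coboundaries_def)
qed

lemma cochain_eval_diff: "cochain_eval \<phi> (a - b) = cochain_eval \<phi> a - cochain_eval \<phi> b"
  using cochain_eval_add[of \<phi> "a - b" b] by simp

text \<open>Subdivision and the chain homotopy are applied simplex by simplex, so the integral
  constructions of the library serve cycles with arbitrary coefficients.\<close>

lemma field_cycle_small:
  fixes a :: "('a, 'f::comm_ring_1) cochain"
  assumes cyc: "field_cycle p X S a" and \<Omega>: "\<Omega> \<in> cocycles (Suc p) X"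
    and cover: "\<And>U. U \<in> \<C> \<Longrightarrow> openin X U" "topspace X \<subseteq> \<Union>\<C>"
    and small: "\<And>\<sigma> U. singular_simplex (Suc p) X \<sigma> \<Longrightarrow> U \<in> \<C> \<Longrightarrow> \<sigma> ` standard_simplex (Suc p) \<subseteq> U \<Longrightarrow> \<Omega> \<sigma> = 0"
  shows "(\<Sum>\<sigma>\<in>S. a \<sigma> * \<Omega> \<sigma>) = 0"
proof -
  have S: "finite S" "\<And>\<sigma>. \<sigma> \<in> S \<Longrightarrow> singular_simplex (Suc p) X \<sigma>"
    using cyc by (auto simp: field_cycle_def)
  have "\<exists>n. \<forall>m f. n \<le> m \<longrightarrow> f \<in> Poly_Mapping.keys ((singular_subdivision (Suc p) ^^ m) (frag_of \<sigma>))
           \<longrightarrow> (\<exists>V\<in>\<C>. f ` standard_simplex (Suc p) \<subseteq> V)" if "\<sigma> \<in> S" for \<sigma>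
    using sufficient_iterated_singular_subdivision_exists[OF cover, of "Suc p" "frag_of \<sigma>"] S(2)[OF that]
    by (metis image_subset_iff_funcset singular_chain_of)
  then obtain n where n: "\<And>\<sigma> m f. \<sigma> \<in> S \<Longrightarrow> n \<sigma> \<le> m \<Longrightarrow>
       f \<in> Poly_Mapping.keys ((singular_subdivision (Suc p) ^^ m) (frag_of \<sigma>))
           \<Longrightarrow> (\<exists>V\<in>\<C>. f ` standard_simplex (Suc p) \<subseteq> V)" by metis
  \<comment> \<open>One number of subdivisions that suffices for all simplices of the cycle.\<close>
  define N where "N = (\<Sum>\<sigma>\<in>S. n \<sigma>)"
  have N: "n \<sigma> \<le> N" if "\<sigma> \<in> S" for \<sigma> using that S(1) by (simp add: N_def member_le_sum)
  obtain h where h: "\<And>p. h p 0 = (0 :: 'a chain)" "\<And>p c1 c2. h p (c1-c2) = h p c1 - h p c2"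
        "\<And>p X c. singular_chain p X c \<Longrightarrow> singular_chain (Suc p) X (h p c)"
        "\<And>p X c. singular_chain p X c
                 \<Longrightarrow> chain_boundary (Suc p) (h p c) + h (p - Suc 0) (chain_boundary p c)
                   = (singular_subdivision p ^^ N) c - c"
    using chain_homotopic_iterated_singular_subdivision[where n = N] by blast
  define \<beta> where "\<beta> \<tau> = cochain_eval \<Omega> (h p (frag_of \<tau>))" for \<tau>
  have \<beta>: "cochain_eval \<Omega> (h p c) = cochain_eval \<beta> c" for c
  proof -
    have "Poly_Mapping.keys c \<subseteq> UNIV" by simp
    then show ?thesis
      by (induction c rule: frag_induction)
        (simp_all add: \<beta>_def h cochain_eval_0 cochain_eval_of cochain_eval_diff)
  qed
  \<comment> \<open>In the homotopy formula \<Omega> vanishes on the iterated subdivision, whose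
    simplices are small, and on the boundary term, being a cocycle. What remains says that on S the
    cocycle equals minus a coboundary, and coboundaries are annihilated by the cycle.\<close>
  have "\<Omega> \<sigma> = - coboundary p X \<beta> \<sigma>" if \<sigma>: "\<sigma> \<in> S" for \<sigma>
  proof -
    have c: "singular_chain (Suc p) X (frag_of \<sigma>)" using S(2)[OF \<sigma>] by (simp add: singular_chain_of)
    let ?s = "(singular_subdivision (Suc p) ^^ N) (frag_of \<sigma>)"
    have "singular_chain (Suc p) X ?s"
      by (induction N) (simp_all add: c singular_chain_singular_subdivision)
    then have "\<Omega> f = 0" if "f \<in> Poly_Mapping.keys ?s" for f
      using that n[OF \<sigma> N[OF \<sigma>] that] small by (auto simp: singular_chain_def)
    then have 1: "cochain_eval \<Omega> ?s = 0" by (simp add: cochain_eval_def)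
    have 2: "cochain_eval \<Omega> (chain_boundary (Suc (Suc p)) (h (Suc p) (frag_of \<sigma>))) = 0"
      using \<Omega> by (simp add: cochain_eval_boundary[OF h(3)[OF c]] cocycles_def) (simp add: cochain_eval_def)
    have "cochain_eval \<Omega> (h p (chain_boundary (Suc p) (frag_of \<sigma>))) = - \<Omega> \<sigma>"
      using arg_cong[OF h(4)[OF c], of "cochain_eval \<Omega>"] 1 2
      by (simp add: cochain_eval_add cochain_eval_diff cochain_eval_of)
    then show ?thesis
      using S(2)[OF \<sigma>] by (simp add: \<beta> cochain_eval_boundary_of)
  qed
  then have "(\<Sum>\<sigma>\<in>S. a \<sigma> * \<Omega> \<sigma>) = - (\<Sum>\<sigma>\<in>S. a \<sigma> * coboundary p X \<beta> \<sigma>)"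
    by (simp add: sum_negf)
  then show ?thesis using cyc by (simp add: field_cycle_def)
qed

section \<open>Faces of grids and of single simplices in terms of vertex lists\<close>

lemma vertex_map_replicate:
  assumes "x \<in> standard_simplex r"
  shows "vertex_map (replicate (Suc r) i) x = (\<lambda>k. if k = i then 1 else 0)"
  using assms by (auto simp: vertex_map_def standard_simplex_def fun_eq_iff lessThan_Suc_atMost simp del: replicate_Suc)

lemma vertex_map_upt:
  assumes "x \<in> standard_simplex r"
  shows "vertex_map [0..<Suc r] x = x"
proof
  fix i
  have "vertex_map [0..<Suc r] x i = (\<Sum>j<Suc r. if j = i then x j else 0)"
    by (simp add: vertex_map_def del: upt_Suc sum.lessThan_Suc)
  also have "\<dots> = x i" using assms by (auto simp: standard_simplex_def)
  finally show "vertex_map [0..<Suc r] x i = x i" .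
qed

definition face_index :: "nat \<Rightarrow> nat \<Rightarrow> nat" where
  "face_index k j = (if j < k then j else Suc j)"

lemma vertex_map_face_index:
  "vertex_map (map (face_index k) l) x = simplical_face k (vertex_map l x)"
proof
  fix i
  have "(\<Sum>j<length l. if face_index k (l ! j) = i then x j else 0) =
    (if i < k then \<Sum>j<length l. if l ! j = i then x j else 0
     else if i = k then 0 else \<Sum>j<length l. if l ! j = i - 1 then x j else 0)"
    by (auto simp: face_index_def intro!: sum.cong sum.neutral)
  then show "vertex_map (map (face_index k) l) x i = simplical_face k (vertex_map l x) i"
    by (auto simp: vertex_map_def simplical_face_def cong: if_cong)
qed

lemma remove_nth_upt: "k \<le> Suc p \<Longrightarrow> remove_nth k [0..<Suc (Suc p)] = map (face_index k) [0..<Suc p]"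
  by (rule nth_equalityI) (auto simp: length_remove_nth nth_remove_nth face_index_def simp del: upt_Suc)

lemma shuffle_sum_map:
  "shuffle_sum (map f I) (map g J) G = shuffle_sum I J (\<lambda>l. G (map (map_prod f g) l))"
proof (induction I J "\<lambda>l. G (map (map_prod f g) l)" arbitrary: G rule: shuffle_sum.induct)
  case (3 i I j J)
  show ?case
    using 3(1)[of "\<lambda>l. G ((f i, g j) # l)"] 3(2)[of "\<lambda>l. G ((f i, g j) # l)"] by auto
qed auto

lemma bisimplex_cong:
  assumes "\<And>x y. x \<in> standard_simplex p \<Longrightarrow> y \<in> standard_simplex q \<Longrightarrow> K x y = K' x y"
    and "l \<noteq> []" "set l \<subseteq> {..p} \<times> {..q}"
  shows "bisimplex K l = bisimplex K' l"
proof -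
  have "set (map fst l) \<subseteq> {..p}" "set (map snd l) \<subseteq> {..q}" using assms(3) by auto
  then show ?thesis
    using assms(2) unfolding bisimplex_def
    by (intro restrict_ext assms(1) vertex_map_in_standard_simplex) auto
qed

lemma shuffle_sum_face1:
  assumes "k \<le> Suc p"
  shows "shuffle_sum (remove_nth k [0..<Suc (Suc p)]) J (\<lambda>l. \<phi> (bisimplex K l)) =
     shuffle_sum [0..<Suc p] J (\<lambda>l. \<phi> (bisimplex (\<lambda>x. K (simplical_face k x)) l))"
proof -
  have "bisimplex K (map (map_prod (face_index k) id) l) = bisimplex (\<lambda>x. K (simplical_face k x)) l" for l
    by (simp add: bisimplex_def flip: vertex_map_face_index)
  then show ?thesis
    using shuffle_sum_map[of "face_index k" "[0..<Suc p]" id J "\<lambda>l. \<phi> (bisimplex K l)"] assms by (simp add: remove_nth_upt del: upt_Suc)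
qed

lemma shuffle_sum_face2:
  assumes "k \<le> Suc q"
  shows "shuffle_sum I (remove_nth k [0..<Suc (Suc q)]) (\<lambda>l. \<phi> (bisimplex K l)) =
     shuffle_sum I [0..<Suc q] (\<lambda>l. \<phi> (bisimplex (\<lambda>x y. K x (simplical_face k y)) l))"
proof -
  have "bisimplex K (map (map_prod id (face_index k)) l) = bisimplex (\<lambda>x y. K x (simplical_face k y)) l" for l
    by (simp add: bisimplex_def flip: vertex_map_face_index)
  then show ?thesis
    using shuffle_sum_map[of id I "face_index k" "[0..<Suc q]" "\<lambda>l. \<phi> (bisimplex K l)"] assms by (simp add: remove_nth_upt del: upt_Suc)
qed

lemma shuffle_sum_single2: "I \<noteq> [] \<Longrightarrow> shuffle_sum I [j] G = G (map (\<lambda>i. (i, j)) I)"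
proof (induction I arbitrary: G)
  case (Cons i I) then show ?case by (cases I) auto
qed simp

definition subsimplex :: "((nat \<Rightarrow> real) \<Rightarrow> 'a) \<Rightarrow> nat list \<Rightarrow> (nat \<Rightarrow> real) \<Rightarrow> 'a" where
  "subsimplex \<sigma> I = restrict (\<lambda>x. \<sigma> (vertex_map I x)) (standard_simplex (length I - 1))"

text \<open>A simplex is regarded as a map on its product with a point, so that the results on
  \<open>bisimplex\<close> apply to it.\<close>

lemma subsimplex_bisimplex: "subsimplex \<sigma> I = bisimplex (\<lambda>x y. \<sigma> x) (map (\<lambda>i. (i, 0)) I)"
  by (simp add: subsimplex_def bisimplex_def o_def)

lemma bicontinuous_fst: "singular_simplex p X \<sigma> \<Longrightarrow> bicontinuous p 0 X (\<lambda>x y. \<sigma> x)"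
  unfolding bicontinuous_def singular_simplex_def case_prod_unfold
  using continuous_map_compose[OF continuous_map_fst, unfolded o_def] by blast

lemma coboundary_subsimplex:
  assumes "singular_simplex p X \<sigma>" "length I = Suc (Suc r)" "set I \<subseteq> {..p}"
  shows "coboundary r X \<phi> (subsimplex \<sigma> I) = list_coboundary (\<lambda>I. \<phi> (subsimplex \<sigma> I)) I"
  using coboundary_bisimplex[OF bicontinuous_fst[OF assms(1)], of "map (\<lambda>i. (i, 0)) I" r \<phi>] assms(2,3)
  by (simp add: subsimplex_bisimplex list_coboundary_def remove_nth_map image_subset_iff del: sum.lessThan_Suc)
    (auto simp: subset_iff)

lemma cochain_cup_subsimplex:
  assumes "singular_simplex m X \<sigma>" "length I = Suc (p + q)" "set I \<subseteq> {..m}"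
  shows "cochain_cup p q X \<phi> \<psi> (subsimplex \<sigma> I) =
    \<phi> (subsimplex \<sigma> (take (Suc p) I)) * \<psi> (subsimplex \<sigma> (drop p I))"
proof -
  have "set (map (\<lambda>i. (i, 0)) I) \<subseteq> {..m} \<times> {..0::nat}" using assms(3) by auto
  from cochain_cup_bisimplex[OF bicontinuous_fst[OF assms(1)] _ this, of p q \<phi> \<psi>] show ?thesis
    using assms(2) by (simp add: subsimplex_bisimplex take_map drop_map)
qed

lemma subsimplex_upt: "singular_simplex p X \<sigma> \<Longrightarrow> subsimplex \<sigma> [0..<Suc p] = \<sigma>"
  by (auto simp: subsimplex_def vertex_map_upt singular_simplex_def extensional_def fun_eq_iff simp del: upt_Suc)

lemma subsimplex_replicate:
  "subsimplex \<sigma> (replicate (Suc r) i) = restrict (\<lambda>x. \<sigma> (\<lambda>k. if k = i then 1 else 0)) (standard_simplex r)"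
  unfolding subsimplex_def by (rule ext) (simp add: vertex_map_replicate restrict_def del: replicate_Suc)

section \<open>Normalisation in degree two\<close>

text \<open>Only the degeneracies that a lattice path produces are demanded: a turn repeats a vertex
  in both projections, and two steps in the same direction make the other projection constant, which
  is the case i = j.\<close>

definition normalized2 :: "'a topology \<Rightarrow> ('a, 'f::comm_ring_1) cochain \<Rightarrow> bool" where
  "normalized2 X \<phi> \<longleftrightarrow> (\<forall>p \<sigma> i j. singular_simplex p X \<sigma> \<longrightarrow> i \<le> p \<longrightarrow> j \<le> p \<longrightarrow>
     \<phi> (subsimplex \<sigma> [i, i, j]) = 0 \<and> \<phi> (subsimplex \<sigma> [i, j, j]) = 0)"

text \<open>By the cocycle condition on [i, i, i, j] and [i, j, j, j], the values on degenerate simplices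
  are determined by the values on constant ones.\<close>

lemma normalized2_exists:
  fixes \<phi> :: "('a, 'f::comm_ring_1) cochain"
  assumes \<phi>: "\<phi> \<in> cocycles 2 X"
  obtains \<beta> where "\<beta> \<in> singular_cochains 1 X" "normalized2 X (\<lambda>\<sigma>. \<phi> \<sigma> - coboundary 1 X \<beta> \<sigma>)"
proof -
  \<comment> \<open>On [i, i, j] the coboundary of \<beta> reduces to the value on [i, i], on
    [i, j, j] to the value on [j, j]. So only constant edges have to be corrected, each by the value
    of \<phi> on the constant 2-simplex at the same point.\<close>
  define \<beta> :: "('a, 'f) cochain" where "\<beta> \<tau> = (if singular_simplex 1 X \<tau> \<and> (\<exists>a. \<tau> = restrict (\<lambda>x. a) (standard_simplex 1))
      then \<phi> (restrict (\<lambda>x. \<tau> (\<lambda>k. if k = 0 then 1 else 0)) (standard_simplex 2)) else 0)" for \<tau>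
  have "\<beta> \<in> singular_cochains 1 X" by (simp add: \<beta>_def singular_cochains_def)
  moreover have "normalized2 X (\<lambda>\<sigma>. \<phi> \<sigma> - coboundary 1 X \<beta> \<sigma>)"
    unfolding normalized2_def
  proof (intro allI impI)
    fix p \<sigma> and i j :: nat
    assume \<sigma>: "singular_simplex p X \<sigma>" and ij: "i \<le> p" "j \<le> p"
    have \<beta>c: "\<beta> (subsimplex \<sigma> [i, i]) = \<phi> (subsimplex \<sigma> [i, i, i])" if "i \<le> p" for i
    proof -
      have s: "subsimplex \<sigma> [i, i] = restrict (\<lambda>x. \<sigma> (\<lambda>k. if k = i then 1 else 0)) (standard_simplex 1)"
        "subsimplex \<sigma> [i, i, i] = restrict (\<lambda>x. \<sigma> (\<lambda>k. if k = i then 1 else 0)) (standard_simplex 2)"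
        using subsimplex_replicate[of \<sigma> 1 i] subsimplex_replicate[of \<sigma> 2 i] by (simp_all add: numeral_2_eq_2)
      have "bicontinuous p 0 X (\<lambda>x y. \<sigma> x)" by (rule bicontinuous_fst[OF \<sigma>])
      from singular_simplex_bisimplex[OF this, of "map (\<lambda>i. (i, 0)) [i, i]" 1]
      have "singular_simplex 1 X (subsimplex \<sigma> [i, i])" using that by (simp add: subsimplex_bisimplex)
      then show ?thesis by (auto simp: \<beta>_def s)
    qed
    have z: "list_coboundary (\<lambda>I. \<phi> (subsimplex \<sigma> I)) I = 0" if "length I = 4" "set I \<subseteq> {..p}" for I
      using coboundary_subsimplex[OF \<sigma> _ that(2), of 2 \<phi>] that \<phi> by (simp add: cocycles_def)
    have z1: "\<phi> (subsimplex \<sigma> [i, i, j]) = \<phi> (subsimplex \<sigma> [i, i, i])"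
      using z[of "[i, i, i, j]"] ij by (simp add: list_coboundary_def remove_nth_def numeral_eq_Suc)
    have z2: "\<phi> (subsimplex \<sigma> [i, j, j]) = \<phi> (subsimplex \<sigma> [j, j, j])"
      using z[of "[i, j, j, j]"] ij by (simp add: list_coboundary_def remove_nth_def numeral_eq_Suc)
    show "\<phi> (subsimplex \<sigma> [i, i, j]) - coboundary 1 X \<beta> (subsimplex \<sigma> [i, i, j]) = 0 \<and>
          \<phi> (subsimplex \<sigma> [i, j, j]) - coboundary 1 X \<beta> (subsimplex \<sigma> [i, j, j]) = 0"
      using ij by (simp add: coboundary_subsimplex[OF \<sigma>] z1 z2 \<beta>c list_coboundary_def remove_nth_def numeral_eq_Suc)
  qed
  ultimately show ?thesis by (rule that)
qed

section \<open>Cocycles of degree one\<close>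

abbreviation vertex :: "nat \<Rightarrow> nat \<Rightarrow> real" where
  "vertex i \<equiv> (\<lambda>k. if k = i then 1 else 0)"

definition segment_point :: "real \<Rightarrow> nat \<Rightarrow> real" where
  "segment_point t = (\<lambda>k. if k = 0 then 1 - t else if k = 1 then t else 0)"

lemma segment_point_in: "t \<in> {0..1} \<Longrightarrow> segment_point t \<in> standard_simplex 1"
  by (auto simp: segment_point_def standard_simplex_def)

lemma segment_point_eq: "x \<in> standard_simplex 1 \<Longrightarrow> segment_point (x 1) = x"
  by (auto simp: segment_point_def standard_simplex_def fun_eq_iff)

lemma segment_point_0: "segment_point 0 = vertex 0" and segment_point_1: "segment_point 1 = vertex 1"
  by (auto simp: segment_point_def fun_eq_iff)

lemma continuous_map_segment_point:
  assumes "continuous_map Y euclideanreal f" "\<And>y. y \<in> topspace Y \<Longrightarrow> f y \<in> {0..1}"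
  shows "continuous_map Y (subtopology (powertop_real UNIV) (standard_simplex 1)) (\<lambda>y. segment_point (f y))"
proof -
  have "continuous_map Y euclideanreal (\<lambda>y. segment_point (f y) k)" for k
    using assms(1) by (cases "k = 0"; cases "k = 1") (auto simp: segment_point_def intro!: continuous_intros)
  then show ?thesis
    using assms(2) segment_point_in by (auto simp: continuous_map_in_subtopology continuous_map_componentwise)
qed

lemma continuous_map_coordinate:
  "continuous_map (subtopology (powertop_real UNIV) S) euclideanreal (\<lambda>x. x k)"
  by (intro continuous_map_from_subtopology continuous_map_product_projection) simp

lemma continuous_map_singular_simplex:
  assumes "singular_simplex p X \<sigma>"
    "continuous_map Y (subtopology (powertop_real UNIV) (standard_simplex p)) f"
  shows "continuous_map Y X (\<lambda>y. \<sigma> (f y))"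
  using continuous_map_compose[OF assms(2)] assms(1) by (auto simp: singular_simplex_def o_def)

text \<open>The triangle K depends on \<open>x 2 - x 0\<close> only. Two of its faces are \<sigma>
  and \<tau>, the face opposite the middle vertex runs through both in turn, and the cocycle
  condition on K is additivity.\<close>

lemma edge_concat:
  assumes c: "c \<in> cocycles 1 W" and \<sigma>: "singular_simplex 1 W \<sigma>" and \<tau>: "singular_simplex 1 W \<tau>"
    and eq: "\<sigma> (vertex 1) = \<tau> (vertex 0)"
  obtains \<rho> where "singular_simplex 1 W \<rho>" "\<rho> (vertex 0) = \<sigma> (vertex 0)" "\<rho> (vertex 1) = \<tau> (vertex 1)"
     "c \<rho> = c \<sigma> + c \<tau>"
proof -
  let ?D = "\<lambda>p. subtopology (powertop_real UNIV) (standard_simplex p)"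
  define K where "K x = (if x 2 \<le> x 0 then \<sigma> (segment_point (1 - x 0 + x 2)) else \<tau> (segment_point (x 2 - x 0)))" for x :: "nat \<Rightarrow> real"
  have co: "continuous_map (?D 2) euclideanreal (\<lambda>x. x k)" for k
    by (rule continuous_map_coordinate)
  have D2: "0 \<le> x 0 \<and> 0 \<le> x 2 \<and> x 0 \<le> 1 \<and> x 2 \<le> 1 \<and> x 2 \<le> 1 + x 0" if "x \<in> standard_simplex 2" for x
    using that unfolding standard_simplex_def by (smt (verit) mem_Collect_eq)
  have "continuous_map (?D 2) W K"
    unfolding K_def
  proof (rule continuous_map_cases_le)
    show "continuous_map (subtopology (?D 2) {x \<in> topspace (?D 2). x 2 \<le> x 0}) W (\<lambda>x. \<sigma> (segment_point (1 - x 0 + x 2)))"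
      by (intro continuous_map_singular_simplex[OF \<sigma>] continuous_map_segment_point continuous_intros continuous_map_from_subtopology[OF co])
        (auto dest: D2)
    show "continuous_map (subtopology (?D 2) {x \<in> topspace (?D 2). x 0 \<le> x 2}) W (\<lambda>x. \<tau> (segment_point (x 2 - x 0)))"
      by (intro continuous_map_singular_simplex[OF \<tau>] continuous_map_segment_point continuous_intros continuous_map_from_subtopology[OF co])
        (auto dest: D2)
  qed (use eq co in \<open>auto simp: segment_point_0 segment_point_1\<close>)
  then have K: "singular_simplex 2 W (restrict K (standard_simplex 2))" (is "singular_simplex 2 W ?K")
    by (auto simp: singular_simplex_def intro: continuous_map_eq)
  have sf: "simplical_face k x \<in> standard_simplex 2" if "k \<le> 2" "x \<in> standard_simplex 1" for k x
    using simplical_face_in_standard_simplex[of 2 k x] that by simp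
  have ext: "\<And>x. x \<notin> standard_simplex 1 \<Longrightarrow> \<sigma> x = undefined" "\<And>x. x \<notin> standard_simplex 1 \<Longrightarrow> \<tau> x = undefined"
    using \<sigma> \<tau> by (auto simp: singular_simplex_def extensional_def)
  have x1: "x 1 = 1 - x 0 \<and> 0 \<le> x 0 \<and> x 0 \<le> 1" if "x \<in> standard_simplex 1" for x
    using that by (auto simp: standard_simplex_def)
  have f0: "singular_face 2 0 ?K = \<tau>"
  proof
    fix x show "singular_face 2 0 ?K x = \<tau> x"
      using sf[of 0 x] ext x1[of x] segment_point_eq[of x] eq
      by (auto simp: singular_face_def K_def simplical_face_def segment_point_0 segment_point_1)
  qed
  have f2: "singular_face 2 2 ?K = \<sigma>"
  proof
    fix x show "singular_face 2 2 ?K x = \<sigma> x"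
      using sf[of 2 x] ext x1[of x] segment_point_eq[of x]
      by (auto simp: singular_face_def K_def simplical_face_def)
  qed
  define \<rho> where "\<rho> = singular_face 2 1 ?K"
  have \<rho>: "singular_simplex 1 W \<rho>" using singular_simplex_singular_face[OF K, of 1] by (simp add: \<rho>_def)
  moreover have "\<rho> (vertex 0) = \<sigma> (vertex 0)" "\<rho> (vertex 1) = \<tau> (vertex 1)"
    using sf[of 1 "vertex 0"] sf[of 1 "vertex 1"]
    by (auto simp: \<rho>_def singular_face_def K_def simplical_face_def segment_point_0 segment_point_1)
  moreover have "coboundary 1 W c ?K = 0" using c by (simp add: cocycles_def)
  then have "c \<rho> = c \<sigma> + c \<tau>"
    using K f0 f2 by (simp add: coboundary_def numeral_2_eq_2 \<rho>_def algebra_simps)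
  ultimately show ?thesis by (rule that)
qed

lemma edge_reverse:
  assumes \<sigma>: "singular_simplex 1 W \<sigma>"
  obtains \<rho> where "singular_simplex 1 W \<rho>" "\<rho> (vertex 0) = \<sigma> (vertex 1)" "\<rho> (vertex 1) = \<sigma> (vertex 0)"
proof
  let ?D = "subtopology (powertop_real UNIV) (standard_simplex 1)"
  have "continuous_map ?D ?D (\<lambda>x. segment_point (1 - x 1))"
    by (rule continuous_map_segment_point)
      (auto simp: standard_simplex_def intro!: continuous_intros continuous_map_coordinate)
  then have "continuous_map ?D W (\<sigma> \<circ> (\<lambda>x. segment_point (1 - x 1)))"
    using \<sigma> unfolding singular_simplex_def by (blast intro: continuous_map_compose)
  then show "singular_simplex 1 W (restrict (\<lambda>x. \<sigma> (segment_point (1 - x 1))) (standard_simplex 1))"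
    by (auto simp: singular_simplex_def o_def intro: continuous_map_eq)
qed (auto simp: segment_point_0 segment_point_1)

text \<open>Integration along paths: the primitive at a point is the value of c on an edge from a
  base point, and vanishing on loops makes it independent of the edge. W need not be path connected,
  so every path component gets its own base point.\<close>

lemma cocycle_1_exact:
  fixes c :: "('a, 'f::comm_ring_1) cochain"
  assumes c: "c \<in> cocycles 1 W"
    and loops: "\<And>\<sigma>. singular_simplex 1 W \<sigma> \<Longrightarrow> \<sigma> (vertex 0) = \<sigma> (vertex 1) \<Longrightarrow> c \<sigma> = 0"
  obtains g where "g \<in> singular_cochains 0 W" "coboundary 0 W g = c"
proof -
  define edge where "edge x y \<sigma> \<longleftrightarrow> singular_simplex 1 W \<sigma> \<and> \<sigma> (vertex 0) = x \<and> \<sigma> (vertex 1) = y" for x y \<sigma>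
  have concat: "\<exists>\<rho>. edge x z \<rho> \<and> c \<rho> = c \<sigma> + c \<tau>" if "edge x y \<sigma>" "edge y z \<tau>" for x y z \<sigma> \<tau>
    using edge_concat[OF c, of \<sigma> \<tau>] that unfolding edge_def by metis
  have rev: "\<exists>\<rho>. edge y x \<rho>" if "edge x y \<sigma>" for x y \<sigma>
    using edge_reverse[of W \<sigma>] that unfolding edge_def by metis
  have loop: "c \<sigma> = 0" if "edge x x \<sigma>" for x \<sigma> using loops that by (auto simp: edge_def)
  have uniq: "c \<sigma> = c \<tau>" if e: "edge x y \<sigma>" "edge x y \<tau>" for x y \<sigma> \<tau>
  proof -
    obtain \<rho> where "edge y x \<rho>" using rev e by blast
    with concat[OF e(1)] concat[OF e(2)] loop have "c \<sigma> + c \<rho> = 0" "c \<tau> + c \<rho> = 0" by metis+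
    then show ?thesis by (metis add_right_cancel)
  qed
  \<comment> \<open>Points joined by an edge satisfy the same predicate here, so \<open>SOME\<close>
    picks the same base point for both.\<close>
  define base where "base x = (SOME b. \<exists>\<sigma>. edge b x \<sigma>)" for x
  define P where "P x = (SOME \<sigma>. edge (base x) x \<sigma>)" for x
  have edge_refl: "\<exists>\<sigma>. edge x x \<sigma>" if "x \<in> topspace W" for x
  proof -
    have "edge x x (restrict (\<lambda>_. x) (standard_simplex 1))"
      using that by (auto simp: edge_def singular_simplex_def intro: continuous_map_eq)
    then show ?thesis by blast
  qed
  have P: "edge (base x) x (P x)" if "x \<in> topspace W" for x
  proof -
    have "\<exists>\<sigma>. edge (base x) x \<sigma>"
      unfolding base_def by (rule someI_ex) (use edge_refl[OF that] in blast)
    then show ?thesis unfolding P_def by (rule someI_ex)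
  qed
  have base: "base x = base y" if "edge x y \<sigma>" for x y \<sigma>
  proof -
    have "(\<exists>\<tau>. edge b x \<tau>) \<longleftrightarrow> (\<exists>\<tau>. edge b y \<tau>)" for b
      using that concat rev by meson
    then show ?thesis by (simp add: base_def)
  qed
  define g where "g \<sigma> = (if singular_simplex 0 W \<sigma> then c (P (\<sigma> (vertex 0))) else 0)" for \<sigma>
  have "coboundary 0 W g = c"
  proof
    fix \<sigma> show "coboundary 0 W g \<sigma> = c \<sigma>"
    proof (cases "singular_simplex 1 W \<sigma>")
      case True
      have in_W: "\<sigma> (vertex i) \<in> topspace W" if "i \<le> 1" for i
      proof -
        have "vertex i \<in> topspace (subtopology (powertop_real UNIV) (standard_simplex 1))"
          using that by simp
        then show ?thesis
          using True continuous_map_image_subset_topspace unfolding singular_simplex_def by blast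
      qed
      let ?x = "\<sigma> (vertex 0)" and ?y = "\<sigma> (vertex 1)"
      have e: "edge ?x ?y \<sigma>" using True by (simp add: edge_def)
      obtain \<rho> where \<rho>: "edge (base ?x) ?y \<rho>" "c \<rho> = c (P ?x) + c \<sigma>"
        using concat[OF P e] in_W[of 0] by auto
      have "edge (base ?x) ?y (P ?y)" using P[OF in_W[of 1]] base[OF e] by simp
      then have 1: "c (P ?y) = c (P ?x) + c \<sigma>" using uniq[OF \<rho>(1)] \<rho>(2) by metis
      have f: "singular_face (Suc 0) 0 \<sigma> (vertex 0) = ?y" "singular_face (Suc 0) (Suc 0) \<sigma> (vertex 0) = ?x"
        by (auto simp: singular_face_def simplical_face_def intro!: arg_cong[of _ _ \<sigma>])
      show ?thesis
        using 1 True singular_simplex_singular_face[OF True, of 0] singular_simplex_singular_face[OF True, of 1]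
        by (simp add: coboundary_def g_def f)
    qed (use c in \<open>simp add: coboundary_def cocycles_def singular_cochains_def\<close>)
  qed
  moreover have "g \<in> singular_cochains 0 W" by (simp add: g_def singular_cochains_def)
  ultimately show ?thesis using that by blast
qed

section \<open>Path spaces and homotopies\<close>

abbreviation unit_interval :: "real topology" where
  "unit_interval \<equiv> top_of_set {0..1}"

text \<open>One half of the exponential law. The preimage of a subbasic set consists of the w for
  which \<open>{w} \<times> K\<close> lies in an open set, and this is an open condition by the tube
  lemma since K is compact.\<close>

lemma continuous_map_into_path_space:
  assumes H: "continuous_map (prod_topology W unit_interval) X (\<lambda>(w, t). H w t)"
  shows "continuous_map W (path_space X) (\<lambda>w. restrict (H w) {0..1})"
  unfolding path_space_def compact_open_topology_def
proof (rule continuous_on_generated_topo)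
  have path: "continuous_map unit_interval X (restrict (H w) {0..1})" if "w \<in> topspace W" for w
  proof -
    have "continuous_map unit_interval (prod_topology W unit_interval) (\<lambda>t. (w, t))"
      using that by (intro continuous_map_pairedI) auto
    from continuous_map_compose[OF this H] show ?thesis
      by (rule continuous_map_eq) auto
  qed
  fix V assume "V \<in> {{g \<in> extensional (topspace unit_interval). continuous_map unit_interval X g \<and> g ` K \<subseteq> U} | K U.
          compactin unit_interval K \<and> openin X U}"
  then obtain K U where V: "V = {g \<in> extensional {0..1}. continuous_map unit_interval X g \<and> g ` K \<subseteq> U}"
    and K: "compactin unit_interval K" and U: "openin X U" by auto
  have K1: "K \<subseteq> {0..1}" using compactin_subset_topspace[OF K] by simp
  let ?O = "{z \<in> topspace (prod_topology W unit_interval). (\<lambda>(w, t). H w t) z \<in> U}"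
  have O: "openin (prod_topology W unit_interval) ?O" by (rule openin_continuous_map_preimage[OF H U])
  have eq: "(\<lambda>w. restrict (H w) {0..1}) -` V \<inter> topspace W = {w \<in> topspace W. {w} \<times> K \<subseteq> ?O}"
  proof -
    have "restrict (H w) {0..1} ` K = H w ` K" for w using K1 by (intro image_cong) auto
    then show ?thesis using path K1 by (auto simp: V image_subset_iff)
  qed
  show "openin W ((\<lambda>w. restrict (H w) {0..1}) -` V \<inter> topspace W)"
    unfolding eq
  proof (subst openin_subopen, clarify)
    fix w assume w: "w \<in> topspace W" "{w} \<times> K \<subseteq> ?O"
    obtain A B where "openin W A" "w \<in> A" "K \<subseteq> B" "A \<times> B \<subseteq> ?O"
      using tube_lemma_right[OF O K w] by blast
    moreover from this have "A \<subseteq> {w \<in> topspace W. {w} \<times> K \<subseteq> ?O}"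
      using openin_subset[of W A] by blast
    ultimately show "\<exists>T. openin W T \<and> w \<in> T \<and> T \<subseteq> {w \<in> topspace W. {w} \<times> K \<subseteq> ?O}" by blast
  qed
next
  have path: "pathin X (restrict (H w) {0..1})" if "w \<in> topspace W" for w
  proof -
    have "continuous_map unit_interval (prod_topology W unit_interval) (\<lambda>t. (w, t))"
      using that by (intro continuous_map_pairedI) auto
    from continuous_map_compose[OF this H] show ?thesis
      unfolding pathin_def by (rule continuous_map_eq) auto
  qed
  then have "(\<lambda>w. restrict (H w) {0..1}) ` topspace W \<subseteq> topspace (path_space X)"
    unfolding topspace_path_space by auto
  then show "(\<lambda>w. restrict (H w) {0..1}) ` topspace W \<subseteq> \<Union> {{g \<in> extensional (topspace unit_interval). continuous_map unit_interval X g \<and> g ` K \<subseteq> U} | K U.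
          compactin unit_interval K \<and> openin X U}"
    unfolding path_space_def compact_open_topology_def topology_generated_by_topspace .
qed

lemma openin_path_space_subbasis:
  "compactin unit_interval K \<Longrightarrow> openin X U \<Longrightarrow>
     openin (path_space X) {g \<in> extensional {0..1}. pathin X g \<and> g ` K \<subseteq> U}"
  unfolding path_space_def compact_open_topology_def pathin_def
  by (rule topology_generated_by_Basis) auto

text \<open>The other half of the exponential law rests on local compactness of the interval: a
  compact neighbourhood K of t that g maps into U defines a subbasic neighbourhood of g.\<close>

lemma continuous_map_path_eval:
  "continuous_map (prod_topology (path_space X) unit_interval) X (\<lambda>(g, t). g t)"
  unfolding continuous_map_def
proof (intro conjI allI impI)
  show "(\<lambda>(g, t). g t) \<in> topspace (prod_topology (path_space X) unit_interval) \<rightarrow> topspace X"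
    by (auto simp: topspace_path_space pathin_def continuous_map_def)
  fix U assume U: "openin X U"
  let ?S = "{z \<in> topspace (prod_topology (path_space X) unit_interval). (\<lambda>(g, t). g t) z \<in> U}"
  show "openin (prod_topology (path_space X) unit_interval) ?S"
    unfolding openin_prod_topology_alt
  proof (intro allI impI)
    fix g t assume "(g, t) \<in> ?S"
    then have g: "g \<in> extensional {0..1}" "pathin X g" "t \<in> {0..1}" "g t \<in> U"
      by (auto simp: topspace_path_space)
    have "openin unit_interval {t \<in> topspace unit_interval. g t \<in> U}"
      using g(2) U unfolding pathin_def by (rule openin_continuous_map_preimage)
    then obtain e where e: "e > 0" "\<And>s. s \<in> {0..1} \<Longrightarrow> dist s t < e \<Longrightarrow> g s \<in> U"
      using g(3,4) by (auto simp: openin_euclidean_subtopology_iff)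
    define K where "K = {0..1} \<inter> cball t (e / 2)"
    have K: "compactin unit_interval K"
      unfolding K_def compactin_subtopology by (auto intro: compact_Int)
    have gK: "g ` K \<subseteq> U" using e by (force simp: K_def dist_commute)
    have "openin unit_interval ({0..1} \<inter> ball t (e / 2))"
      by (simp add: openin_open_Int)
    moreover have "t \<in> {0..1} \<inter> ball t (e / 2)" using g(3) e(1) by simp
    moreover have "g \<in> {g \<in> extensional {0..1}. pathin X g \<and> g ` K \<subseteq> U}" using g gK by simp
    moreover have "{g \<in> extensional {0..1}. pathin X g \<and> g ` K \<subseteq> U} \<times> ({0..1} \<inter> ball t (e / 2)) \<subseteq> ?S"
    proof -
      have "h s \<in> U" if "h ` K \<subseteq> U" "s \<in> {0..1} \<inter> ball t (e / 2)" for h s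
        using that by (auto simp: K_def)
      then show ?thesis by (auto simp: topspace_path_space)
    qed
    ultimately show "\<exists>A B. openin (path_space X) A \<and> openin unit_interval B \<and> g \<in> A \<and> t \<in> B \<and> A \<times> B \<subseteq> ?S"
      using openin_path_space_subbasis[OF K U] by blast
  qed
qed

lemma continuous_map_from_path_space:
  assumes "continuous_map W (path_space X) s"
  shows "continuous_map (prod_topology W unit_interval) X (\<lambda>(w, t). s w t)"
proof -
  have "continuous_map (prod_topology W unit_interval) (prod_topology (path_space X) unit_interval) (\<lambda>(w, t). (s w, t))"
    unfolding case_prod_unfold
    by (intro continuous_map_pairedI continuous_map_compose[OF continuous_map_fst assms, unfolded o_def] continuous_map_snd)
  from continuous_map_compose[OF this continuous_map_path_eval] show ?thesis
    by (simp add: o_def case_prod_unfold)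
qed

lemma bicontinuous_homotopy:
  assumes H: "continuous_map (prod_topology W unit_interval) X (\<lambda>(w, t). H w t)" and \<sigma>: "singular_simplex p W \<sigma>"
  shows "bicontinuous p 1 X (\<lambda>x y. H (\<sigma> x) (y 1))"
proof -
  let ?D = "\<lambda>p. subtopology (powertop_real UNIV) (standard_simplex p)"
  have "continuous_map (?D 1) unit_interval (\<lambda>y. y 1)"
    by (auto simp: continuous_map_in_subtopology standard_simplex_def intro: continuous_map_coordinate)
  then have "continuous_map (prod_topology (?D p) (?D 1)) (prod_topology W unit_interval) (\<lambda>z. (\<sigma> (fst z), snd z 1))"
    by (intro continuous_map_pairedI continuous_map_compose[OF continuous_map_snd, unfolded o_def]
         continuous_map_singular_simplex[OF \<sigma>] continuous_map_fst)
  from continuous_map_compose[OF this H] show ?thesis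
    by (simp add: bicontinuous_def o_def case_prod_unfold)
qed

text \<open>The prism operator in dual form. The interval is the standard 1-simplex with time
  \<open>y 1\<close>, so a prism is a product of simplices of dimensions p and 1.\<close>

definition prism_cochain ::
    "nat \<Rightarrow> 'w topology \<Rightarrow> ('w \<Rightarrow> real \<Rightarrow> 'a) \<Rightarrow> ('a, 'f::comm_ring_1) cochain \<Rightarrow> ('w, 'f) cochain" where
  "prism_cochain p W H \<phi> = (\<lambda>\<sigma>. if singular_simplex p W \<sigma>
     then shuffle_sum [0..<Suc p] [0..<Suc 1] (\<lambda>l. \<phi> (bisimplex (\<lambda>x y. H (\<sigma> x) (y 1)) l)) else 0)"

lemma bisimplex_end:
  "bisimplex (\<lambda>x y. H (\<sigma> x) (y 1)) (map (\<lambda>i. (i, j)) [0..<Suc p]) = simplex_map p (\<lambda>w. H w (vertex j 1)) \<sigma>"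
proof
  fix x
  have "map snd (map (\<lambda>i. (i, j)) [0..<Suc p]) = replicate (Suc p) j"
    "map fst (map (\<lambda>i. (i, j)) [0..<Suc p]) = [0..<Suc p]"
    by (auto simp: o_def map_replicate_const map_idI simp del: upt_Suc replicate_Suc)
  then show "bisimplex (\<lambda>x y. H (\<sigma> x) (y 1)) (map (\<lambda>i. (i, j)) [0..<Suc p]) x = simplex_map p (\<lambda>w. H w (vertex j 1)) \<sigma> x"
    by (simp add: bisimplex_def simplex_map_def restrict_def vertex_map_upt vertex_map_replicate del: upt_Suc replicate_Suc)
qed

text \<open>Stokes' formula on a prism, applied to a cocycle: the sides of the prism give the
  coboundary of the prism cochain, bottom and top give the pullbacks at times 0 and 1.\<close>

lemma coboundary_prism:
  assumes H: "continuous_map (prod_topology W unit_interval) X (\<lambda>(w, t). H w t)"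
    and \<phi>: "\<phi> \<in> cocycles (Suc p) X" and \<sigma>: "singular_simplex (Suc p) W \<sigma>"
  shows "coboundary p W (prism_cochain p W H \<phi>) \<sigma> =
    (-1) ^ p * (\<phi> (simplex_map (Suc p) (\<lambda>w. H w 1) \<sigma>) - \<phi> (simplex_map (Suc p) (\<lambda>w. H w 0) \<sigma>))"
proof -
  let ?K = "\<lambda>x y. H (\<sigma> x) (y 1)" and ?I = "[0..<Suc (Suc p)]"
  have bi: "bicontinuous (Suc p) 1 X ?K" by (rule bicontinuous_homotopy[OF H \<sigma>])
  have f: "shuffle_sum (remove_nth k ?I) [0..<Suc 1] (\<lambda>l. \<phi> (bisimplex ?K l)) = prism_cochain p W H \<phi> (singular_face (Suc p) k \<sigma>)"
    if "k \<le> Suc p" for k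
  proof -
    have "bisimplex (\<lambda>x. ?K (simplical_face k x)) l = bisimplex (\<lambda>x y. H (singular_face (Suc p) k \<sigma> x) (y 1)) l"
      if "length l + 1 = length [0..<Suc p] + length [0..<Suc 1]" "set l \<subseteq> set [0..<Suc p] \<times> set [0..<Suc 1]" for l
      by (rule bisimplex_cong[of p 1]) (use that in \<open>auto simp: singular_face_def\<close>)
    then have "shuffle_sum [0..<Suc p] [0..<Suc 1] (\<lambda>l. \<phi> (bisimplex (\<lambda>x. ?K (simplical_face k x)) l)) =
      shuffle_sum [0..<Suc p] [0..<Suc 1] (\<lambda>l. \<phi> (bisimplex (\<lambda>x y. H (singular_face (Suc p) k \<sigma> x) (y 1)) l))"
      by (intro shuffle_sum_cong arg_cong[of _ _ \<phi>])
    then show ?thesis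
      using singular_simplex_singular_face[OF \<sigma> _ that]
      by (simp add: shuffle_sum_face1[OF that] prism_cochain_def del: upt_Suc)
  qed
  have e: "shuffle_sum ?I [j] (\<lambda>l. \<phi> (bisimplex ?K l)) = \<phi> (simplex_map (Suc p) (\<lambda>w. H w (vertex j 1)) \<sigma>)" for j
    by (subst shuffle_sum_single2) (simp_all only: bisimplex_end, simp)
  have r: "remove_nth 0 [0..<Suc 1] = [1]" "remove_nth 1 [0..<Suc 1] = [0]"
    by (simp_all add: remove_nth_def)
  have "0 = shuffle_sum ?I [0..<Suc 1] (\<lambda>l. coboundary (Suc p) X \<phi> (bisimplex ?K l))"
    using \<phi> by (simp add: cocycles_def)
  also have "\<dots> = (\<Sum>k\<le>Suc p. (-1) ^ k * prism_cochain p W H \<phi> (singular_face (Suc p) k \<sigma>))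
     + (-1) ^ Suc p * (\<phi> (simplex_map (Suc p) (\<lambda>w. H w 1) \<sigma>) - \<phi> (simplex_map (Suc p) (\<lambda>w. H w 0) \<sigma>))"
  proof -
    have fs: "(\<Sum>k\<le>Suc p. (-1) ^ k * shuffle_sum (remove_nth k ?I) [0..<Suc 1] (\<lambda>l. \<phi> (bisimplex ?K l)))
      = (\<Sum>k\<le>Suc p. (-1) ^ k * prism_cochain p W H \<phi> (singular_face (Suc p) k \<sigma>))"
      by (intro sum.cong refl) (simp only: atMost_iff f)
    have "(\<Sum>k\<le>1. (-1) ^ k * shuffle_sum ?I (remove_nth k [0..<Suc 1]) (\<lambda>l. \<phi> (bisimplex ?K l)))
      = shuffle_sum ?I (remove_nth 0 [0..<Suc 1]) (\<lambda>l. \<phi> (bisimplex ?K l)) - shuffle_sum ?I (remove_nth 1 [0..<Suc 1]) (\<lambda>l. \<phi> (bisimplex ?K l))"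
      by (simp del: upt_Suc)
    then show ?thesis
      by (subst shuffle_sum_bisimplex_coboundary[OF bi]) (simp_all only: r e fs, simp)
  qed
  also have "(\<Sum>k\<le>Suc p. (-1) ^ k * prism_cochain p W H \<phi> (singular_face (Suc p) k \<sigma>)) = coboundary p W (prism_cochain p W H \<phi>) \<sigma>"
    using \<sigma> by (simp add: coboundary_def del: sum.atMost_Suc)
  finally show ?thesis by (simp add: algebra_simps)
qed

section \<open>Atoroidal classes and loops of paths\<close>

definition torus_point :: "real \<times> real \<Rightarrow> nat \<Rightarrow> complex" where
  "torus_point z = (\<lambda>i\<in>{..<2}. if i = 0 then cis (2 * pi * fst z) else cis (2 * pi * snd z))"

lemma cis_eq_on_unit_interval:
  assumes "cis (2 * pi * a) = cis (2 * pi * b)" "a \<in> {0..1}" "b \<in> {0..1}"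
  shows "a = b \<or> (a = 0 \<and> b = 1) \<or> (a = 1 \<and> b = 0)"
proof -
  obtain n :: int where "2 * pi * a = 2 * pi * b + 2 * of_int n * pi"
    using assms(1) unfolding cis_conv_exp exp_eq
    by (auto simp: complex_eq_iff)
  then have "pi * (2 * a) = pi * (2 * b + 2 * of_int n)" by (simp add: algebra_simps)
  then have n: "a = b + of_int n" by simp
  with assms(2,3) have "of_int n \<le> (1::real)" "of_int n \<ge> (-1::real)" by auto
  then have "n = -1 \<or> n = 0 \<or> n = 1" by linarith
  with n assms(2,3) show ?thesis by auto
qed

lemma torus_point_quotient_map:
  "quotient_map (prod_topology unit_interval unit_interval) (torus 2) torus_point"
proof (rule continuous_imp_quotient_map)
  show cont: "continuous_map (prod_topology unit_interval unit_interval) (torus 2) torus_point"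
    unfolding torus_def continuous_map_componentwise
    by (auto simp: torus_point_def continuous_map_in_subtopology lessThan_def intro!: continuous_intros)
  show "compact_space (prod_topology unit_interval unit_interval)"
    by (simp add: compact_space_prod_topology compact_space_subtopology del: prod_topology_subtopology_eu)
  show "Hausdorff_space (torus 2)"
    by (simp add: torus_def Hausdorff_space_product_topology Hausdorff_space_subtopology)
  have circle: "\<exists>a\<in>{0..1}. w = cis (2 * pi * a)" if "cmod w = 1" for w
  proof
    show "w = cis (2 * pi * (Arg2pi w / (2 * pi)))"
      using Arg2pi_eq[of w] that by (simp add: cis_conv_exp)
    show "Arg2pi w / (2 * pi) \<in> {0..1}"
      using Arg2pi_ge_0[of w] Arg2pi_lt_2pi[of w] by (simp add: divide_simps)
  qed
  show "torus_point ` topspace (prod_topology unit_interval unit_interval) = topspace (torus 2)"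
  proof
    show "topspace (torus 2) \<subseteq> torus_point ` topspace (prod_topology unit_interval unit_interval)"
    proof
      fix w assume w: "w \<in> topspace (torus 2)"
      then have "cmod (w 0) = 1" "cmod (w 1) = 1" by (auto simp: torus_def PiE_iff)
      then obtain a b where ab: "a \<in> {0..1}" "b \<in> {0..1}" "w 0 = cis (2 * pi * a)" "w 1 = cis (2 * pi * b)"
        using circle by meson
      have "w i = torus_point (a, b) i" for i
        using w ab by (cases "i = 0"; cases "i = 1") (auto simp: torus_point_def torus_def PiE_iff extensional_def)
      then show "w \<in> torus_point ` topspace (prod_topology unit_interval unit_interval)"
        using ab by (intro image_eqI[of _ _ "(a, b)"]) auto
    qed
  qed (rule continuous_map_image_subset_topspace[OF cont])
qed

lemma vertex_map_pair: "x \<in> standard_simplex 1 \<Longrightarrow> vertex_map [i, i] x = vertex i"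
  using vertex_map_replicate[of x 1 i] by simp

text \<open>Two families of paths with common end points, restricted to a loop, form a map from the torus.
  In the torus, the two squares on which the families live have the same boundary.\<close>

lemma prism_loop_eq:
  fixes \<phi> :: "('a, 'f::comm_ring_1) cochain"
  assumes \<phi>: "\<phi> \<in> cocycles 2 X" and ator: "atoroidal 2 X (cohomology_class 2 X \<phi>)"
    and H0: "continuous_map (prod_topology W unit_interval) X (\<lambda>(w, t). H0 w t)"
    and H1: "continuous_map (prod_topology W unit_interval) X (\<lambda>(w, t). H1 w t)"
    and ends: "\<And>w. w \<in> topspace W \<Longrightarrow> H0 w 0 = H1 w 0" "\<And>w. w \<in> topspace W \<Longrightarrow> H0 w 1 = H1 w 1"
    and \<sigma>: "singular_simplex 1 W \<sigma>" and loop: "\<sigma> (vertex 0) = \<sigma> (vertex 1)"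
  shows "prism_cochain 1 W H0 \<phi> \<sigma> = prism_cochain 1 W H1 \<phi> \<sigma>"
proof -
  let ?T = "prod_topology unit_interval unit_interval"
  let ?D = "subtopology (powertop_real UNIV) (standard_simplex 1)"
  \<comment> \<open>The first coordinate runs along the loop; the second runs through H0 and then
    backwards through H1. The halves fit at 1/2 because the final points agree, and the edges 0 and
    1 fit because the initial points do.\<close>
  define F where "F z = (if snd z \<le> 1 / 2 then H0 (\<sigma> (segment_point (fst z))) (2 * snd z)
      else H1 (\<sigma> (segment_point (fst z))) (2 - 2 * snd z))" for z :: "real \<times> real"
  have topD: "topspace ?T = {0..1} \<times> {0..1}" by simp
  have \<sigma>W: "\<sigma> x \<in> topspace W" if "x \<in> standard_simplex 1" for x
    using \<sigma> that by (auto simp: singular_simplex_def continuous_map_def)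
  have cfst: "continuous_map ?T euclideanreal fst" and csnd: "continuous_map ?T euclideanreal snd"
    using continuous_map_fst[of unit_interval unit_interval] continuous_map_snd[of unit_interval unit_interval]
    by (auto simp: continuous_map_in_subtopology)
  have piece: "continuous_map (subtopology ?T S) X (\<lambda>z. H (\<sigma> (segment_point (fst z))) (g z))"
    if H: "continuous_map (prod_topology W unit_interval) X (\<lambda>(w, t). H w t)"
      and g: "continuous_map ?T euclideanreal g" "\<And>z. z \<in> topspace ?T \<inter> S \<Longrightarrow> g z \<in> {0..1}" for H g S
  proof -
    have "continuous_map (subtopology ?T S) (prod_topology W unit_interval) (\<lambda>z. (\<sigma> (segment_point (fst z)), g z))"
    proof (intro continuous_map_pairedI continuous_map_singular_simplex[OF \<sigma>] continuous_map_segment_point)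
      show "continuous_map (subtopology ?T S) unit_interval g"
        using g by (auto simp: continuous_map_in_subtopology simp del: prod_topology_subtopology_eu intro: continuous_map_from_subtopology)
    qed (auto simp del: prod_topology_subtopology_eu intro: continuous_map_from_subtopology[OF cfst])
    from continuous_map_compose[OF this H] show ?thesis by (simp add: o_def)
  qed
  have F: "continuous_map ?T X F"
    unfolding F_def
  proof (rule continuous_map_cases_le[OF csnd])
    show "continuous_map (subtopology ?T {z \<in> topspace ?T. snd z \<le> 1/2}) X (\<lambda>z. H0 (\<sigma> (segment_point (fst z))) (2 * snd z))"
      by (rule piece[OF H0]) (auto intro!: continuous_map_real_mult csnd simp del: prod_topology_subtopology_eu)
    show "continuous_map (subtopology ?T {z \<in> topspace ?T. 1/2 \<le> snd z}) X (\<lambda>z. H1 (\<sigma> (segment_point (fst z))) (2 - 2 * snd z))"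
      by (rule piece[OF H1]) (auto intro!: continuous_map_real_mult continuous_map_diff csnd simp del: prod_topology_subtopology_eu)
    show "H0 (\<sigma> (segment_point (fst z))) (2 * snd z) = H1 (\<sigma> (segment_point (fst z))) (2 - 2 * snd z)"
      if "z \<in> topspace ?T" "snd z = 1/2" for z
    proof -
      have "2 * snd z = 1" "2 - 2 * snd z = 1" using that(2) by auto
      then show ?thesis
        using that(1) ends(2)[OF \<sigma>W[OF segment_point_in[of "fst z"]]] by (auto simp: mem_Times_iff)
    qed
  qed auto
  have F_eq: "F z = F z'" if z: "z \<in> topspace ?T" "z' \<in> topspace ?T" and eq: "torus_point z = torus_point z'" for z z'
  proof -
    obtain a b a' b' where ab: "z = (a, b)" "z' = (a', b')" by (cases z; cases z')
    have "cis (2 * pi * a) = cis (2 * pi * a')" "cis (2 * pi * b) = cis (2 * pi * b')"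
      using fun_cong[OF eq, of 0] fun_cong[OF eq, of 1] by (auto simp: torus_point_def ab)
    then have c: "a = a' \<or> (a = 0 \<and> a' = 1) \<or> (a = 1 \<and> a' = 0)" "b = b' \<or> (b = 0 \<and> b' = 1) \<or> (b = 1 \<and> b' = 0)"
      using z cis_eq_on_unit_interval[of a a'] cis_eq_on_unit_interval[of b b'] unfolding ab by auto
    have 1: "\<sigma> (segment_point a) = \<sigma> (segment_point a')"
      using c(1) loop by (auto simp: segment_point_0 segment_point_1)
    have "H0 (\<sigma> (segment_point a')) 0 = H1 (\<sigma> (segment_point a')) 0"
      using ends(1)[OF \<sigma>W[OF segment_point_in]] z by (auto simp: ab)
    with 1 have "F (a, 0) = F (a', 0)" "F (a, 0) = F (a', 1)" "F (a, 1) = F (a', 0)" "F (a, b) = F (a', b)"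
      by (simp_all add: F_def)
    then show ?thesis using c(2) unfolding ab by metis
  qed
  obtain f where f: "continuous_map (torus 2) X f" "\<And>z. z \<in> topspace ?T \<Longrightarrow> f (torus_point z) = F z"
  proof (rule quotient_map_lift_exists[OF torus_point_quotient_map F F_eq])
  qed auto
  have "cohomology_class 2 (torus 2) (cochain_map 2 (torus 2) f \<phi>) = cohomology_class 2 (torus 2) (\<lambda>_. 0)"
    using ator f(1) cohomology_map_cohomology_class[OF f(1), of 2 \<phi>]
    unfolding atoroidal_def one_cohomology_group by metis
  then have "cochain_map 2 (torus 2) f \<phi> \<in> cohomology_class 2 (torus 2) (\<lambda>_. 0)"
    using cohomology_class_self[of "cochain_map 2 (torus 2) f \<phi>" 2 "torus 2"] by simp
  then have "cochain_map 2 (torus 2) f \<phi> \<in> coboundaries (Suc 1) (torus 2)"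
    unfolding mem_cohomology_class by (simp only: diff_zero Suc_1)
  then obtain \<beta> where \<beta>: "cochain_map 2 (torus 2) f \<phi> = coboundary 1 (torus 2) \<beta>"
    unfolding coboundaries_def nat.case by blast
  \<comment> \<open>The half of the torus that carries \<open>H b\<close>, parametrised in the time
    direction of \<open>H b\<close>. For H1 this reverses the direction in F, which is why the two
    squares have the same, equally oriented, time 0 and time 1 edges.\<close>
  define Q where "Q b x y = torus_point (x 1, if b then 1 - y 1 / 2 else y 1 / 2)" for b and x y :: "nat \<Rightarrow> real"
  define H where "H b = (if b then H1 else H0)" for b
  have coord: "x k \<in> {0..1}" if "x \<in> standard_simplex 1" for x k
    using that by (simp add: standard_simplex_def)
  have half: "y (Suc 0) \<le> 2" if "y \<in> standard_simplex (Suc 0)" for y :: "nat \<Rightarrow> real"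
    using coord[of y "Suc 0"] that by auto
  have Q: "bicontinuous 1 1 (torus 2) (Q b)" for b
  proof -
    have "continuous_map (prod_topology ?D ?D) euclideanreal (\<lambda>z. if b then 1 - snd z 1 / 2 else snd z 1 / 2)"
      by (cases b) (auto intro!: continuous_map_diff continuous_map_real_divide
          continuous_map_compose[OF continuous_map_snd continuous_map_coordinate, unfolded o_def])
    moreover have "continuous_map (prod_topology ?D ?D) euclideanreal (\<lambda>z. fst z 1)"
      by (rule continuous_map_compose[OF continuous_map_fst continuous_map_coordinate, unfolded o_def])
    ultimately have "continuous_map (prod_topology ?D ?D) ?T (\<lambda>z. (fst z 1, if b then 1 - snd z 1 / 2 else snd z 1 / 2))"
      using half coord by (intro continuous_map_pairedI) (auto simp: continuous_map_in_subtopology)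
    from continuous_map_compose[OF this quotient_imp_continuous_map[OF torus_point_quotient_map]]
    show ?thesis by (simp add: bicontinuous_def Q_def o_def case_prod_unfold)
  qed
  have fQ: "f (Q b x y) = H b (\<sigma> x) (y 1)" if xy: "x \<in> standard_simplex 1" "y \<in> standard_simplex 1" for b x y
  proof -
    have 01: "x 1 \<in> {0..1}" "y 1 \<in> {0..1}" using coord xy by blast+
    then have "f (Q b x y) = F (x 1, if b then 1 - y 1 / 2 else y 1 / 2)"
      unfolding Q_def by (intro f(2)) auto
    also have "\<dots> = H b (\<sigma> x) (y 1)"
      using 01 ends(2)[OF \<sigma>W[OF xy(1)]] by (auto simp: F_def H_def segment_point_eq[OF xy(1), simplified])
    finally show ?thesis .
  qed
  have torus_eq: "torus_point (1, v) = torus_point (0, v)" "torus_point (v, 1) = torus_point (v, 0)" for v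
    by (auto simp: torus_point_def)
  have r: "remove_nth 0 [0..<Suc 1] = [1]" "remove_nth (Suc 0) [0..<Suc 1] = [0]" "[0..<Suc 1] = [0, 1]"
    "remove_nth 0 [0, 1] = [1]" "remove_nth (Suc 0) [0, 1] = [0]"
    by (simp_all add: remove_nth_def)
  \<comment> \<open>Pulled back to the torus \<phi> is the coboundary of \<beta>, so its value on a
    square is a sum of \<beta> over four edges. The edges over the two ends of the loop are
    identified and cancel; the other two do not depend on b.\<close>
  have "prism_cochain 1 W (H b) \<phi> \<sigma> =
    \<beta> (bisimplex (Q b) [(1, 0), (1, 1)]) - \<beta> (bisimplex (Q b) [(0, 0), (0, 1)])
    - (\<beta> (bisimplex (Q b) [(0, 1), (1, 1)]) - \<beta> (bisimplex (Q b) [(0, 0), (1, 0)]))" for b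
  proof -
    have "\<phi> (bisimplex (\<lambda>x y. H b (\<sigma> x) (y 1)) l) = coboundary 1 (torus 2) \<beta> (bisimplex (Q b) l)"
      if l: "length l + 1 = length [0..<Suc 1] + length [0..<Suc 1]" "set l \<subseteq> set [0..<Suc 1] \<times> set [0..<Suc 1]" for l
    proof -
      have "simplex_map 2 f (bisimplex (Q b) l) = bisimplex (\<lambda>x y. f (Q b x y)) l"
        using l by (auto simp: simplex_map_def bisimplex_def restrict_def fun_eq_iff numeral_2_eq_2)
      also have "\<dots> = bisimplex (\<lambda>x y. H b (\<sigma> x) (y 1)) l"
        using l by (intro bisimplex_cong[of 1 1] fQ) auto
      finally show ?thesis
        unfolding \<beta>[symmetric] cochain_map_def using singular_simplex_bisimplex[OF Q, of l 2 b] l by auto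
    qed
    then have "prism_cochain 1 W (H b) \<phi> \<sigma> = shuffle_sum [0..<Suc 1] [0..<Suc 1] (\<lambda>l. coboundary 1 (torus 2) \<beta> (bisimplex (Q b) l))"
      unfolding prism_cochain_def if_P[OF \<sigma>] by (intro shuffle_sum_cong)
    also have "\<dots> = (\<beta> (bisimplex (Q b) [(1, 0), (1, 1)]) - \<beta> (bisimplex (Q b) [(0, 0), (0, 1)]))
    - (\<beta> (bisimplex (Q b) [(0, 1), (1, 1)]) - \<beta> (bisimplex (Q b) [(0, 0), (1, 0)]))"
      by (subst shuffle_sum_bisimplex_coboundary[OF Q]) (simp_all only: r, simp_all add: remove_nth_def)
    finally show ?thesis .
  qed
  moreover have "bisimplex (Q b) [(1, 0), (1, 1)] = bisimplex (Q b) [(0, 0), (0, 1)]" for b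
    by (rule ext) (simp add: bisimplex_def restrict_def vertex_map_pair[simplified] Q_def torus_eq)
  moreover have "bisimplex (Q True) [(0, 1), (1, 1)] = bisimplex (Q False) [(0, 1), (1, 1)]"
    by (rule ext) (simp add: bisimplex_def restrict_def vertex_map_pair[simplified] Q_def torus_eq)
  moreover have "bisimplex (Q True) [(0, 0), (1, 0)] = bisimplex (Q False) [(0, 0), (1, 0)]"
    by (rule ext) (simp add: bisimplex_def restrict_def vertex_map_pair[simplified] Q_def torus_eq)
  ultimately have "prism_cochain 1 W (H False) \<phi> \<sigma> = prism_cochain 1 W (H True) \<phi> \<sigma>" by simp
  then show ?thesis by (simp add: H_def)
qed

lemma coboundary_cong:
  assumes "singular_simplex (Suc p) X \<sigma>" "singular_simplex (Suc p) Y \<sigma>"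
    and "\<And>k. k \<le> Suc p \<Longrightarrow> \<phi> (singular_face (Suc p) k \<sigma>) = \<psi> (singular_face (Suc p) k \<sigma>)"
  shows "coboundary p X \<phi> \<sigma> = coboundary p Y \<psi> \<sigma>"
  using assms by (simp add: coboundary_def del: sum.atMost_Suc)

text \<open>In the usual terminology: the zero-divisor of an atoroidal class of degree two has weight two.\<close>

lemma atoroidal_zero_divisor_vanishes:
  fixes \<phi> :: "('a, 'f::comm_ring_1) cochain"
  assumes \<phi>: "\<phi> \<in> cocycles 2 X" and ator: "atoroidal 2 X (cohomology_class 2 X \<phi>)"
    and s0: "continuous_map (subtopology (prod_topology X X) U0) (path_space X) s0" "\<And>z. z \<in> U0 \<Longrightarrow> path_ends (s0 z) = z"
    and s1: "continuous_map (subtopology (prod_topology X X) U1) (path_space X) s1" "\<And>z. z \<in> U1 \<Longrightarrow> path_ends (s1 z) = z"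
  obtains \<beta> where "\<beta> \<in> singular_cochains 1 (prod_topology X X)"
    "\<And>\<sigma>. singular_simplex 2 (prod_topology X X) \<sigma> \<Longrightarrow> \<sigma> ` standard_simplex 2 \<subseteq> U0 \<or> \<sigma> ` standard_simplex 2 \<subseteq> U1 \<Longrightarrow>
       coboundary 1 (prod_topology X X) \<beta> \<sigma> = \<phi> (simplex_map 2 snd \<sigma>) - \<phi> (simplex_map 2 fst \<sigma>)"
proof -
  define Z where "Z = prod_topology X X"
  let ?W = "\<lambda>U. subtopology Z U"
  have face: "singular_simplex p (?W U) (singular_face (Suc p) k \<sigma>)"
    if "singular_simplex (Suc p) (?W U) \<sigma>" "k \<le> Suc p" for p k \<sigma> U
    using singular_simplex_singular_face[OF that(1) _ that(2)] by simp
  have forget: "singular_simplex p Z \<sigma>" if "singular_simplex p (?W U) \<sigma>" for p \<sigma> U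
    using that by (simp add: singular_simplex_subtopology)
  have restr: "coboundary p (?W U) \<psi> \<sigma> = coboundary p Z \<psi> \<sigma>" if "singular_simplex (Suc p) (?W U) \<sigma>"
    for p \<sigma> U and \<psi> :: "('a \<times> 'a, 'f) cochain"
    by (rule coboundary_cong[OF that forget[OF that] refl])
  have H: "continuous_map (prod_topology (?W V) unit_interval) X (\<lambda>(w, t). s w t)"
    if "continuous_map (?W U) (path_space X) s" "V \<subseteq> U" for s U V
    using continuous_map_from_path_space[OF continuous_map_from_subtopology_mono[OF that]] .
  define h0 where "h0 = prism_cochain 1 (?W U0) s0 \<phi>"
  define h1 where "h1 = prism_cochain 1 (?W U1) s1 \<phi>"
  have \<phi>2: "\<phi> \<in> cocycles (Suc 1) X" using \<phi> by (simp add: numeral_2_eq_2)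
  have prism: "coboundary 1 Z (prism_cochain 1 (?W U) s \<phi>) \<sigma> = - (\<phi> (simplex_map 2 snd \<sigma>) - \<phi> (simplex_map 2 fst \<sigma>))"
    if s: "continuous_map (?W U) (path_space X) s" "\<And>z. z \<in> U \<Longrightarrow> path_ends (s z) = z"
      and \<sigma>: "singular_simplex 2 (?W U) \<sigma>" for U s \<sigma>
  proof -
    have \<sigma>': "singular_simplex (Suc 1) (?W U) \<sigma>" using \<sigma> by (simp add: numeral_2_eq_2)
    have "s z 1 = snd z" "s z 0 = fst z" if "z \<in> topspace (?W U)" for z
      using s(2)[of z] that by (auto simp: path_ends_def dest: arg_cong[of _ _ snd] arg_cong[of _ _ fst])
    then have "simplex_map 2 (\<lambda>z. s z 1) \<sigma> = simplex_map 2 snd \<sigma>" "simplex_map 2 (\<lambda>z. s z 0) \<sigma> = simplex_map 2 fst \<sigma>"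
      by (auto intro!: simplex_map_eq[OF \<sigma>])
    then show ?thesis
      using coboundary_prism[OF H[OF s(1) order_refl] \<phi>2 \<sigma>'] restr[OF \<sigma>'] by (simp add: numeral_2_eq_2)
  qed
  have sub: "singular_simplex p (?W U0) \<sigma>" "singular_simplex p (?W U1) \<sigma>" if "singular_simplex p (?W (U0 \<inter> U1)) \<sigma>" for p \<sigma>
    using that by (auto simp: singular_simplex_subtopology)
  define c where "c \<sigma> = (if singular_simplex 1 (?W (U0 \<inter> U1)) \<sigma> then h0 \<sigma> - h1 \<sigma> else 0)" for \<sigma>
  have "c \<in> cocycles 1 (?W (U0 \<inter> U1))"
  proof -
    have "coboundary 1 (?W (U0 \<inter> U1)) c \<sigma> = 0" for \<sigma>
    proof (cases "singular_simplex 2 (?W (U0 \<inter> U1)) \<sigma>")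
      case True
      then have T: "singular_simplex (Suc 1) (?W (U0 \<inter> U1)) \<sigma>" by (simp add: numeral_2_eq_2)
      have "coboundary 1 (?W (U0 \<inter> U1)) c \<sigma> = coboundary 1 Z (\<lambda>\<sigma>. h0 \<sigma> + (- h1 \<sigma>)) \<sigma>"
        using T face[OF T] by (intro coboundary_cong forget[OF T]) (auto simp: c_def)
      also have "\<dots> = coboundary 1 Z h0 \<sigma> - coboundary 1 Z h1 \<sigma>"
        unfolding coboundary_add coboundary_uminus by simp
      also have "\<dots> = 0"
        unfolding h0_def h1_def using True prism[OF s0[folded Z_def]] prism[OF s1[folded Z_def]] sub by simp
      finally show ?thesis .
    next
      case False then show ?thesis by (simp add: coboundary_def numeral_2_eq_2)
    qed
    then show ?thesis by (auto simp: cocycles_def singular_cochains_def c_def)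
  qed
  moreover have "c \<sigma> = 0" if \<sigma>: "singular_simplex 1 (?W (U0 \<inter> U1)) \<sigma>" and loop: "\<sigma> (vertex 0) = \<sigma> (vertex 1)" for \<sigma>
  proof -
    have "prism_cochain 1 (?W (U0 \<inter> U1)) s0 \<phi> \<sigma> = prism_cochain 1 (?W (U0 \<inter> U1)) s1 \<phi> \<sigma>"
    proof (rule prism_loop_eq[OF \<phi> ator _ _ _ _ \<sigma> loop])
      show "s0 w 0 = s1 w 0" "s0 w 1 = s1 w 1" if "w \<in> topspace (?W (U0 \<inter> U1))" for w
        using that s0(2)[of w] s1(2)[of w] by (auto simp: path_ends_def prod_eq_iff)
    qed (auto intro!: H[OF s0(1)[folded Z_def]] H[OF s1(1)[folded Z_def]])
    then show ?thesis using \<sigma> sub[OF \<sigma>] by (simp add: c_def h0_def h1_def prism_cochain_def)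
  qed
  ultimately obtain g where g: "coboundary 0 (?W (U0 \<inter> U1)) g = c"
    using cocycle_1_exact by metis
  \<comment> \<open>A 0-cochain of the intersection is also defined on all of Z, so the coboundary
    of g may be added on every edge in U0. This makes the two definitions agree on edges lying in
    both sets, and one cochain serves both kinds of simplices; nothing is claimed about simplices
    that lie only in the union.\<close>
  define \<beta> where "\<beta> \<sigma> = (if singular_simplex 1 (?W U0) \<sigma> then - h0 \<sigma> + coboundary 0 Z g \<sigma>
     else if singular_simplex 1 (?W U1) \<sigma> then - h1 \<sigma> else 0)" for \<sigma>
  have \<beta>1: "\<beta> \<sigma> = - h1 \<sigma>" if \<sigma>: "singular_simplex 1 (?W U1) \<sigma>" for \<sigma>
  proof (cases "singular_simplex 1 (?W U0) \<sigma>")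
    case True
    then have W: "singular_simplex 1 (?W (U0 \<inter> U1)) \<sigma>" using \<sigma> by (auto simp: singular_simplex_subtopology)
    have "coboundary 0 Z g \<sigma> = coboundary 0 (?W (U0 \<inter> U1)) g \<sigma>"
      using W by (intro restr[symmetric]) simp
    also have "\<dots> = h0 \<sigma> - h1 \<sigma>" using W by (simp add: g c_def)
    finally show ?thesis using True by (simp add: \<beta>_def)
  qed (use \<sigma> in \<open>simp add: \<beta>_def\<close>)
  have b0: "coboundary 1 Z \<beta> \<sigma> = \<phi> (simplex_map 2 snd \<sigma>) - \<phi> (simplex_map 2 fst \<sigma>)"
    if \<sigma>: "singular_simplex 2 (?W U0) \<sigma>" for \<sigma>
  proof -
    have \<sigma>': "singular_simplex (Suc 1) (?W U0) \<sigma>" using \<sigma> by (simp add: numeral_2_eq_2)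
    have "coboundary 1 Z \<beta> \<sigma> = coboundary 1 Z (\<lambda>\<sigma>. - h0 \<sigma> + coboundary 0 Z g \<sigma>) \<sigma>"
      using \<sigma>' by (intro coboundary_cong forget[OF \<sigma>']) (use face[OF \<sigma>'] in \<open>auto simp: \<beta>_def\<close>)
    also have "\<dots> = - coboundary 1 Z h0 \<sigma>"
      using coboundary_coboundary[of 0 Z g] unfolding coboundary_add coboundary_uminus by simp
    finally show ?thesis using prism[OF s0[folded Z_def] \<sigma>] by (simp add: h0_def)
  qed
  have b1: "coboundary 1 Z \<beta> \<sigma> = \<phi> (simplex_map 2 snd \<sigma>) - \<phi> (simplex_map 2 fst \<sigma>)"
    if \<sigma>: "singular_simplex 2 (?W U1) \<sigma>" for \<sigma>
  proof -
    have \<sigma>': "singular_simplex (Suc 1) (?W U1) \<sigma>" using \<sigma> by (simp add: numeral_2_eq_2)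
    have "coboundary 1 Z \<beta> \<sigma> = coboundary 1 Z (\<lambda>\<sigma>. - h1 \<sigma>) \<sigma>"
      using \<sigma>' face[OF \<sigma>'] by (intro coboundary_cong forget[OF \<sigma>'] \<beta>1) auto
    then show ?thesis using prism[OF s1[folded Z_def] \<sigma>] unfolding coboundary_uminus by (simp add: h1_def)
  qed
  show ?thesis
  proof (rule that[of \<beta>])
    show "\<beta> \<in> singular_cochains 1 (prod_topology X X)"
      unfolding Z_def[symmetric] by (auto simp: singular_cochains_def \<beta>_def dest: forget)
  next
    fix \<sigma> assume "singular_simplex 2 (prod_topology X X) \<sigma>" "\<sigma> ` standard_simplex 2 \<subseteq> U0 \<or> \<sigma> ` standard_simplex 2 \<subseteq> U1"
    then have "singular_simplex 2 (?W U0) \<sigma> \<or> singular_simplex 2 (?W U1) \<sigma>"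
      by (simp add: singular_simplex_subtopology Z_def)
    then show "coboundary 1 (prod_topology X X) \<beta> \<sigma> = \<phi> (simplex_map 2 snd \<sigma>) - \<phi> (simplex_map 2 fst \<sigma>)"
      unfolding Z_def[symmetric] using b0 b1 by blast
  qed
qed

section \<open>Products of cochains of degree two\<close>

text \<open>The cup product of 2-cochains evaluated on a list of vertices: block b takes the
  positions 2b, 2b + 1, 2b + 2, so neighbouring blocks share a vertex. The value 0 on lists of the
  wrong length later removes splittings into products of unequal degree.\<close>

fun block_prod :: "('i \<Rightarrow> 'i \<Rightarrow> 'i \<Rightarrow> 'f::comm_ring_1) list \<Rightarrow> 'i list \<Rightarrow> 'f" where
  "block_prod [] I = (if length I = 1 then 1 else 0)"
| "block_prod (w # ws) (i # j # k # I) = w i j k * block_prod ws (k # I)"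
| "block_prod (w # ws) I = 0"

lemma block_prod_append:
  assumes "length I = Suc (2 * (length ws + length vs))"
  shows "block_prod (ws @ vs) I =
    block_prod ws (take (Suc (2 * length ws)) I) * block_prod vs (drop (2 * length ws) I)"
  using assms
proof (induction ws arbitrary: I)
  case Nil then show ?case by (cases I) auto
next
  case (Cons w ws)
  then obtain i j k I' where I: "I = i # j # k # I'" by (auto simp: length_Suc_conv)
  then show ?case using Cons by (simp add: mult.assoc)
qed

lemma block_prod_wrong_length: "length I \<noteq> Suc (2 * length ws) \<Longrightarrow> block_prod ws I = 0"
  by (induction ws I rule: block_prod.induct) auto

lemma block_prod_zero:
  assumes "b < length ws" "length I = Suc (2 * length ws)"
    and "(ws ! b) (I ! (2 * b)) (I ! (2 * b + 1)) (I ! (2 * b + 2)) = 0"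
  shows "block_prod ws I = 0"
  using assms
proof (induction ws arbitrary: I b)
  case (Cons w ws)
  then obtain i j k I' where I: "I = i # j # k # I'" by (auto simp: length_Suc_conv)
  then show ?case using Cons by (cases b) auto
qed simp

text \<open>The expansion of a product of binomials: each factor is assigned to one of two sublists,
  and the order inside each sublist is kept.\<close>

primrec split_sum :: "('b list \<Rightarrow> 'b list \<Rightarrow> 'f::comm_ring_1) \<Rightarrow> 'b list \<Rightarrow> 'f" where
  "split_sum F [] = F [] []"
| "split_sum F (x # xs) = split_sum (\<lambda>S T. F (x # S) T) xs + split_sum (\<lambda>S T. F S (x # T)) xs"

lemma split_sum_mult: "split_sum (\<lambda>S T. c * F S T) xs = c * split_sum F xs"
  by (induction xs arbitrary: F) (auto simp: algebra_simps)

lemma split_sum_zero [simp]: "split_sum (\<lambda>S T. 0) xs = 0"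
  by (induction xs) auto

lemma split_sum_sum: "split_sum (\<lambda>S T. \<Sum>i\<in>A. F i S T) xs = (\<Sum>i\<in>A. split_sum (F i) xs)"
  by (induction xs arbitrary: F) (auto simp: sum.distrib)

lemma split_sum_map: "split_sum F (map h xs) = split_sum (\<lambda>S T. F (map h S) (map h T)) xs"
  by (induction xs arbitrary: F) auto

lemma split_sum_eq_0:
  assumes "\<And>S T. set S \<subseteq> set xs \<Longrightarrow> set T \<subseteq> set xs \<Longrightarrow> F S T = 0"
  shows "split_sum F xs = 0"
  using assms
proof (induction xs arbitrary: F)
  case (Cons x xs)
  have "split_sum (\<lambda>S T. F (x # S) T) xs = 0" "split_sum (\<lambda>S T. F S (x # T)) xs = 0"
    by (rule Cons.IH, rule Cons.prems; auto)+
  then show ?case by simp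
qed simp

text \<open>If both copies of x go to the same side, they stay adjacent there and the term vanishes.
  The two ways to separate them give the same term, hence a factor 2 for each entry.\<close>

lemma split_sum_double:
  assumes "\<And>P x S T. set (P @ x # S) \<subseteq> D \<Longrightarrow> set T \<subseteq> D \<Longrightarrow> F (P @ x # x # S) T = 0"
    and "\<And>P x S T. set (P @ x # T) \<subseteq> D \<Longrightarrow> set S \<subseteq> D \<Longrightarrow> F S (P @ x # x # T) = 0"
    and "set xs \<subseteq> D"
  shows "split_sum F (concat (map (\<lambda>x. [x, x]) xs)) = 2 ^ length xs * F xs xs"
  using assms
proof (induction xs arbitrary: F)
  case (Cons x xs)
  let ?d = "concat (map (\<lambda>x. [x, x]) xs)"
  have d: "set ?d \<subseteq> D" and x: "x \<in> D" "set xs \<subseteq> D" using Cons.prems(3) by auto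
  have "split_sum (\<lambda>S T. F (x # x # S) T) ?d = 0"
    by (rule split_sum_eq_0) (use d x Cons.prems(1)[of "[]"] in auto)
  moreover have "split_sum (\<lambda>S T. F S (x # x # T)) ?d = 0"
    by (rule split_sum_eq_0) (use d x Cons.prems(2)[of "[]"] in auto)
  moreover have "split_sum (\<lambda>S T. F (x # S) (x # T)) ?d = 2 ^ length xs * F (x # xs) (x # xs)"
  proof (rule Cons.IH)
    show "F (x # P @ y # y # S) (x # T) = 0" if "set (P @ y # S) \<subseteq> D" "set T \<subseteq> D" for P y S T
      using Cons.prems(1)[of "x # P" y S "x # T"] that x by simp
    show "F (x # S) (x # P @ y # y # T) = 0" if "set (P @ y # T) \<subseteq> D" "set S \<subseteq> D" for P y S T
      using Cons.prems(2)[of "x # P" y T "x # S"] that x by simp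
  qed (use x in auto)
  ultimately show ?case by (simp add: algebra_simps)
qed simp

lemma shuffle_sum_hd_cong:
  assumes "\<And>l. G ((i, j) # l) = G' ((i, j) # l)"
  shows "shuffle_sum (i # I) (j # J) G = shuffle_sum (i # I) (j # J) G'"
  by (simp add: assms)

text \<open>The difference of the two pullbacks; it vanishes on a step of a lattice path that is neither
  horizontal nor vertical if A and B are normalised.\<close>

definition block_diff ::
    "('i \<Rightarrow> 'i \<Rightarrow> 'i \<Rightarrow> 'f::comm_ring_1) \<times> ('j \<Rightarrow> 'j \<Rightarrow> 'j \<Rightarrow> 'f) \<Rightarrow> 'i \<times> 'j \<Rightarrow> 'i \<times> 'j \<Rightarrow> 'i \<times> 'j \<Rightarrow> 'f" where
  "block_diff w a b c = snd w (snd a) (snd b) (snd c) - fst w (fst a) (fst b) (fst c)"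

text \<open>The path is read two steps at a time, one block for each factor. A turn within a block
  gives degenerate triples in both projections and hence 0; two horizontal steps leave
  \<open>- fst w\<close>, two vertical ones \<open>snd w\<close>. Vertical steps taken in pairs
  carry no shuffle sign, so the only sign left counts the horizontal blocks. Lists of odd length
  have an even number of steps, which keeps both directions divisible into blocks.\<close>

lemma shuffle_sum_block_prod:
  assumes "odd (length I)" "odd (length J)" "length I + length J = 2 * length ws + 2"
    and "set I \<subseteq> P" "set J \<subseteq> Q"
    and "\<And>w i j. w \<in> set ws \<Longrightarrow> i \<in> P \<Longrightarrow> j \<in> P \<Longrightarrow> fst w i i j = 0 \<and> fst w i j j = 0"
    and "\<And>w i j. w \<in> set ws \<Longrightarrow> i \<in> Q \<Longrightarrow> j \<in> Q \<Longrightarrow> snd w i i j = 0 \<and> snd w i j j = 0"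
  shows "shuffle_sum I J (block_prod (map block_diff ws)) =
    split_sum (\<lambda>S T. (-1) ^ length S * block_prod (map fst S) I * block_prod (map snd T) J) ws"
  using assms
proof (induction ws arbitrary: I J)
  case Nil
  then have "length I = 1 \<and> length J = 1" by (cases "length I"; cases "length J") auto
  then obtain i j where "I = [i]" "J = [j]" by (auto simp: length_Suc_conv)
  then show ?case by simp
next
  case (Cons w ws)
  note prem = Cons.prems
  have step: "shuffle_sum (i2 # I') (j2 # J') (\<lambda>l. block_prod (map block_diff (w # ws)) (a # b # l))
     = block_diff w a b (i2, j2) * shuffle_sum (i2 # I') (j2 # J') (block_prod (map block_diff ws))" for i2 I' j2 J' a b
    by (subst shuffle_sum_mult[symmetric]) (rule shuffle_sum_hd_cong, simp)
  have IH: "shuffle_sum I' J' (block_prod (map block_diff ws)) =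
     split_sum (\<lambda>S T. (-1) ^ length S * block_prod (map fst S) I' * block_prod (map snd T) J') ws"
    if "odd (length I')" "odd (length J')" "length I' + length J' = 2 * length ws + 2" "set I' \<subseteq> P" "set J' \<subseteq> Q" for I' J'
    using that prem by (intro Cons.IH) auto
  obtain i0 I1 where I: "I = i0 # I1" "even (length I1)" using prem(1) by (cases I) auto
  obtain j0 J1 where J: "J = j0 # J1" "even (length J1)" using prem(2) by (cases J) auto
  have P0: "i0 \<in> P" "j0 \<in> Q" using prem I J by auto
  have w: "\<And>i j. i \<in> P \<Longrightarrow> j \<in> P \<Longrightarrow> fst w i i j = 0 \<and> fst w i j j = 0"
    "\<And>i j. i \<in> Q \<Longrightarrow> j \<in> Q \<Longrightarrow> snd w i i j = 0 \<and> snd w i j j = 0" using prem(6,7) by auto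
  let ?F = "\<lambda>S T. (-1) ^ length S * block_prod (map fst S) I * block_prod (map snd T) J"
  have A: "split_sum (\<lambda>S T. ?F (w # S) T) ws = (case I1 of i1 # i2 # I' \<Rightarrow>
      - fst w i0 i1 i2 * shuffle_sum (i2 # I') J (block_prod (map block_diff ws)) | _ \<Rightarrow> 0)"
  proof (cases "I1 = []")
    case False
    then obtain i1 i2 I' where I1: "I1 = i1 # i2 # I'" using I(2) by (cases I1 rule: remdups_adj.cases) auto
    have e: "(\<lambda>S T. ?F (w # S) T) = (\<lambda>S T. - fst w i0 i1 i2 *
        ((-1) ^ length S * block_prod (map fst S) (i2 # I') * block_prod (map snd T) J))"
      by (auto simp: I I1 algebra_simps fun_eq_iff)
    show ?thesis
      unfolding e split_sum_mult using IH[of "i2 # I'" J] prem I I1 by auto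
  qed (simp add: I)
  have B: "split_sum (\<lambda>S T. ?F S (w # T)) ws = (case J1 of j1 # j2 # J' \<Rightarrow>
      snd w j0 j1 j2 * shuffle_sum I (j2 # J') (block_prod (map block_diff ws)) | _ \<Rightarrow> 0)"
  proof (cases "J1 = []")
    case False
    then obtain j1 j2 J' where J1: "J1 = j1 # j2 # J'" using J(2) by (cases J1 rule: remdups_adj.cases) auto
    have e: "(\<lambda>S T. ?F S (w # T)) = (\<lambda>S T. snd w j0 j1 j2 *
        ((-1) ^ length S * block_prod (map fst S) I * block_prod (map snd T) (j2 # J')))"
      by (auto simp: J J1 algebra_simps fun_eq_iff)
    show ?thesis
      unfolding e split_sum_mult using IH[of I "j2 # J'"] prem J J1 by auto
  qed (simp add: J)
  show ?case
  proof (cases "I1 = []")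
    case True
    then obtain j1 j2 J' where J1: "J1 = j1 # j2 # J'" using J prem(3) I by (cases J1 rule: remdups_adj.cases) auto
    have "shuffle_sum I J (block_prod (map block_diff (w # ws)))
       = shuffle_sum [i0] (j2 # J') (\<lambda>l. block_prod (map block_diff (w # ws)) ((i0, j0) # (i0, j1) # l))"
      by (simp add: I J J1 True)
    also have "\<dots> = snd w j0 j1 j2 * shuffle_sum I (j2 # J') (block_prod (map block_diff ws))"
      unfolding step using w(1)[OF P0(1) P0(1)] by (simp add: block_diff_def I True)
    finally show ?thesis using A B by (simp add: True J1)
  next
    case False
    then obtain i1 i2 I' where I1: "I1 = i1 # i2 # I'" using I(2) by (cases I1 rule: remdups_adj.cases) auto
    have P1: "i1 \<in> P" using prem(4) I I1 by auto
    show ?thesis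
    proof (cases "J1 = []")
      case True
      have "shuffle_sum I J (block_prod (map block_diff (w # ws)))
         = shuffle_sum (i2 # I') [j0] (\<lambda>l. block_prod (map block_diff (w # ws)) ((i0, j0) # (i1, j0) # l))"
        by (simp add: I J I1 True)
      also have "\<dots> = - fst w i0 i1 i2 * shuffle_sum (i2 # I') J (block_prod (map block_diff ws))"
        unfolding step using w(2)[OF P0(2) P0(2)] by (simp add: block_diff_def J True)
      finally show ?thesis using A B by (simp add: True I1)
    next
      case False
      then obtain j1 j2 J' where J1: "J1 = j1 # j2 # J'" using J(2) by (cases J1 rule: remdups_adj.cases) auto
      have Q1: "j1 \<in> Q" using prem(5) J J1 by auto
      let ?G = "\<lambda>a b l. block_prod (map block_diff (w # ws)) (a # b # l)"
      have "shuffle_sum I J (block_prod (map block_diff (w # ws)))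
         = shuffle_sum (i2 # I') J (?G (i0, j0) (i1, j0))
           + (-1) ^ length (i2 # I') * shuffle_sum (i1 # i2 # I') (j1 # j2 # J') (?G (i0, j0) (i1, j0))
         + (shuffle_sum (i1 # i2 # I') (j1 # j2 # J') (?G (i0, j0) (i0, j1))
           + shuffle_sum I (j2 # J') (?G (i0, j0) (i0, j1)))"
        using I(2) by (simp add: I J I1 J1 del: block_prod.simps map_eq_Cons_conv)
      also have "\<dots> = - fst w i0 i1 i2 * shuffle_sum (i2 # I') J (block_prod (map block_diff ws))
          + snd w j0 j1 j2 * shuffle_sum I (j2 # J') (block_prod (map block_diff ws))"
        unfolding J I step using w(1)[OF P0(1) P1] w(2)[OF P0(2) Q1] w(1)[OF P0(1) P0(1)] w(2)[OF P0(2) P0(2)]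
        by (simp add: block_diff_def del: shuffle_sum.simps)
      finally show ?thesis using A B by (simp add: I1 J1)
    qed
  qed
qed

text \<open>Nested to the right, like \<open>block_prod\<close>, whereas \<open>iterated_cup\<close>
  is nested to the left; \<open>cup_list_append\<close> mediates between the two.\<close>

primrec cup_list :: "'a topology \<Rightarrow> ('a, 'f::comm_ring_1) cochain list \<Rightarrow> ('a, 'f) cochain" where
  "cup_list X [] = unit_cochain X"
| "cup_list X (\<phi> # S) = cochain_cup 2 (2 * length S) X \<phi> (cup_list X S)"

lemma cup_list_in: "cup_list X S \<in> singular_cochains (2 * length S) X"
proof (cases S)
  case Nil then show ?thesis by (simp add: unit_cochain_def singular_cochains_def)
next
  case (Cons \<phi> T) then show ?thesis using cochain_cup_in[of 2 "2 * length T"] by simp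
qed

lemma cup_list_bisimplex:
  assumes "bicontinuous p q Y K" "length l = Suc (2 * length S)" "set l \<subseteq> {..p} \<times> {..q}"
  shows "cup_list Y S (bisimplex K l) = block_prod (map (\<lambda>\<phi> a b c. \<phi> (bisimplex K [a, b, c])) S) l"
  using assms(2,3)
proof (induction S arbitrary: l)
  case Nil
  then show ?case using singular_simplex_bisimplex[OF assms(1), of l 0] by (simp add: unit_cochain_def)
next
  case (Cons \<phi> S)
  then obtain a b c l' where l: "l = a # b # c # l'" by (auto simp: length_Suc_conv)
  have "cup_list Y (\<phi> # S) (bisimplex K l) = \<phi> (bisimplex K (take (Suc 2) l)) * cup_list Y S (bisimplex K (drop 2 l))"
    unfolding cup_list.simps using Cons.prems by (intro cochain_cup_bisimplex[OF assms(1)]) auto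
  also have "cup_list Y S (bisimplex K (drop 2 l)) = block_prod (map (\<lambda>\<phi> a b c. \<phi> (bisimplex K [a, b, c])) S) (drop 2 l)"
    using Cons.prems set_drop_subset[of 2 l] by (intro Cons.IH) auto
  finally show ?case by (simp add: l numeral_2_eq_2)
qed

lemma block_prod_map: "block_prod ws (map f l) = block_prod (map (\<lambda>w a b c. w (f a) (f b) (f c)) ws) l"
proof (induction ws "map f l" arbitrary: l rule: block_prod.induct)
  case (2 w ws i j k I)
  then obtain a b c l' where l: "l = a # b # c # l'" "i = f a" "j = f b" "k = f c" "I = map f l'" by auto
  then show ?case using 2(1)[of "c # l'"] by simp
qed (auto simp: map_eq_Cons_conv)

lemma cup_list_subsimplex:
  assumes "singular_simplex p X \<sigma>" "length I = Suc (2 * length S)" "set I \<subseteq> {..p}"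
  shows "cup_list X S (subsimplex \<sigma> I) = block_prod (map (\<lambda>\<phi> i j k. \<phi> (subsimplex \<sigma> [i, j, k])) S) I"
  using cup_list_bisimplex[OF bicontinuous_fst[OF assms(1)], of "map (\<lambda>i. (i, 0)) I" S] assms(2,3)
  by (auto simp: subsimplex_bisimplex block_prod_map o_def)

lemma cup_list_simplex:
  assumes "singular_simplex (2 * length S) X \<sigma>"
  shows "cup_list X S \<sigma> = block_prod (map (\<lambda>\<phi> i j k. \<phi> (subsimplex \<sigma> [i, j, k])) S) [0..<Suc (2 * length S)]"
  using cup_list_subsimplex[OF assms, of "[0..<Suc (2 * length S)]" S] subsimplex_upt[OF assms]
  by (simp add: atLeast0LessThan lessThan_Suc_atMost del: upt_Suc)

text \<open>The cup product of cochains is strictly associative: on a simplex both sides are the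
  same product of blocks.\<close>

lemma cup_list_append:
  "cup_list X (S @ T) = cochain_cup (2 * length S) (2 * length T) X (cup_list X S) (cup_list X T)"
proof
  fix \<sigma>
  show "cup_list X (S @ T) \<sigma> = cochain_cup (2 * length S) (2 * length T) X (cup_list X S) (cup_list X T) \<sigma>"
  proof (cases "singular_simplex (2 * length S + 2 * length T) X \<sigma>")
    case True
    let ?I = "[0..<Suc (2 * length S + 2 * length T)]" and ?w = "map (\<lambda>\<phi> i j k. \<phi> (subsimplex \<sigma> [i, j, k]))"
    have "cup_list X (S @ T) \<sigma> = block_prod (?w S @ ?w T) ?I"
      using cup_list_simplex[of "S @ T" X \<sigma>] True by (simp add: algebra_simps del: upt_Suc)
    also have "\<dots> = block_prod (?w S) (take (Suc (2 * length S)) ?I) * block_prod (?w T) (drop (2 * length S) ?I)"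
      by (subst block_prod_append) (simp_all del: upt_Suc)
    also have "\<dots> = cup_list X S (subsimplex \<sigma> (take (Suc (2 * length S)) ?I)) * cup_list X T (subsimplex \<sigma> (drop (2 * length S) ?I))"
      by (subst (1 2) cup_list_subsimplex[OF True]) (auto simp del: upt_Suc dest: in_set_takeD in_set_dropD)
    also have "\<dots> = cochain_cup (2 * length S) (2 * length T) X (cup_list X S) (cup_list X T) (subsimplex \<sigma> ?I)"
      by (subst cochain_cup_subsimplex[OF True]) (auto simp del: upt_Suc)
    finally show ?thesis by (simp add: subsimplex_upt[OF True] del: upt_Suc)
  next
    case False
    then show ?thesis using cup_list_in[of X "S @ T"] cochain_cup_in[of "2 * length S" "2 * length T" X "cup_list X S" "cup_list X T"]
      by (simp add: singular_cochains_def algebra_simps)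
  qed
qed

lemma cup_list_cocycle: "set S \<subseteq> cocycles 2 X \<Longrightarrow> cup_list X S \<in> cocycles (2 * length S) X"
proof (induction S)
  case (Cons \<phi> S)
  then show ?case using cochain_cup_cocycle[of \<phi> 2 X "cup_list X S" "2 * length S"] by simp
qed (simp add: unit_cocycle)

lemma cup_list_single: "\<phi> \<in> singular_cochains 2 X \<Longrightarrow> cup_list X [\<phi>] = \<phi>"
proof
  fix \<sigma> assume \<phi>: "\<phi> \<in> singular_cochains 2 X"
  show "cup_list X [\<phi>] \<sigma> = \<phi> \<sigma>"
  proof (cases "singular_simplex 2 X \<sigma>")
    case True
    have "[0, 1, 2] = [0..<Suc 2]" by (simp add: upt_rec)
    then show ?thesis using cup_list_simplex[of "[\<phi>]" X \<sigma>] True subsimplex_upt[OF True]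
      by (simp add: numeral_eq_Suc upt_rec)
  next
    case False
    then show ?thesis using \<phi> cup_list_in[of X "[\<phi>]"] by (simp add: singular_cochains_def)
  qed
qed

text \<open>Strict associativity isolates the factor \<phi> \<union> \<phi>, a coboundary, and
  multiplying a coboundary by cocycles on either side gives a coboundary.\<close>

lemma cup_list_square:
  assumes "set (P @ \<phi> # S) \<subseteq> cocycles 2 X" "cochain_cup 2 2 X \<phi> \<phi> \<in> coboundaries 4 X"
  shows "cup_list X (P @ \<phi> # \<phi> # S) \<in> coboundaries (2 * length (P @ \<phi> # \<phi> # S)) X"
proof -
  have \<phi>: "\<phi> \<in> singular_cochains 2 X" using assms(1) by (simp add: cocycles_def)
  have "cup_list X (P @ \<phi> # \<phi> # S) = cochain_cup (2 * length P) (2 * length ([\<phi>, \<phi>] @ S)) X (cup_list X P)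
      (cochain_cup (2 * length [\<phi>, \<phi>]) (2 * length S) X (cup_list X [\<phi>, \<phi>]) (cup_list X S))"
    using cup_list_append[of X P "[\<phi>, \<phi>] @ S"] by (simp only: cup_list_append[of X "[\<phi>, \<phi>]" S]) simp
  also have "cup_list X [\<phi>, \<phi>] = cochain_cup 2 2 X \<phi> \<phi>"
    using cup_list_single[OF \<phi>] cup_list_append[of X "[\<phi>]" "[\<phi>]"] by (simp del: cup_list.simps)
  finally have eq: "cup_list X (P @ \<phi> # \<phi> # S) = cochain_cup (2 * length P) (4 + 2 * length S) X (cup_list X P)
      (cochain_cup 4 (2 * length S) X (cochain_cup 2 2 X \<phi> \<phi>) (cup_list X S))"
    by (simp add: eval_nat_numeral)
  have c: "cochain_cup 4 (2 * length S) X (cochain_cup 2 2 X \<phi> \<phi>) (cup_list X S) \<in> coboundaries (4 + 2 * length S) X"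
    using assms by (intro cochain_cup_coboundary_left cup_list_cocycle) auto
  have "cup_list X (P @ \<phi> # \<phi> # S) \<in> coboundaries (2 * length P + (4 + 2 * length S)) X"
    unfolding eq using assms by (intro cochain_cup_coboundary_right[OF cup_list_cocycle c]) auto
  then show ?thesis by (simp add: algebra_simps eval_nat_numeral)
qed

lemma cocycles_diff:
  assumes "\<phi> \<in> cocycles p X" "\<psi> \<in> coboundaries p X"
  shows "(\<lambda>\<sigma>. \<phi> \<sigma> - \<psi> \<sigma>) \<in> cocycles p X"
proof -
  have "\<psi> \<in> cocycles p X" using assms(2) coboundaries_sub by blast
  then show ?thesis
    using assms(1) coboundary_add[of p X \<phi> "\<lambda>\<sigma>. - \<psi> \<sigma>"]
    by (simp add: cocycles_def singular_cochains_def coboundary_uminus)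
qed

text \<open>Replacing one factor at a time changes the product by a coboundary times
  cocycles.\<close>

lemma cup_list_cohomologous:
  assumes "list_all2 (\<lambda>\<phi> \<psi>. \<phi> \<in> cocycles 2 X \<and> \<psi> \<in> cocycles 2 X \<and> (\<lambda>\<sigma>. \<phi> \<sigma> - \<psi> \<sigma>) \<in> coboundaries 2 X) S T"
  shows "(\<lambda>\<sigma>. cup_list X S \<sigma> - cup_list X T \<sigma>) \<in> coboundaries (2 * length S) X"
  using assms
proof (induction rule: list_all2_induct)
  case Nil then show ?case by (simp add: coboundaries_zero)
next
  case (Cons \<phi> S \<psi> T)
  have len: "length S = length T" using Cons(2) by (rule list_all2_lengthD)
  have T: "set T \<subseteq> cocycles 2 X" and S: "set S \<subseteq> cocycles 2 X"
    using Cons(2) by (auto simp: list_all2_conv_all_nth in_set_conv_nth)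
  let ?m = "2 * length S"
  have "(\<lambda>\<sigma>. cochain_cup 2 ?m X (\<lambda>\<sigma>. \<phi> \<sigma> - \<psi> \<sigma>) (cup_list X S) \<sigma>
      + cochain_cup 2 ?m X \<psi> (\<lambda>\<sigma>. cup_list X S \<sigma> - cup_list X T \<sigma>) \<sigma>) \<in> coboundaries (2 + ?m) X"
    using Cons S by (intro coboundaries_add cochain_cup_coboundary_left cochain_cup_coboundary_right cup_list_cocycle) auto
  also have "(\<lambda>\<sigma>. cochain_cup 2 ?m X (\<lambda>\<sigma>. \<phi> \<sigma> - \<psi> \<sigma>) (cup_list X S) \<sigma>
      + cochain_cup 2 ?m X \<psi> (\<lambda>\<sigma>. cup_list X S \<sigma> - cup_list X T \<sigma>) \<sigma>)
     = (\<lambda>\<sigma>. cup_list X (\<phi> # S) \<sigma> - cup_list X (\<psi> # T) \<sigma>)"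
    by (auto simp: cochain_cup_def algebra_simps fun_eq_iff len)
  finally show ?case by simp
qed

section \<open>Cross products of cycles\<close>

text \<open>A finite chain with coefficients, seen through its pairing with cochains. Chains given
  by nested sums can then be combined linearly without collecting the coefficients of coinciding
  simplices by hand.\<close>

definition chain_functional :: "nat \<Rightarrow> 'a topology \<Rightarrow> (('a, 'f::comm_ring_1) cochain \<Rightarrow> 'f) \<Rightarrow> bool" where
  "chain_functional p X L \<longleftrightarrow>
     (\<exists>T b. finite T \<and> T \<subseteq> singular_simplex_set p X \<and> (\<forall>\<phi>. L \<phi> = (\<Sum>\<sigma>\<in>T. b \<sigma> * \<phi> \<sigma>)))"

lemma chain_functional_eval: "singular_simplex p X \<sigma> \<Longrightarrow> chain_functional p X (\<lambda>\<phi>. \<phi> \<sigma>)"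
  unfolding chain_functional_def by (intro exI[of _ "{\<sigma>}"] exI[of _ "\<lambda>_. 1"]) auto

lemma chain_functional_zero: "chain_functional p X (\<lambda>\<phi>. 0)"
  unfolding chain_functional_def by (intro exI[of _ "{}"]) auto

lemma chain_functional_mult:
  assumes "chain_functional p X L" shows "chain_functional p X (\<lambda>\<phi>. c * L \<phi>)"
proof -
  obtain T b where "finite T" "T \<subseteq> singular_simplex_set p X" "\<And>\<phi>. L \<phi> = (\<Sum>\<sigma>\<in>T. b \<sigma> * \<phi> \<sigma>)"
    using assms by (auto simp: chain_functional_def)
  then show ?thesis
    unfolding chain_functional_def
    by (intro exI[of _ T] exI[of _ "\<lambda>\<sigma>. c * b \<sigma>"]) (auto simp: sum_distrib_left mult.assoc)
qed

lemma chain_functional_add: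
  assumes "chain_functional p X L" "chain_functional p X L'"
  shows "chain_functional p X (\<lambda>\<phi>. L \<phi> + L' \<phi>)"
proof -
  obtain T b where 1: "finite T" "T \<subseteq> singular_simplex_set p X" "\<And>\<phi>. L \<phi> = (\<Sum>\<sigma>\<in>T. b \<sigma> * \<phi> \<sigma>)"
    using assms(1) by (auto simp: chain_functional_def)
  obtain T' b' where 2: "finite T'" "T' \<subseteq> singular_simplex_set p X" "\<And>\<phi>. L' \<phi> = (\<Sum>\<sigma>\<in>T'. b' \<sigma> * \<phi> \<sigma>)"
    using assms(2) by (auto simp: chain_functional_def)
  let ?c = "\<lambda>\<sigma>. (if \<sigma> \<in> T then b \<sigma> else 0) + (if \<sigma> \<in> T' then b' \<sigma> else 0)"
  have "L \<phi> + L' \<phi> = (\<Sum>\<sigma>\<in>T \<union> T'. ?c \<sigma> * \<phi> \<sigma>)" for \<phi>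
  proof -
    have "L \<phi> = (\<Sum>\<sigma>\<in>T \<union> T'. (if \<sigma> \<in> T then b \<sigma> else 0) * \<phi> \<sigma>)"
      unfolding 1(3) using 1(1) 2(1) by (intro sum.mono_neutral_cong_left) auto
    moreover have "L' \<phi> = (\<Sum>\<sigma>\<in>T \<union> T'. (if \<sigma> \<in> T' then b' \<sigma> else 0) * \<phi> \<sigma>)"
      unfolding 2(3) using 1(1) 2(1) by (intro sum.mono_neutral_cong_left) auto
    ultimately show ?thesis by (simp add: distrib_right sum.distrib)
  qed
  then show ?thesis
    unfolding chain_functional_def using 1 2 by (intro exI[of _ "T \<union> T'"] exI[of _ ?c]) auto
qed

lemma chain_functional_sum:
  assumes "\<And>i. i \<in> A \<Longrightarrow> chain_functional p X (L i)"
  shows "chain_functional p X (\<lambda>\<phi>. \<Sum>i\<in>A. L i \<phi>)"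
  using assms
  by (induction A rule: infinite_finite_induct) (auto intro: chain_functional_zero chain_functional_add)

lemma chain_functional_shuffle_sum:
  assumes "\<And>l. length l + 1 = length I + length J \<Longrightarrow> set l \<subseteq> set I \<times> set J \<Longrightarrow> singular_simplex p X (g l)"
  shows "chain_functional p X (\<lambda>\<phi> :: ('a, 'f::comm_ring_1) cochain. shuffle_sum I J (\<lambda>l. \<phi> (g l)))"
  using assms
proof (induction "length I + length J" arbitrary: I J g rule: less_induct)
  case less
  show ?case
  proof (cases "I = [] \<or> J = []")
    case True then show ?thesis by (auto intro: chain_functional_zero)
  next
    case False
    then obtain i I' j J' where IJ: "I = i # I'" "J = j # J'" by (meson neq_Nil_conv)
    show ?thesis
    proof (cases "I' = [] \<and> J' = []")
      case True
      then show ?thesis using less(2)[of "[(i, j)]"] IJ by (auto intro: chain_functional_eval)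
    next
      case False
      have g: "singular_simplex p X (g ((i, j) # l))"
        if "length l + 1 = length I' + length J \<or> length l + 1 = length I + length J'" "set l \<subseteq> set I \<times> set J" for l
        using that IJ by (intro less(2)) auto
      have sub: "set I' \<times> set J \<subseteq> set I \<times> set J" "set I \<times> set J' \<subseteq> set I \<times> set J"
        by (auto simp: IJ)
      have 1: "chain_functional p X (\<lambda>\<phi> :: ('a, 'f) cochain. shuffle_sum I' J (\<lambda>l. \<phi> (g ((i, j) # l))))"
      proof (rule less(1)[of I' J "\<lambda>l. g ((i, j) # l)"])
        show "singular_simplex p X (g ((i, j) # l))"
          if "length l + 1 = length I' + length J" "set l \<subseteq> set I' \<times> set J" for l
          using that sub by (intro g) blast+
      qed (simp add: IJ)
      have 2: "chain_functional p X (\<lambda>\<phi> :: ('a, 'f) cochain. shuffle_sum I J' (\<lambda>l. \<phi> (g ((i, j) # l))))"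
      proof (rule less(1)[of I J' "\<lambda>l. g ((i, j) # l)"])
        show "singular_simplex p X (g ((i, j) # l))"
          if "length l + 1 = length I + length J'" "set l \<subseteq> set I \<times> set J'" for l
          using that sub by (intro g) blast+
      qed (simp add: IJ)
      have "(\<lambda>\<phi> :: ('a, 'f) cochain. shuffle_sum I J (\<lambda>l. \<phi> (g l))) = (\<lambda>\<phi>. shuffle_sum I' J (\<lambda>l. \<phi> (g ((i, j) # l)))
           + (-1) ^ length I' * shuffle_sum I J' (\<lambda>l. \<phi> (g ((i, j) # l))))"
        using False by (auto simp: IJ fun_eq_iff)
      then show ?thesis using chain_functional_add[OF 1 chain_functional_mult[OF 2]] by simp
    qed
  qed
qed

abbreviation pair_map :: "((nat \<Rightarrow> real) \<Rightarrow> 'a) \<Rightarrow> ((nat \<Rightarrow> real) \<Rightarrow> 'b) \<Rightarrow> (nat \<Rightarrow> real) \<Rightarrow> (nat \<Rightarrow> real) \<Rightarrow> 'a \<times> 'b" where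
  "pair_map \<sigma> \<tau> \<equiv> (\<lambda>x y. (\<sigma> x, \<tau> y))"

lemma bicontinuous_pair_map:
  assumes "singular_simplex p X \<sigma>" "singular_simplex q Y \<tau>"
  shows "bicontinuous p q (prod_topology X Y) (pair_map \<sigma> \<tau>)"
  unfolding bicontinuous_def case_prod_unfold
  by (intro continuous_map_pairedI continuous_map_singular_simplex[OF assms(1)] continuous_map_singular_simplex[OF assms(2)]
      continuous_map_fst continuous_map_snd)

text \<open>The Leibniz rule for the boundary of a cross product in dual form: deleting a column of
  the grid replaces \<sigma> by a face, deleting a row replaces \<tau> by a face.\<close>

lemma shuffle_sum_pair_coboundary:
  assumes \<sigma>: "singular_simplex (Suc p) X \<sigma>" and \<tau>: "singular_simplex (Suc q) Y \<tau>"
  shows "shuffle_sum [0..<Suc (Suc p)] [0..<Suc (Suc q)] (\<lambda>l. coboundary (Suc (p + q)) (prod_topology X Y) \<beta> (bisimplex (pair_map \<sigma> \<tau>) l))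
     = coboundary p X (\<lambda>\<rho>. shuffle_sum [0..<Suc p] [0..<Suc (Suc q)] (\<lambda>l. \<beta> (bisimplex (pair_map \<rho> \<tau>) l))) \<sigma>
     + (-1) ^ Suc p * coboundary q Y (\<lambda>\<rho>. shuffle_sum [0..<Suc (Suc p)] [0..<Suc q] (\<lambda>l. \<beta> (bisimplex (pair_map \<sigma> \<rho>) l))) \<tau>"
proof -
  have 1: "shuffle_sum (remove_nth k [0..<Suc (Suc p)]) [0..<Suc (Suc q)] (\<lambda>l. \<beta> (bisimplex (pair_map \<sigma> \<tau>) l))
     = shuffle_sum [0..<Suc p] [0..<Suc (Suc q)] (\<lambda>l. \<beta> (bisimplex (pair_map (singular_face (Suc p) k \<sigma>) \<tau>) l))" if "k \<le> Suc p" for k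
    unfolding shuffle_sum_face1[OF that]
  proof (intro shuffle_sum_cong arg_cong[of _ _ \<beta>])
    fix l assume "length l + 1 = length [0..<Suc p] + length [0..<Suc (Suc q)]" "set l \<subseteq> set [0..<Suc p] \<times> set [0..<Suc (Suc q)]"
    then show "bisimplex (\<lambda>x. pair_map \<sigma> \<tau> (simplical_face k x)) l = bisimplex (pair_map (singular_face (Suc p) k \<sigma>) \<tau>) l"
      by (intro bisimplex_cong[of p "Suc q"]) (auto simp: singular_face_def)
  qed
  have 2: "shuffle_sum [0..<Suc (Suc p)] (remove_nth k [0..<Suc (Suc q)]) (\<lambda>l. \<beta> (bisimplex (pair_map \<sigma> \<tau>) l))
     = shuffle_sum [0..<Suc (Suc p)] [0..<Suc q] (\<lambda>l. \<beta> (bisimplex (pair_map \<sigma> (singular_face (Suc q) k \<tau>)) l))" if "k \<le> Suc q" for k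
    unfolding shuffle_sum_face2[OF that]
  proof (intro shuffle_sum_cong arg_cong[of _ _ \<beta>])
    fix l assume "length l + 1 = length [0..<Suc (Suc p)] + length [0..<Suc q]" "set l \<subseteq> set [0..<Suc (Suc p)] \<times> set [0..<Suc q]"
    then show "bisimplex (\<lambda>x y. pair_map \<sigma> \<tau> x (simplical_face k y)) l = bisimplex (pair_map \<sigma> (singular_face (Suc q) k \<tau>)) l"
      by (intro bisimplex_cong[of "Suc p" q]) (auto simp: singular_face_def)
  qed
  have d: "Suc p + Suc q = Suc (Suc (p + q))" by simp
  show ?thesis
    unfolding shuffle_sum_bisimplex_coboundary[OF bicontinuous_pair_map[OF \<sigma> \<tau>] d]
    unfolding coboundary_def if_P[OF \<sigma>] if_P[OF \<tau>]
    by (intro arg_cong2[of _ _ _ _ "(+)"] arg_cong2[of _ _ _ _ "(*)"] sum.cong refl; simp only: atMost_iff 1 2)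
qed

text \<open>By the Leibniz rule a coboundary on the product pairs to two terms. After an interchange
  of the sums in the first, each contains a coboundary summed over one of the two given cycles,
  which is 0.\<close>

lemma cross_product_cycle:
  fixes a :: "('a, 'f::comm_ring_1) cochain" and a' :: "('b, 'f) cochain"
  assumes S: "field_cycle p X S a" and S': "field_cycle q Y S' a'"
  obtains T b where "field_cycle (Suc (p + q)) (prod_topology X Y) T b"
    "\<And>\<Theta>. (\<Sum>\<rho>\<in>T. b \<rho> * \<Theta> \<rho>) = (\<Sum>\<sigma>\<in>S. a \<sigma> * (\<Sum>\<tau>\<in>S'. a' \<tau> *
       shuffle_sum [0..<Suc (Suc p)] [0..<Suc (Suc q)] (\<lambda>l. \<Theta> (bisimplex (pair_map \<sigma> \<tau>) l))))"
proof -
  let ?Z = "prod_topology X Y"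
  let ?sh = "\<lambda>\<sigma> \<tau> \<Theta>. shuffle_sum [0..<Suc (Suc p)] [0..<Suc (Suc q)] (\<lambda>l. \<Theta> (bisimplex (pair_map \<sigma> \<tau>) l))"
  define L where "L \<Theta> = (\<Sum>\<sigma>\<in>S. a \<sigma> * (\<Sum>\<tau>\<in>S'. a' \<tau> * ?sh \<sigma> \<tau> \<Theta>))" for \<Theta> :: "('a \<times> 'b, 'f) cochain"
  have simp: "\<And>\<sigma>. \<sigma> \<in> S \<Longrightarrow> singular_simplex (Suc p) X \<sigma>" "\<And>\<tau>. \<tau> \<in> S' \<Longrightarrow> singular_simplex (Suc q) Y \<tau>"
    using S S' by (auto simp: field_cycle_def)
  have "chain_functional (Suc (Suc (p + q))) ?Z L"
    unfolding L_def
  proof (intro chain_functional_sum chain_functional_mult chain_functional_shuffle_sum)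
    fix \<sigma> \<tau> l assume st: "\<sigma> \<in> S" "\<tau> \<in> S'" and l: "length l + 1 = length [0..<Suc (Suc p)] + length [0..<Suc (Suc q)]"
      "set l \<subseteq> set [0..<Suc (Suc p)] \<times> set [0..<Suc (Suc q)]"
    show "singular_simplex (Suc (Suc (p + q))) ?Z (bisimplex (pair_map \<sigma> \<tau>) l)"
      by (rule singular_simplex_bisimplex[OF bicontinuous_pair_map[OF simp(1)[OF st(1)] simp(2)[OF st(2)]]]) (use l in auto)
  qed
  then obtain T b where T: "finite T" "T \<subseteq> singular_simplex_set (Suc (Suc (p + q))) ?Z" "\<And>\<Theta>. L \<Theta> = (\<Sum>\<rho>\<in>T. b \<rho> * \<Theta> \<rho>)"
    unfolding chain_functional_def by blast
  have "L (coboundary (Suc (p + q)) ?Z \<beta>) = 0" for \<beta>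
  proof -
    let ?f = "\<lambda>\<sigma> \<tau>. coboundary p X (\<lambda>\<rho>. shuffle_sum [0..<Suc p] [0..<Suc (Suc q)] (\<lambda>l. \<beta> (bisimplex (pair_map \<rho> \<tau>) l))) \<sigma>"
    let ?g = "\<lambda>\<sigma> \<tau>. coboundary q Y (\<lambda>\<rho>. shuffle_sum [0..<Suc (Suc p)] [0..<Suc q] (\<lambda>l. \<beta> (bisimplex (pair_map \<sigma> \<rho>) l))) \<tau>"
    have "L (coboundary (Suc (p + q)) ?Z \<beta>) = (\<Sum>\<sigma>\<in>S. a \<sigma> * (\<Sum>\<tau>\<in>S'. a' \<tau> * (?f \<sigma> \<tau> + (-1) ^ Suc p * ?g \<sigma> \<tau>)))"
      unfolding L_def using simp by (intro sum.cong refl arg_cong2[of _ _ _ _ "(*)"] shuffle_sum_pair_coboundary) auto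
    also have "\<dots> = (\<Sum>\<sigma>\<in>S. \<Sum>\<tau>\<in>S'. a' \<tau> * (a \<sigma> * ?f \<sigma> \<tau>)) + (\<Sum>\<sigma>\<in>S. a \<sigma> * ((-1) ^ Suc p * (\<Sum>\<tau>\<in>S'. a' \<tau> * ?g \<sigma> \<tau>)))"
    proof -
      have "(\<Sum>\<sigma>\<in>S. a \<sigma> * (\<Sum>\<tau>\<in>S'. a' \<tau> * (f \<sigma> \<tau> + e * g \<sigma> \<tau>)))
        = (\<Sum>\<sigma>\<in>S. \<Sum>\<tau>\<in>S'. a' \<tau> * (a \<sigma> * f \<sigma> \<tau>)) + (\<Sum>\<sigma>\<in>S. a \<sigma> * (e * (\<Sum>\<tau>\<in>S'. a' \<tau> * g \<sigma> \<tau>)))"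
        for f g e by (simp add: sum.distrib sum_distrib_left distrib_left mult_ac)
      then show ?thesis .
    qed
    also have "(\<Sum>\<sigma>\<in>S. \<Sum>\<tau>\<in>S'. a' \<tau> * (a \<sigma> * ?f \<sigma> \<tau>)) = (\<Sum>\<tau>\<in>S'. a' \<tau> * (\<Sum>\<sigma>\<in>S. a \<sigma> * ?f \<sigma> \<tau>))"
      by (subst sum.swap) (simp only: sum_distrib_left)
    finally show ?thesis
      using S S' by (simp add: field_cycle_def)
  qed
  then have "field_cycle (Suc (p + q)) ?Z T b"
    using T by (simp add: field_cycle_def)
  moreover have "(\<Sum>\<rho>\<in>T. b \<rho> * \<Theta> \<rho>) = (\<Sum>\<sigma>\<in>S. a \<sigma> * (\<Sum>\<tau>\<in>S'. a' \<tau> * ?sh \<sigma> \<tau> \<Theta>))" for \<Theta>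
    unfolding T(3)[symmetric] L_def ..
  ultimately show ?thesis by (rule that)
qed

section \<open>The lower bound\<close>

definition zero_divisor :: "'a topology \<Rightarrow> ('a, 'f::comm_ring_1) cochain \<Rightarrow> ('a \<times> 'a, 'f) cochain" where
  "zero_divisor X \<phi> = (\<lambda>\<rho>. cochain_map 2 (prod_topology X X) snd \<phi> \<rho> - cochain_map 2 (prod_topology X X) fst \<phi> \<rho>)"

lemma cochain_map_cocycle:
  assumes "continuous_map Y X f" "\<phi> \<in> cocycles p X"
  shows "cochain_map p Y f \<phi> \<in> cocycles p Y"
  using assms cochain_map_coboundary[OF assms(1), of p \<phi>]
  by (simp add: cocycles_def cochain_map_in) (simp add: cochain_map_def fun_eq_iff)

lemma zero_divisor_cocycle: "\<phi> \<in> cocycles 2 X \<Longrightarrow> zero_divisor X \<phi> \<in> cocycles 2 (prod_topology X X)"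
  using cochain_map_cocycle[OF continuous_map_snd, of \<phi> 2 X X] cochain_map_cocycle[OF continuous_map_fst, of \<phi> 2 X X]
    coboundary_add[of 2 "prod_topology X X" "cochain_map 2 (prod_topology X X) snd \<phi>" "\<lambda>\<rho>. - cochain_map 2 (prod_topology X X) fst \<phi> \<rho>"]
  by (simp add: zero_divisor_def cocycles_def singular_cochains_def coboundary_uminus)

lemma block_prod_cong:
  assumes "list_all2 (\<lambda>w v. \<forall>a\<in>D. \<forall>b\<in>D. \<forall>c\<in>D. w a b c = v a b c) ws vs" "set l \<subseteq> D"
  shows "block_prod ws l = block_prod vs l"
  using assms
proof (induction arbitrary: l rule: list_all2_induct)
  case (Cons w ws v vs)
  show ?case
  proof (cases "\<exists>a b c l'. l = a # b # c # l'")
    case True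
    then obtain a b c l' where l: "l = a # b # c # l'" by blast
    then show ?thesis using Cons by simp
  next
    case False
    then have "length l < 3" by (cases l; cases "tl l"; cases "tl (tl l)") auto
    then show ?thesis by (simp add: block_prod_wrong_length)
  qed
qed simp

text \<open>The projections take a simplex of the grid to subsimplices of \<sigma> and \<tau>, so on
  lattice paths a product of zero-divisors is a \<open>block_prod\<close> of
  \<open>block_diff\<close>s, and normalisation supplies the vanishing on degenerate
  triples.\<close>

lemma shuffle_sum_zero_divisors:
  assumes \<sigma>: "singular_simplex (2 * n) X \<sigma>" and \<tau>: "singular_simplex (2 * n) X \<tau>"
    and len: "length \<phi>s = 2 * n" and norm: "\<And>\<phi>. \<phi> \<in> set \<phi>s \<Longrightarrow> normalized2 X \<phi>"
  shows "shuffle_sum [0..<Suc (2 * n)] [0..<Suc (2 * n)]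
      (\<lambda>l. cup_list (prod_topology X X) (map (zero_divisor X) \<phi>s) (bisimplex (pair_map \<sigma> \<tau>) l)) =
    split_sum (\<lambda>S T. (-1) ^ length S
       * block_prod (map (\<lambda>\<phi> i j k. \<phi> (subsimplex \<sigma> [i, j, k])) S) [0..<Suc (2 * n)]
       * block_prod (map (\<lambda>\<phi> i j k. \<phi> (subsimplex \<tau> [i, j, k])) T) [0..<Suc (2 * n)]) \<phi>s"
proof -
  let ?I = "[0..<Suc (2 * n)]" and ?Z = "prod_topology X X" and ?K = "pair_map \<sigma> \<tau>"
  let ?A = "\<lambda>\<rho> \<phi> i j k. \<phi> (subsimplex \<rho> [i, j, k])"
  let ?ws = "map (\<lambda>\<phi>. (?A \<sigma> \<phi>, ?A \<tau> \<phi>)) \<phi>s"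
  have bi: "bicontinuous (2 * n) (2 * n) ?Z ?K" by (rule bicontinuous_pair_map[OF \<sigma> \<tau>])
  have zd: "zero_divisor X \<phi> (bisimplex ?K [a, b, c]) = block_diff (?A \<sigma> \<phi>, ?A \<tau> \<phi>) a b c"
    if "a \<in> {..2 * n} \<times> {..2 * n}" "b \<in> {..2 * n} \<times> {..2 * n}" "c \<in> {..2 * n} \<times> {..2 * n}" for \<phi> :: "('a, 'b) cochain" and a b c
  proof -
    have "singular_simplex 2 ?Z (bisimplex ?K [a, b, c])"
      using that by (intro singular_simplex_bisimplex[OF bi]) auto
    moreover have "simplex_map 2 snd (bisimplex ?K [a, b, c]) = subsimplex \<tau> [snd a, snd b, snd c]"
      "simplex_map 2 fst (bisimplex ?K [a, b, c]) = subsimplex \<sigma> [fst a, fst b, fst c]"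
      by (auto simp: simplex_map_def bisimplex_def subsimplex_def restrict_def fun_eq_iff numeral_2_eq_2)
    ultimately show ?thesis by (simp add: zero_divisor_def cochain_map_def block_diff_def)
  qed
  have "shuffle_sum ?I ?I (\<lambda>l. cup_list ?Z (map (zero_divisor X) \<phi>s) (bisimplex ?K l)) = shuffle_sum ?I ?I (block_prod (map block_diff ?ws))"
  proof (rule shuffle_sum_cong)
    fix l assume l: "length l + 1 = length ?I + length ?I" "set l \<subseteq> set ?I \<times> set ?I"
    then have sl: "set l \<subseteq> {..2 * n} \<times> {..2 * n}" by auto
    have "cup_list ?Z (map (zero_divisor X) \<phi>s) (bisimplex ?K l)
       = block_prod (map (\<lambda>\<phi> a b c. \<phi> (bisimplex ?K [a, b, c])) (map (zero_divisor X) \<phi>s)) l"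
      using l sl len by (intro cup_list_bisimplex[OF bi]) auto
    also have "\<dots> = block_prod (map block_diff ?ws) l"
      by (rule block_prod_cong[OF _ sl]) (auto simp: list_all2_conv_all_nth zd[simplified])
    finally show "cup_list ?Z (map (zero_divisor X) \<phi>s) (bisimplex ?K l) = block_prod (map block_diff ?ws) l" .
  qed
  also have "\<dots> = split_sum (\<lambda>S T. (-1) ^ length S * block_prod (map fst S) ?I * block_prod (map snd T) ?I) ?ws"
  proof (rule shuffle_sum_block_prod[where P = "{..2 * n}" and Q = "{..2 * n}"])
    show "fst w i i j = 0 \<and> fst w i j j = 0" if "w \<in> set ?ws" "i \<in> {..2 * n}" "j \<in> {..2 * n}" for w i j
      using that norm \<sigma> unfolding normalized2_def by fastforce
    show "snd w i i j = 0 \<and> snd w i j j = 0" if "w \<in> set ?ws" "i \<in> {..2 * n}" "j \<in> {..2 * n}" for w i j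
      using that norm \<tau> unfolding normalized2_def by fastforce
  qed (use len in auto)
  finally show ?thesis by (simp add: split_sum_map o_def del: upt_Suc)
qed

text \<open>Two cohomologous cocycles are paired with the same cycle. For \<Omega>, the product of
  the zero-divisors, the value can be computed; in \<Omega>' every factor is replaced by a
  cohomologous one that vanishes on its two sets, so \<Omega>' vanishes on all simplices small with
  respect to the cover.\<close>

lemma topological_complexity_lower_bound:
  fixes xs :: "('a, 'f::field) cochain list"
  assumes two: "(2::'f) \<noteq> 0" and n: "length xs = n" "n > 0"
    and xs: "\<And>\<phi>. \<phi> \<in> set xs \<Longrightarrow> \<phi> \<in> cocycles 2 X" "\<And>\<phi>. \<phi> \<in> set xs \<Longrightarrow> normalized2 X \<phi>"
      "\<And>\<phi>. \<phi> \<in> set xs \<Longrightarrow> atoroidal 2 X (cohomology_class 2 X \<phi>)"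
      "\<And>\<phi>. \<phi> \<in> set xs \<Longrightarrow> cochain_cup 2 2 X \<phi> \<phi> \<in> coboundaries 4 X"
    and nz: "cup_list X xs \<notin> coboundaries (2 * n) X"
    and cover: "(\<Union>j\<le>k. U j) = topspace (prod_topology X X)"
    and U: "\<And>j. j \<le> k \<Longrightarrow> openin (prod_topology X X) (U j)"
    and s: "\<And>j. j \<le> k \<Longrightarrow> continuous_map (subtopology (prod_topology X X) (U j)) (path_space X) (s j)"
      "\<And>j z. j \<le> k \<Longrightarrow> z \<in> U j \<Longrightarrow> path_ends (s j z) = z"
  shows "4 * n \<le> k"
proof (rule ccontr)
  assume "\<not> 4 * n \<le> k"
  define Z where "Z = prod_topology X X"
  \<comment> \<open>\<open>field_cycle\<close> is indexed by the degree minus one, so the degree 2n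
    is written as \<open>Suc p\<close>; here n > 0 enters.\<close>
  define p where "p = 2 * n - 1"
  have p: "2 * n = Suc p" using n by (simp add: p_def)
  \<comment> \<open>The k + 1 \<le> 4n sets are listed as 4n sets by repeating the last one. Factor
    b is in charge of \<open>V (2 * b)\<close> and \<open>V (2 * b + 1)\<close>.\<close>
  define V where "V j = U (min j k)" for j
  define \<phi>s where "\<phi>s = concat (map (\<lambda>\<phi>. [\<phi>, \<phi>]) xs)"
  have "length \<phi>s = 2 * length xs" unfolding \<phi>s_def by (induction xs) auto
  then have len: "length \<phi>s = 2 * n" by (simp add: n)
  have set_\<phi>s: "set \<phi>s = set xs" by (auto simp: \<phi>s_def)
  have \<phi>b: "\<phi>s ! b \<in> set xs" if "b < 2 * n" for b using that len set_\<phi>s by (metis nth_mem)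
  have "\<exists>\<beta>. \<beta> \<in> singular_cochains 1 Z \<and> (\<forall>\<rho>. singular_simplex 2 Z \<rho> \<longrightarrow>
      \<rho> ` standard_simplex 2 \<subseteq> V (2 * b) \<or> \<rho> ` standard_simplex 2 \<subseteq> V (2 * b + 1) \<longrightarrow>
      zero_divisor X (\<phi>s ! b) \<rho> - coboundary 1 Z \<beta> \<rho> = 0)" if "b < 2 * n" for b
  proof (rule atoroidal_zero_divisor_vanishes[OF xs(1)[OF \<phi>b[OF that]] xs(3)[OF \<phi>b[OF that]],
        of "V (2 * b)" "s (min (2 * b) k)" "V (2 * b + 1)" "s (min (2 * b + 1) k)"])
    fix \<beta> assume "\<beta> \<in> singular_cochains 1 (prod_topology X X)"
     "\<And>\<sigma>. singular_simplex 2 (prod_topology X X) \<sigma> \<Longrightarrow> \<sigma> ` standard_simplex 2 \<subseteq> V (2 * b) \<or> \<sigma> ` standard_simplex 2 \<subseteq> V (2 * b + 1) \<Longrightarrow>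
       coboundary 1 (prod_topology X X) \<beta> \<sigma> = (\<phi>s ! b) (simplex_map 2 snd \<sigma>) - (\<phi>s ! b) (simplex_map 2 fst \<sigma>)"
    then show ?thesis
      by (intro exI[of _ \<beta>]) (auto simp: Z_def zero_divisor_def cochain_map_def)
  qed (auto simp: V_def intro: s)
  then obtain \<beta> where \<beta>: "\<And>b. b < 2 * n \<Longrightarrow> \<beta> b \<in> singular_cochains 1 Z"
    "\<And>b \<rho>. b < 2 * n \<Longrightarrow> singular_simplex 2 Z \<rho> \<Longrightarrow>
      \<rho> ` standard_simplex 2 \<subseteq> V (2 * b) \<or> \<rho> ` standard_simplex 2 \<subseteq> V (2 * b + 1) \<Longrightarrow>
      zero_divisor X (\<phi>s ! b) \<rho> - coboundary 1 Z (\<beta> b) \<rho> = 0" by metis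
  define \<omega> where "\<omega> b = (\<lambda>\<rho>. zero_divisor X (\<phi>s ! b) \<rho> - coboundary 1 Z (\<beta> b) \<rho>)" for b
  define \<Omega> where "\<Omega> = cup_list Z (map (zero_divisor X) \<phi>s)"
  define \<Omega>' where "\<Omega>' = cup_list Z (map \<omega> [0..<2 * n])"
  have zd: "zero_divisor X (\<phi>s ! b) \<in> cocycles 2 Z" if "b < 2 * n" for b
    unfolding Z_def by (rule zero_divisor_cocycle[OF xs(1)[OF \<phi>b[OF that]]])
  have bd: "coboundary 1 Z (\<beta> b) \<in> coboundaries 2 Z" if "b < 2 * n" for b
    using \<beta>(1)[OF that] by (auto simp: coboundaries_def numeral_2_eq_2)
  have \<omega>: "\<omega> b \<in> cocycles 2 Z" if "b < 2 * n" for b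
    unfolding \<omega>_def by (rule cocycles_diff[OF zd[OF that] bd[OF that]])
  have \<Omega>'_cocycle: "\<Omega>' \<in> cocycles (4 * n) Z"
  proof -
    have "set (map \<omega> [0..<2 * n]) \<subseteq> cocycles 2 Z" using \<omega> by auto
    from cup_list_cocycle[OF this] show ?thesis by (simp add: \<Omega>'_def)
  qed
  have "(\<lambda>\<sigma>. \<Omega> \<sigma> - \<Omega>' \<sigma>) \<in> coboundaries (2 * length (map (zero_divisor X) \<phi>s)) Z"
    unfolding \<Omega>_def \<Omega>'_def
    by (rule cup_list_cohomologous) (use len zd \<omega> bd in \<open>auto simp: list_all2_conv_all_nth \<omega>_def\<close>)
  then have diff: "(\<lambda>\<sigma>. \<Omega> \<sigma> - \<Omega>' \<sigma>) \<in> coboundaries (4 * n) Z" by (simp add: len)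
  have small: "\<Omega>' \<rho> = 0" if \<rho>: "singular_simplex (4 * n) Z \<rho>" and W: "W \<in> U ` {..k}" "\<rho> ` standard_simplex (4 * n) \<subseteq> W" for \<rho> W
  proof -
    obtain j where j: "j \<le> k" "W = U j" using W by auto
    then have j4: "j < 4 * n" "V j = U j" using \<open>\<not> 4 * n \<le> k\<close> by (auto simp: V_def)
    \<comment> \<open>The set with number j belongs to factor b. Its block evaluates
      \<open>\<omega> b\<close> on a face of \<rho>, which lies in the same set as \<rho>, so this
      one factor annihilates the product.\<close>
    define b where "b = j div 2"
    have b: "b < 2 * n" "j = 2 * b \<or> j = 2 * b + 1" using j4 by (auto simp: b_def)
    let ?I = "[0..<Suc (2 * length (map \<omega> [0..<2 * n]))]"
    let ?\<rho> = "subsimplex \<rho> [2 * b, 2 * b + 1, 2 * b + 2]"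
    have "singular_simplex (2 * length (map \<omega> [0..<2 * n])) Z \<rho>" using \<rho> by simp
    then have "\<Omega>' \<rho> = block_prod (map (\<lambda>\<phi> i j k. \<phi> (subsimplex \<rho> [i, j, k])) (map \<omega> [0..<2 * n])) ?I"
      unfolding \<Omega>'_def by (rule cup_list_simplex)
    also have "\<dots> = 0"
    proof (rule block_prod_zero[of b])
      have "singular_simplex 2 Z ?\<rho>"
        unfolding subsimplex_bisimplex
        by (rule singular_simplex_bisimplex[OF bicontinuous_fst[OF \<rho>]]) (use b in auto)
      moreover have "?\<rho> ` standard_simplex 2 \<subseteq> \<rho> ` standard_simplex (4 * n)"
        using b vertex_map_in_standard_simplex[of _ 2 "[2 * b, 2 * b + 1, 2 * b + 2]" "4 * n"]
        by (auto simp: subsimplex_def numeral_2_eq_2)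
      ultimately have "\<omega> b ?\<rho> = 0"
        unfolding \<omega>_def using \<beta>(2)[OF b(1), of ?\<rho>] W(2) j j4 b(2) by auto
      then show "(map (\<lambda>\<phi> i j k. \<phi> (subsimplex \<rho> [i, j, k])) (map \<omega> [0..<2 * n]) ! b) (?I ! (2 * b)) (?I ! (2 * b + 1)) (?I ! (2 * b + 2)) = 0"
        using b(1) by (simp del: upt_Suc)
    qed (use b in auto)
    finally show ?thesis .
  qed
  have cl: "cup_list X S \<in> singular_cochains (Suc p) X" if "length S = n" for S :: "('a, 'f) cochain list"
    using cup_list_in[of X S] that p by simp
  obtain S a where S: "field_cycle p X S a" and S_nz: "(\<Sum>\<sigma>\<in>S. a \<sigma> * cup_list X xs \<sigma>) \<noteq> 0"
    using field_cycle_detects[OF cl[OF n(1)]] nz p by metis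
  obtain T c where T: "field_cycle (Suc (p + p)) Z T c"
    and Tc: "\<And>\<Theta>. (\<Sum>\<rho>\<in>T. c \<rho> * \<Theta> \<rho>) = (\<Sum>\<sigma>\<in>S. a \<sigma> * (\<Sum>\<tau>\<in>S. a \<tau> *
       shuffle_sum [0..<Suc (Suc p)] [0..<Suc (Suc p)] (\<lambda>l. \<Theta> (bisimplex (pair_map \<sigma> \<tau>) l))))"
  proof (rule cross_product_cycle[OF S S])
    fix T c assume "field_cycle (Suc (p + p)) (prod_topology X X) T c"
      and "\<And>\<Theta>. (\<Sum>\<rho>\<in>T. c \<rho> * \<Theta> \<rho>) = (\<Sum>\<sigma>\<in>S. a \<sigma> * (\<Sum>\<tau>\<in>S. a \<tau> *
       shuffle_sum [0..<Suc (Suc p)] [0..<Suc (Suc p)] (\<lambda>l. \<Theta> (bisimplex (pair_map \<sigma> \<tau>) l))))"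
    then show thesis unfolding Z_def[symmetric] by (rule that)
  qed
  have 4: "4 * n = Suc (Suc (p + p))" using p by simp
  have S2: "singular_simplex (2 * n) X \<sigma>" if "\<sigma> \<in> S" for \<sigma> using S that p by (auto simp: field_cycle_def)
  define E where "E S' = (\<Sum>\<sigma>\<in>S. a \<sigma> * block_prod (map (\<lambda>\<phi> i j k. \<phi> (subsimplex \<sigma> [i, j, k])) S') [0..<Suc (2 * n)])" for S'
  have E: "E S' = (if length S' = n then \<Sum>\<sigma>\<in>S. a \<sigma> * cup_list X S' \<sigma> else 0)" for S'
  proof (cases "length S' = n")
    case True
    then show ?thesis using S2 cup_list_simplex[of S' X] by (auto simp: E_def simp del: upt_Suc intro!: sum.cong)
  qed (simp add: E_def block_prod_wrong_length del: upt_Suc)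
  have E0: "E (P @ \<phi> # \<phi> # S') = 0" if "set (P @ \<phi> # S') \<subseteq> set xs" for P \<phi> S'
  proof (cases "length (P @ \<phi> # \<phi> # S') = n")
    case True
    have "set (P @ \<phi> # S') \<subseteq> cocycles 2 X" using that xs(1) by blast
    from cup_list_square[OF this] have "cup_list X (P @ \<phi> # \<phi> # S') \<in> coboundaries (Suc p) X"
      using that xs(4) unfolding True p by simp
    then obtain \<gamma> where "cup_list X (P @ \<phi> # \<phi> # S') = coboundary p X \<gamma>" by (auto simp: coboundaries_def)
    then show ?thesis using S True by (simp add: E field_cycle_def del: length_append list.size)
  qed (simp add: E)
  have "(\<Sum>\<rho>\<in>T. c \<rho> * \<Omega> \<rho>) = (\<Sum>\<sigma>\<in>S. a \<sigma> * (\<Sum>\<tau>\<in>S. a \<tau> * split_sum (\<lambda>S T. (-1) ^ length S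
       * block_prod (map (\<lambda>\<phi> i j k. \<phi> (subsimplex \<sigma> [i, j, k])) S) [0..<Suc (2 * n)]
       * block_prod (map (\<lambda>\<phi> i j k. \<phi> (subsimplex \<tau> [i, j, k])) T) [0..<Suc (2 * n)]) \<phi>s))"
    unfolding Tc \<Omega>_def Z_def p[symmetric]
    using S2 len xs set_\<phi>s by (intro sum.cong refl arg_cong2[of _ _ _ _ "(*)"] shuffle_sum_zero_divisors) auto
  also have "\<dots> = split_sum (\<lambda>S T. (-1) ^ length S * E S * E T) \<phi>s"
    unfolding E_def split_sum_mult[symmetric] split_sum_sum[symmetric]
    by (rule arg_cong[of _ _ "\<lambda>F. split_sum F \<phi>s"])
      (simp add: fun_eq_iff sum_distrib_left sum_distrib_right mult_ac del: upt_Suc)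
  \<comment> \<open>By E0 all splittings with both copies of a class on one side contribute 0. The
    2^n others all give \<open>xs\<close> twice, with sign (-1)^n; their common value is the square
    of the nonzero pairing of the cycle with the product of the classes.\<close>
  also have "\<dots> = 2 ^ length xs * ((-1) ^ length xs * E xs * E xs)"
    unfolding \<phi>s_def by (rule split_sum_double[where D = "set xs"]) (auto simp: E0)
  finally have "(\<Sum>\<rho>\<in>T. c \<rho> * \<Omega> \<rho>) \<noteq> 0"
    using two S_nz n by (simp add: E)
  moreover have "(\<Sum>\<rho>\<in>T. c \<rho> * \<Omega>' \<rho>) = 0"
  proof (rule field_cycle_small[OF T _ _ _ small[unfolded 4]])
    show "\<Omega>' \<in> cocycles (Suc (Suc (p + p))) Z" using \<Omega>'_cocycle unfolding 4 .
    show "openin Z W" if "W \<in> U ` {..k}" for W using that U by (auto simp: Z_def)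
    show "topspace Z \<subseteq> \<Union> (U ` {..k})" using cover by (simp add: Z_def)
  qed auto
  moreover have "(\<Sum>\<rho>\<in>T. c \<rho> * (\<Omega> \<rho> - \<Omega>' \<rho>)) = 0"
    using diff T unfolding 4 by (auto simp: coboundaries_def field_cycle_def fun_eq_iff)
  ultimately show False by (simp add: right_diff_distrib sum_subtractf)
qed

section \<open>Disks\<close>

definition disk :: "nat \<Rightarrow> (nat \<Rightarrow> real) topology" where
  "disk k = subtopology (Euclidean_space k) (closed_disk k)"

definition radius :: "nat \<Rightarrow> (nat \<Rightarrow> real) \<Rightarrow> real" where
  "radius k y = sqrt (\<Sum>i<k. (y i)\<^sup>2)"

definition scale :: "real \<Rightarrow> (nat \<Rightarrow> real) \<Rightarrow> nat \<Rightarrow> real" where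
  "scale a y = (\<lambda>i. a * y i)"

lemma radius_scale: "radius k (scale a y) = \<bar>a\<bar> * radius k y"
proof -
  have "(\<Sum>i<k. (a * y i)\<^sup>2) = a\<^sup>2 * (\<Sum>i<k. (y i)\<^sup>2)"
    by (simp add: power_mult_distrib sum_distrib_left)
  then show ?thesis by (simp add: radius_def scale_def real_sqrt_mult)
qed

lemma radius_nonneg: "0 \<le> radius k y"
  by (simp add: radius_def sum_nonneg)

lemma scale_1 [simp]: "scale 1 y = y"
  by (simp add: scale_def)

lemma closed_disk_iff: "y \<in> closed_disk k \<longleftrightarrow> (\<forall>i\<ge>k. y i = 0) \<and> radius k y \<le> 1"
  by (simp add: closed_disk_def radius_def topspace_Euclidean_space)

lemma open_disk_iff: "y \<in> open_disk k \<longleftrightarrow> (\<forall>i\<ge>k. y i = 0) \<and> radius k y < 1"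
  by (simp add: open_disk_def radius_def topspace_Euclidean_space)

lemma open_disk_subset: "open_disk k \<subseteq> closed_disk k"
  by (auto simp: open_disk_iff closed_disk_iff)

lemma topspace_disk [simp]: "topspace (disk k) = closed_disk k"
  by (auto simp: disk_def closed_disk_def)

lemma scale_in_disk: "y \<in> closed_disk k \<Longrightarrow> \<bar>a\<bar> * radius k y \<le> 1 \<Longrightarrow> scale a y \<in> closed_disk k"
  by (simp add: closed_disk_iff radius_scale) (simp add: scale_def)

lemma disk_eq: "disk k = subtopology (powertop_real UNIV) (closed_disk k)"
proof -
  have "{x. \<forall>i\<ge>k. x i = 0} \<inter> closed_disk k = closed_disk k" by (auto simp: closed_disk_iff)
  then show ?thesis by (simp add: disk_def Euclidean_space_def subtopology_subtopology)
qed

lemma continuous_map_into_disk: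
  assumes "\<And>i. continuous_map Y euclideanreal (\<lambda>w. h w i)" "\<And>w. w \<in> topspace Y \<Longrightarrow> h w \<in> closed_disk k"
  shows "continuous_map Y (disk k) h"
  using assms by (auto simp: disk_eq continuous_map_in_subtopology continuous_map_componentwise)

lemma continuous_map_disk_coordinate: "continuous_map (disk k) euclideanreal (\<lambda>y. y i)"
  unfolding disk_eq by (rule continuous_map_coordinate)

lemma continuous_map_radius: "continuous_map (disk k) euclideanreal (radius k)"
  unfolding radius_def
  by (intro continuous_map_sqrt continuous_map_sum continuous_map_real_pow continuous_map_disk_coordinate) auto

text \<open>The disk is a closed subset of a product of intervals [-1, 1], which is compact by
  Tychonoff's theorem.\<close>

lemma compact_space_disk: "compact_space (disk k)"
proof -
  let ?X = "powertop_real UNIV"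
  have eq: "closed_disk k = (\<Inter>i \<in> {k..}. {x \<in> topspace ?X. x i \<in> {0}}) \<inter> {x \<in> topspace ?X. (\<Sum>i<k. (x i)\<^sup>2) \<in> {..1}}"
    by (auto simp: closed_disk_def topspace_Euclidean_space)
  have "continuous_map ?X euclideanreal (\<lambda>x. \<Sum>i<k. (x i)\<^sup>2)"
    by (intro continuous_map_sum continuous_map_real_pow continuous_map_product_projection) auto
  then have 1: "closedin ?X {x \<in> topspace ?X. (\<Sum>i<k. (x i)\<^sup>2) \<in> {..1}}"
    by (rule closedin_continuous_map_preimage) simp
  have 2: "closedin ?X {x \<in> topspace ?X. x i \<in> {0}}" for i
    by (rule closedin_continuous_map_preimage[OF continuous_map_product_projection]) auto
  have cl: "closedin ?X (closed_disk k)"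
    unfolding eq using 1 2 by (intro closedin_Int closedin_Inter) auto
  have "y i \<in> {-1..1}" if "y \<in> closed_disk k" for y i
  proof (cases "i < k")
    case True
    have "(y i)\<^sup>2 \<le> (\<Sum>i<k. (y i)\<^sup>2)" using True by (intro member_le_sum) auto
    also have "\<dots> \<le> 1" using that by (simp add: closed_disk_def)
    finally have "\<bar>y i\<bar> \<le> 1" by (simp add: abs_square_le_1)
    then show ?thesis by auto
  next
    case False then show ?thesis using that by (simp add: closed_disk_iff)
  qed
  then have "closed_disk k \<subseteq> UNIV \<rightarrow>\<^sub>E {-1..1}" by auto
  moreover have "compactin ?X (UNIV \<rightarrow>\<^sub>E {-1..1})" by (simp add: compactin_PiE)
  ultimately have "compactin ?X (closed_disk k)" using cl by (metis closed_compactin)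
  then show ?thesis unfolding disk_eq by (rule compact_space_subtopology)
qed

lemma path_connected_space_disk: "path_connected_space (disk k)"
proof -
  have "path_component_of (disk k) y (\<lambda>_. 0)" if y: "y \<in> closed_disk k" for y
    unfolding path_component_of_def pathin_def
  proof (intro exI conjI)
    show "continuous_map unit_interval (disk k) (\<lambda>t. scale (1 - t) y)"
    proof (rule continuous_map_into_disk)
      show "continuous_map unit_interval euclideanreal (\<lambda>t. scale (1 - t) y i)" for i
        unfolding scale_def by (simp add: continuous_intros)
      show "scale (1 - t) y \<in> closed_disk k" if "t \<in> topspace unit_interval" for t
        using that y radius_nonneg[of k y] by (intro scale_in_disk) (auto simp: closed_disk_iff intro: mult_le_one)
    qed
  qed (auto simp: scale_def)
  then show ?thesis
    unfolding path_connected_space_iff_path_component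
    by (metis path_component_of_sym path_component_of_trans topspace_disk)
qed

section \<open>Skeleta of CW complexes\<close>

locale cw =
  fixes X :: "'a topology" and E :: "'a set set" and d :: "'a set \<Rightarrow> nat"
    and \<Phi> :: "'a set \<Rightarrow> (nat \<Rightarrow> real) \<Rightarrow> 'a"
  assumes cw: "cw_complex X E d \<Phi>"
begin

lemma Hausdorff: "Hausdorff_space X" and Union_cells: "\<Union>E = topspace X"
  and cells_disjoint: "pairwise disjnt E"
  using cw by (auto simp: cw_complex_def)

lemma continuous_\<Phi>: "e \<in> E \<Longrightarrow> continuous_map (disk (d e)) X (\<Phi> e)"
  using cw by (auto simp: cw_complex_def disk_def)

lemma cell_unique: "e \<in> E \<Longrightarrow> e' \<in> E \<Longrightarrow> x \<in> e \<Longrightarrow> x \<in> e' \<Longrightarrow> e = e'"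
  using cells_disjoint by (auto simp: pairwise_def disjnt_def)

lemma \<Phi>_open_disk:
  assumes "e \<in> E" shows "\<Phi> e ` open_disk (d e) = e" "inj_on (\<Phi> e) (open_disk (d e))"
proof -
  have h: "homeomorphic_map (subtopology (Euclidean_space (d e)) (open_disk (d e))) (subtopology X e) (\<Phi> e)"
    using cw assms by (auto simp: cw_complex_def)
  have "e \<subseteq> topspace X" using assms Union_cells by auto
  moreover have "topspace (subtopology (Euclidean_space (d e)) (open_disk (d e))) = open_disk (d e)"
    by (auto simp: open_disk_def)
  ultimately show "\<Phi> e ` open_disk (d e) = e" "inj_on (\<Phi> e) (open_disk (d e))"
    using homeomorphic_imp_surjective_map[OF h] homeomorphic_imp_injective_map[OF h] by auto
qed

lemma \<Phi>_sphere:
  assumes "e \<in> E"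
  obtains C where "finite C" "C \<subseteq> {c \<in> E. d c < d e}" "\<Phi> e ` (closed_disk (d e) - open_disk (d e)) \<subseteq> \<Union>C"
  using cw assms unfolding cw_complex_def by meson

lemma closedin_\<Phi>_image:
  assumes "e \<in> E" "closedin (disk (d e)) A" shows "closedin X (\<Phi> e ` A)"
proof -
  have "compactin (disk (d e)) A" using assms(2) compact_space_disk by (rule closedin_compact_space[rotated])
  then have "compactin X (\<Phi> e ` A)" using continuous_\<Phi>[OF assms(1)] by (rule image_compactin)
  then show ?thesis using Hausdorff by (rule compactin_imp_closedin[rotated])
qed

lemma weak_topology:
  assumes "A \<subseteq> topspace X" "\<And>e. e \<in> E \<Longrightarrow> closedin X (A \<inter> X closure_of e)"
  shows "closedin X A"
proof -
  have "\<forall>A\<subseteq>topspace X. closedin X A \<longleftrightarrow> (\<forall>e\<in>E. closedin X (A \<inter> X closure_of e))"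
    using cw unfolding cw_complex_def by (elim conjE)
  then show ?thesis using assms by simp
qed

text \<open>The weak topology is given in terms of closures of cells. The closure of a cell lies in
  the image of its closed disk, which is compact and hence closed, so openness can be tested on the
  disks.\<close>

lemma openin_cw:
  assumes "U \<subseteq> topspace X" "\<And>e. e \<in> E \<Longrightarrow> openin (disk (d e)) {y \<in> closed_disk (d e). \<Phi> e y \<in> U}"
  shows "openin X U"
proof -
  have "closedin X (topspace X - U)"
  proof -
    have "closedin X ((topspace X - U) \<inter> X closure_of e)" if e: "e \<in> E" for e
    proof -
      let ?A = "closed_disk (d e) - {y \<in> closed_disk (d e). \<Phi> e y \<in> U}"
      have "e \<subseteq> \<Phi> e ` closed_disk (d e)"
        using \<Phi>_open_disk(1)[OF e] open_disk_subset by blast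
      moreover have "closedin X (\<Phi> e ` closed_disk (d e))"
        using closedin_\<Phi>_image[OF e, of "topspace (disk (d e))"] closedin_topspace by (metis topspace_disk)
      ultimately have "X closure_of e \<subseteq> \<Phi> e ` closed_disk (d e)" by (rule closure_of_minimal)
      moreover have "\<Phi> e y \<in> topspace X" if "y \<in> closed_disk (d e)" for y
        using continuous_\<Phi>[OF e] that by (auto simp: continuous_map_def Pi_iff)
      ultimately have "(topspace X - U) \<inter> X closure_of e = \<Phi> e ` ?A \<inter> X closure_of e" by auto
      moreover have "closedin (disk (d e)) ?A"
        using assms(2)[OF e] by (metis closedin_diff closedin_topspace topspace_disk)
      ultimately show ?thesis using closedin_\<Phi>_image[OF e] by (simp add: closedin_Int)
    qed
    then show ?thesis by (rule weak_topology[rotated]) auto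
  qed
  then show ?thesis using assms(1) by (simp add: closedin_def Diff_Diff_Int Int_absorb1)
qed

text \<open>A disk is path connected, so the preimage of a path component under a characteristic map
  is empty or the whole disk. Path components are therefore open, and by passing to complements also
  closed.\<close>

lemma connected_imp_path_connected:
  assumes "connected_space X" shows "path_connected_space X"
proof -
  let ?P = "path_component_of_set X"
  have "openin X (?P x)" for x
  proof (rule openin_cw)
    show "?P x \<subseteq> topspace X" by (rule path_component_of_subset_topspace)
    fix e assume e: "e \<in> E"
    have "path_connectedin X (\<Phi> e ` closed_disk (d e))"
      using path_connectedin_continuous_map_image[OF continuous_\<Phi>[OF e]] path_connected_space_disk[of "d e"]
        path_connectedin_topspace[of "disk (d e)"] by (metis topspace_disk)
    then have "path_component_of X (\<Phi> e y) (\<Phi> e y')" if "y \<in> closed_disk (d e)" "y' \<in> closed_disk (d e)" for y y'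
      using that by (meson imageI path_component_of path_connectedin)
    then have "{y \<in> closed_disk (d e). \<Phi> e y \<in> ?P x} = {} \<or> {y \<in> closed_disk (d e). \<Phi> e y \<in> ?P x} = topspace (disk (d e))"
      unfolding topspace_disk by (auto intro: path_component_of_trans)
    then show "openin (disk (d e)) {y \<in> closed_disk (d e). \<Phi> e y \<in> ?P x}"
      by (elim disjE) (simp_all only: openin_empty openin_topspace)
  qed
  then have op: "openin X (?P x)" for x .
  have "?P x = topspace X" if x: "x \<in> topspace X" for x
  proof -
    have eq: "topspace X - ?P x = \<Union> (?P ` (topspace X - ?P x))"
    proof
      show "topspace X - ?P x \<subseteq> \<Union> (?P ` (topspace X - ?P x))"
        by (auto simp: path_component_of_refl)
      show "\<Union> (?P ` (topspace X - ?P x)) \<subseteq> topspace X - ?P x"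
        by (auto dest: path_component_in_topspace) (meson path_component_of_sym path_component_of_trans)
    qed
    have "openin X (topspace X - ?P x)" by (subst eq, rule openin_Union) (use op in auto)
    then have "closedin X (?P x)" using op[of x] openin_subset[OF op[of x]] by (simp add: closedin_def)
    moreover have "x \<in> ?P x" using x by (simp add: path_component_of_refl)
    ultimately show ?thesis using assms op[of x] unfolding connected_space_clopen_in by blast
  qed
  then show ?thesis unfolding path_connected_space_iff_path_component by blast
qed

text \<open>With the strict inequality this is the skeleton of dimension k - 1. For k = 0 it is
  empty, which is where the induction over skeleta starts.\<close>

definition skeleton_set :: "nat \<Rightarrow> 'a set" where
  "skeleton_set k = \<Union>{e \<in> E. d e < k}"

text \<open>The final topology for the characteristic maps rather than the subspace topology of X,
  so that continuity of maps out of a skeleton can be checked on disks.\<close>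

definition skeleton :: "nat \<Rightarrow> 'a topology" where
  "skeleton k = topology (\<lambda>U. U \<subseteq> skeleton_set k \<and>
     (\<forall>e\<in>E. d e < k \<longrightarrow> openin (disk (d e)) {y \<in> closed_disk (d e). \<Phi> e y \<in> U}))"

lemma openin_skeleton:
  "openin (skeleton k) U \<longleftrightarrow> U \<subseteq> skeleton_set k \<and>
     (\<forall>e\<in>E. d e < k \<longrightarrow> openin (disk (d e)) {y \<in> closed_disk (d e). \<Phi> e y \<in> U})"
proof -
  have "istopology (\<lambda>U. U \<subseteq> skeleton_set k \<and>
     (\<forall>e\<in>E. d e < k \<longrightarrow> openin (disk (d e)) {y \<in> closed_disk (d e). \<Phi> e y \<in> U}))"
    unfolding istopology_def
  proof (intro conjI allI impI ballI)
    fix S T e assume *: "S \<subseteq> skeleton_set k \<and> (\<forall>e\<in>E. d e < k \<longrightarrow> openin (disk (d e)) {y \<in> closed_disk (d e). \<Phi> e y \<in> S})"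
      "T \<subseteq> skeleton_set k \<and> (\<forall>e\<in>E. d e < k \<longrightarrow> openin (disk (d e)) {y \<in> closed_disk (d e). \<Phi> e y \<in> T})"
    show "S \<inter> T \<subseteq> skeleton_set k" using * by blast
    assume e: "e \<in> E" "d e < k"
    have eq: "{y \<in> closed_disk (d e). \<Phi> e y \<in> S \<inter> T} = {y \<in> closed_disk (d e). \<Phi> e y \<in> S} \<inter> {y \<in> closed_disk (d e). \<Phi> e y \<in> T}" by auto
    show "openin (disk (d e)) {y \<in> closed_disk (d e). \<Phi> e y \<in> S \<inter> T}"
      unfolding eq by (rule openin_Int) (use * e in blast)+
  next
    fix \<K> e assume *: "\<forall>K\<in>\<K>. K \<subseteq> skeleton_set k \<and> (\<forall>e\<in>E. d e < k \<longrightarrow> openin (disk (d e)) {y \<in> closed_disk (d e). \<Phi> e y \<in> K})"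
    show "\<Union>\<K> \<subseteq> skeleton_set k" using * by blast
    assume e: "e \<in> E" "d e < k"
    have eq: "{y \<in> closed_disk (d e). \<Phi> e y \<in> \<Union>\<K>} = \<Union> ((\<lambda>K. {y \<in> closed_disk (d e). \<Phi> e y \<in> K}) ` \<K>)" by auto
    show "openin (disk (d e)) {y \<in> closed_disk (d e). \<Phi> e y \<in> \<Union>\<K>}"
      unfolding eq by (rule openin_Union) (use * e in blast)
  qed
  then show ?thesis unfolding skeleton_def by (simp add: topology_inverse')
qed

lemma sphere_in_skeleton: "e \<in> E \<Longrightarrow> y \<in> closed_disk (d e) \<Longrightarrow> y \<notin> open_disk (d e) \<Longrightarrow> \<Phi> e y \<in> skeleton_set (d e)"
  using \<Phi>_sphere[of e] unfolding skeleton_set_def by (metis (no_types, lifting) DiffI Union_mono image_subset_iff subsetD)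

lemma disk_in_skeleton:
  assumes "e \<in> E" "d e < k" "y \<in> closed_disk (d e)" shows "\<Phi> e y \<in> skeleton_set k"
proof (cases "y \<in> open_disk (d e)")
  case True
  then have "\<Phi> e y \<in> e" using \<Phi>_open_disk(1)[OF assms(1)] by blast
  then show ?thesis using assms by (auto simp: skeleton_set_def)
next
  case False
  then have "\<Phi> e y \<in> skeleton_set (d e)" by (rule sphere_in_skeleton[OF assms(1,3)])
  then show ?thesis using assms(2) by (auto simp: skeleton_set_def)
qed

lemma topspace_skeleton [simp]: "topspace (skeleton k) = skeleton_set k"
proof
  show "topspace (skeleton k) \<subseteq> skeleton_set k"
    using openin_topspace[of "skeleton k"] unfolding openin_skeleton by blast
  have "{y \<in> closed_disk (d e). \<Phi> e y \<in> skeleton_set k} = topspace (disk (d e))" if "e \<in> E" "d e < k" for e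
    using disk_in_skeleton[OF that] unfolding topspace_disk by blast
  then have "openin (skeleton k) (skeleton_set k)"
    unfolding openin_skeleton by (metis openin_topspace order_refl)
  then show "skeleton_set k \<subseteq> topspace (skeleton k)" by (rule openin_subset)
qed

lemma continuous_map_\<Phi>_skeleton:
  assumes "e \<in> E" "d e < k" shows "continuous_map (disk (d e)) (skeleton k) (\<Phi> e)"
  unfolding continuous_map_def
  using assms disk_in_skeleton by (auto simp: openin_skeleton)

text \<open>Closure finiteness makes the attaching maps continuous for the weak topology of the skeleton.\<close>

lemma continuous_map_\<Phi>_sphere:
  assumes e: "e \<in> E"
  shows "continuous_map (subtopology (disk (d e)) {y. y \<notin> open_disk (d e)}) (skeleton (d e)) (\<Phi> e)"
proof -
  let ?S = "subtopology (disk (d e)) {y. y \<notin> open_disk (d e)}"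
  have top: "topspace ?S = closed_disk (d e) - open_disk (d e)"
    by auto
  have \<Phi>S: "continuous_map ?S X (\<Phi> e)" by (rule continuous_map_from_subtopology[OF continuous_\<Phi>[OF e]])
  obtain C where C: "finite C" "C \<subseteq> {c \<in> E. d c < d e}" "\<Phi> e ` (closed_disk (d e) - open_disk (d e)) \<subseteq> \<Union>C"
    using \<Phi>_sphere[OF e] .
  show ?thesis
    unfolding continuous_map_def topspace_skeleton top
  proof (intro conjI allI impI)
    show "\<Phi> e \<in> closed_disk (d e) - open_disk (d e) \<rightarrow> skeleton_set (d e)"
      using sphere_in_skeleton[OF e] by auto
    fix U assume U: "openin (skeleton (d e)) U"
    \<comment> \<open>The part outside U of the finitely many closed cells that cover the image of
      the sphere. It is a finite union of images of closed subsets of disks, hence closed in X, and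
      on the sphere \<open>\<Phi> e\<close> meets it exactly when it misses U.\<close>
    define A where "A = (\<Union>c\<in>C. \<Phi> c ` (closed_disk (d c) - {y \<in> closed_disk (d c). \<Phi> c y \<in> U}))"
    have "closedin X A"
      unfolding A_def
    proof (rule closedin_Union)
      show "closedin X T" if T: "T \<in> (\<lambda>c. \<Phi> c ` (closed_disk (d c) - {y \<in> closed_disk (d c). \<Phi> c y \<in> U})) ` C" for T
      proof -
        obtain c where c: "c \<in> C" "T = \<Phi> c ` (closed_disk (d c) - {y \<in> closed_disk (d c). \<Phi> c y \<in> U})" using T by blast
        have "c \<in> E" "d c < d e" using c C by auto
        then have "openin (disk (d c)) {y \<in> closed_disk (d c). \<Phi> c y \<in> U}" using U by (simp add: openin_skeleton)
        then have "closedin (disk (d c)) (closed_disk (d c) - {y \<in> closed_disk (d c). \<Phi> c y \<in> U})"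
          by (metis closedin_diff closedin_topspace topspace_disk)
        then show ?thesis using closedin_\<Phi>_image \<open>c \<in> E\<close> c(2) by blast
      qed
    qed (use C in auto)
    then have "closedin ?S {y \<in> topspace ?S. \<Phi> e y \<in> A}"
      using \<Phi>S closedin_continuous_map_preimage by blast
    moreover have "\<Phi> e y \<in> A \<longleftrightarrow> \<Phi> e y \<notin> U" if y: "y \<in> topspace ?S" for y
    proof
      assume "\<Phi> e y \<notin> U"
      obtain c where c: "c \<in> C" "\<Phi> e y \<in> c" using C(3) y unfolding top by auto
      then have "c \<in> E" using C by auto
      then obtain z where "z \<in> open_disk (d c)" "\<Phi> c z = \<Phi> e y" using c \<Phi>_open_disk(1)[of c] by (metis imageE)
      then show "\<Phi> e y \<in> A" using c(1) \<open>\<Phi> e y \<notin> U\<close> open_disk_subset[of "d c"]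
        unfolding A_def by (intro UN_I[OF c(1)] image_eqI[of _ _ z]) auto
    qed (auto simp: A_def)
    ultimately have "closedin ?S {y \<in> topspace ?S. \<Phi> e y \<notin> U}" by (simp cong: conj_cong)
    then have "openin ?S (topspace ?S - {y \<in> topspace ?S. \<Phi> e y \<notin> U})" by (rule openin_diff[OF openin_topspace])
    moreover have "topspace ?S - {y \<in> topspace ?S. \<Phi> e y \<notin> U} = {y \<in> closed_disk (d e) - open_disk (d e). \<Phi> e y \<in> U}"
      unfolding top by auto
    ultimately show "openin ?S {y \<in> closed_disk (d e) - open_disk (d e). \<Phi> e y \<in> U}" by simp
  qed
qed

lemma continuous_map_from_skeleton:
  assumes W: "openin (skeleton k) W"
    and h: "\<And>e. e \<in> E \<Longrightarrow> d e < k \<Longrightarrow>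
        continuous_map (subtopology (disk (d e)) {y \<in> closed_disk (d e). \<Phi> e y \<in> W}) Y (\<lambda>y. h (\<Phi> e y))"
  shows "continuous_map (subtopology (skeleton k) W) Y h"
proof -
  have Wsub: "W \<subseteq> skeleton_set k" using W by (simp add: openin_skeleton)
  have top: "topspace (subtopology (skeleton k) W) = W" using Wsub by auto
  show ?thesis
    unfolding continuous_map_def top
  proof (intro conjI allI impI)
    show "h \<in> W \<rightarrow> topspace Y"
    proof
      fix x assume x: "x \<in> W"
      then obtain e where e: "e \<in> E" "d e < k" "x \<in> e" using Wsub by (auto simp: skeleton_set_def)
      then obtain y where "y \<in> open_disk (d e)" "x = \<Phi> e y" using \<Phi>_open_disk(1) by blast
      then show "h x \<in> topspace Y"
        using h[OF e(1,2)] x open_disk_subset[of "d e"] by (auto simp: continuous_map_def Pi_iff)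
    qed
    fix V assume V: "openin Y V"
    have "openin (skeleton k) {x \<in> W. h x \<in> V}"
      unfolding openin_skeleton
    proof (intro conjI ballI impI)
      fix e assume e: "e \<in> E" "d e < k"
      let ?D = "{y \<in> closed_disk (d e). \<Phi> e y \<in> W}"
      have "openin (subtopology (disk (d e)) ?D) {y \<in> topspace (subtopology (disk (d e)) ?D). h (\<Phi> e y) \<in> V}"
        using h[OF e] V by (rule openin_continuous_map_preimage)
      moreover have "openin (disk (d e)) ?D" using W e by (simp add: openin_skeleton)
      ultimately have "openin (disk (d e)) {y \<in> topspace (subtopology (disk (d e)) ?D). h (\<Phi> e y) \<in> V}"
        by (rule openin_trans_full)
      moreover have "{y \<in> topspace (subtopology (disk (d e)) ?D). h (\<Phi> e y) \<in> V} = {y \<in> closed_disk (d e). \<Phi> e y \<in> {x \<in> W. h x \<in> V}}"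
        by (simp only: topspace_subtopology topspace_disk) auto
      ultimately show "openin (disk (d e)) {y \<in> closed_disk (d e). \<Phi> e y \<in> {x \<in> W. h x \<in> V}}" by simp
    qed (use Wsub in auto)
    then show "openin (subtopology (skeleton k) W) {x \<in> W. h x \<in> V}"
      by (auto simp: openin_subtopology)
  qed
qed

lemma skeleton_eq:
  assumes "\<And>e. e \<in> E \<Longrightarrow> d e < k" shows "skeleton k = X"
proof -
  have top: "skeleton_set k = topspace X" using assms unfolding skeleton_set_def Union_cells[symmetric] by blast
  have "openin (skeleton k) U \<longleftrightarrow> openin X U" for U
  proof
    assume "openin (skeleton k) U"
    then show "openin X U" using assms by (intro openin_cw) (auto simp: openin_skeleton top)
  next
    assume U: "openin X U"
    have "openin (disk (d e)) {y \<in> topspace (disk (d e)). \<Phi> e y \<in> U}" if "e \<in> E" for e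
      using continuous_\<Phi>[OF that] U by (rule openin_continuous_map_preimage)
    then show "openin (skeleton k) U" using openin_subset[OF U] by (simp add: openin_skeleton top)
  qed
  then show ?thesis by (simp add: topology_eq)
qed

end

section \<open>Categorical covers of CW complexes\<close>

context cw
begin

text \<open>Functions f i adding up to one, such that the set where f i is positive is a disjoint union of
  open sets, indexed via g i by cells c, on each of which p i contracts to the centre of c.\<close>

definition contraction_data ::
    "nat \<Rightarrow> (nat \<Rightarrow> 'a \<Rightarrow> real) \<Rightarrow> (nat \<Rightarrow> 'a \<Rightarrow> 'a set) \<Rightarrow> (nat \<Rightarrow> 'a \<Rightarrow> real \<Rightarrow> 'a) \<Rightarrow> bool" where
  "contraction_data k f g p \<longleftrightarrow>
     (\<forall>i. continuous_map (skeleton k) euclideanreal (f i)) \<and>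
     (\<forall>x\<in>skeleton_set k. (\<forall>i. 0 \<le> f i x) \<and> (\<forall>i\<ge>k. f i x = 0) \<and> (\<Sum>i<k. f i x) = 1) \<and>
     (\<forall>i. \<forall>x\<in>skeleton_set k. 0 < f i x \<longrightarrow> g i x \<in> E \<and> p i x 0 = x \<and> p i x 1 = \<Phi> (g i x) (\<lambda>_. 0)) \<and>
     (\<forall>i c. openin (skeleton k) {x \<in> skeleton_set k. 0 < f i x \<and> g i x = c}) \<and>
     (\<forall>i. continuous_map (subtopology (skeleton k) {x \<in> skeleton_set k. 0 < f i x}) (path_space X) (p i))"

lemma \<Phi>_open_disk_notin_skeleton:
  assumes "e \<in> E" "y \<in> open_disk (d e)" shows "\<Phi> e y \<notin> skeleton_set (d e)"
proof
  assume "\<Phi> e y \<in> skeleton_set (d e)"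
  then obtain e' where "e' \<in> E" "d e' < d e" "\<Phi> e y \<in> e'" by (auto simp: skeleton_set_def)
  moreover have "\<Phi> e y \<in> e" using \<Phi>_open_disk(1)[OF assms(1)] assms(2) by blast
  ultimately show False using cell_unique assms(1) by blast
qed

definition cell_of :: "'a \<Rightarrow> 'a set" where
  "cell_of x = (THE e. e \<in> E \<and> x \<in> e)"

lemma cell_of_eq: "e \<in> E \<Longrightarrow> x \<in> e \<Longrightarrow> cell_of x = e"
  unfolding cell_of_def by (rule the_equality) (use cell_unique in auto)

text \<open>New values are given by a formula on open disks, the coordinate coming from the inverse
  of the characteristic map. For continuity the formula must also hold on the boundary sphere, where
  the value is \<open>old\<close>; this is verified for each of the extended functions
  below.\<close>

definition extend :: "nat \<Rightarrow> ('a \<Rightarrow> 'c) \<Rightarrow> ('a set \<Rightarrow> (nat \<Rightarrow> real) \<Rightarrow> 'c) \<Rightarrow> 'a \<Rightarrow> 'c" where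
  "extend k old new x = (if x \<in> skeleton_set k then old x
     else new (cell_of x) (inv_into (open_disk (d (cell_of x))) (\<Phi> (cell_of x)) x))"

lemma extend_old: "x \<in> skeleton_set k \<Longrightarrow> extend k old new x = old x"
  by (simp add: extend_def)

lemma extend_new:
  assumes "e \<in> E" "d e = k" "y \<in> open_disk k"
  shows "extend k old new (\<Phi> e y) = new e y"
proof -
  have "\<Phi> e y \<in> e" using \<Phi>_open_disk(1)[OF assms(1)] assms(2,3) by blast
  then show ?thesis
    using \<Phi>_open_disk_notin_skeleton[OF assms(1)] assms cell_of_eq[OF assms(1)] inv_into_f_f[OF \<Phi>_open_disk(2)[OF assms(1)]]
    by (simp add: extend_def)
qed

lemma skeleton_set_Suc:
  assumes "x \<in> skeleton_set (Suc k)" "x \<notin> skeleton_set k"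
  obtains e y where "e \<in> E" "d e = k" "y \<in> open_disk k" "x = \<Phi> e y"
proof -
  obtain e where e: "e \<in> E" "d e < Suc k" "x \<in> e" using assms(1) by (auto simp: skeleton_set_def)
  moreover have "\<not> d e < k" using assms(2) e by (auto simp: skeleton_set_def)
  ultimately have "d e = k" by simp
  then have "x \<in> \<Phi> e ` open_disk k" using e(3) \<Phi>_open_disk(1)[OF e(1)] by simp
  then obtain y where "y \<in> open_disk k" "x = \<Phi> e y" by blast
  with e(1) \<open>d e = k\<close> show ?thesis by (rule that)
qed

lemma skeleton_set_mono: "skeleton_set k \<subseteq> skeleton_set (Suc k)"
  by (auto simp: skeleton_set_def)

lemma continuous_map_from_skeleton_total:
  assumes "\<And>e. e \<in> E \<Longrightarrow> d e < k \<Longrightarrow> continuous_map (disk (d e)) Y (\<lambda>y. h (\<Phi> e y))"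
  shows "continuous_map (skeleton k) Y h"
proof -
  have "continuous_map (subtopology (skeleton k) (skeleton_set k)) Y h"
  proof (rule continuous_map_from_skeleton)
    show "openin (skeleton k) (skeleton_set k)" by (metis openin_topspace topspace_skeleton)
  qed (intro continuous_map_from_subtopology assms)
  then show ?thesis by (metis subtopology_topspace topspace_skeleton)
qed

text \<open>Radial projection to the sphere followed by the attaching map. The value at the centre
  is a default, hidden by a factor \<open>ramp\<close> or by positivity conditions wherever
  \<open>push\<close> is used.\<close>

definition push :: "'a set \<Rightarrow> (nat \<Rightarrow> real) \<Rightarrow> 'a" where
  "push e y = \<Phi> e (scale (1 / radius (d e) y) y)"

lemma continuous_map_disk_scale:
  assumes "continuous_map Y (disk k) h" "continuous_map Y euclideanreal a"
    and "\<And>w. w \<in> topspace Y \<Longrightarrow> \<bar>a w\<bar> * radius k (h w) \<le> 1"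
  shows "continuous_map Y (disk k) (\<lambda>w. scale (a w) (h w))"
proof (rule continuous_map_into_disk)
  show "continuous_map Y euclideanreal (\<lambda>w. scale (a w) (h w) i)" for i
    using continuous_map_compose[OF assms(1) continuous_map_disk_coordinate[of k i]]
    unfolding scale_def o_def by (intro continuous_map_real_mult assms(2))
  show "scale (a w) (h w) \<in> closed_disk k" if "w \<in> topspace Y" for w
    using that assms(1,3) by (intro scale_in_disk) (auto simp: continuous_map_def Pi_iff)
qed

lemma continuous_map_push:
  assumes e: "e \<in> E"
  shows "continuous_map (subtopology (disk (d e)) {y. 0 < radius (d e) y}) (skeleton (d e)) (push e)"
proof -
  let ?P = "subtopology (disk (d e)) {y. 0 < radius (d e) y}"
  have "continuous_map ?P (disk (d e)) (\<lambda>y. scale (1 / radius (d e) y) y)"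
  proof (rule continuous_map_disk_scale)
    show "continuous_map ?P (disk (d e)) (\<lambda>y. y)"
      using continuous_map_from_subtopology[OF continuous_map_id] by (simp add: id_def)
    show "continuous_map ?P euclideanreal (\<lambda>y. 1 / radius (d e) y)"
      by (intro continuous_map_real_divide continuous_map_from_subtopology[OF continuous_map_radius]) auto
  qed auto
  then have "continuous_map ?P (subtopology (disk (d e)) {y. y \<notin> open_disk (d e)}) (\<lambda>y. scale (1 / radius (d e) y) y)"
    by (auto simp: continuous_map_in_subtopology open_disk_iff radius_scale)
  from continuous_map_compose[OF this continuous_map_\<Phi>_sphere[OF e]]
  show ?thesis by (simp add: push_def[abs_def] o_def)
qed

lemma push_in_skeleton:
  assumes "e \<in> E" "y \<in> closed_disk (d e)" "0 < radius (d e) y" shows "push e y \<in> skeleton_set (d e)"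
  using continuous_map_push[OF assms(1)] assms(2,3) by (auto simp: continuous_map_def Pi_iff)

lemma push_sphere: "radius (d e) y = 1 \<Longrightarrow> push e y = \<Phi> e y"
  by (simp add: push_def)

text \<open>Zero up to radius 1/2 and one on the sphere. The old functions thus spread only over a
  collar that stays away from the centre, where \<open>push\<close> need not be continuous.\<close>

definition ramp :: "real \<Rightarrow> real" where
  "ramp r = max 0 (2 * r - 1)"

end

section \<open>Inductive step: attaching the cells of dimension k\<close>

locale contraction_step = cw +
  fixes k f g p
  assumes data: "contraction_data k f g p"
begin

lemma continuous_f: "\<And>i. continuous_map (skeleton k) euclideanreal (f i)"
  and f_nonneg: "\<And>i x. x \<in> skeleton_set k \<Longrightarrow> 0 \<le> f i x"
  and f_vanishes: "\<And>i x. x \<in> skeleton_set k \<Longrightarrow> k \<le> i \<Longrightarrow> f i x = 0"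
  and sum_f: "\<And>x. x \<in> skeleton_set k \<Longrightarrow> (\<Sum>i<k. f i x) = 1"
  and p_ends: "\<And>i x. x \<in> skeleton_set k \<Longrightarrow> 0 < f i x \<Longrightarrow> g i x \<in> E \<and> p i x 0 = x \<and> p i x 1 = \<Phi> (g i x) (\<lambda>_. 0)"
  and openin_g: "\<And>i c. openin (skeleton k) {x \<in> skeleton_set k. 0 < f i x \<and> g i x = c}"
  and continuous_p: "\<And>i. continuous_map (subtopology (skeleton k) {x \<in> skeleton_set k. 0 < f i x}) (path_space X) (p i)"
  using data unfolding contraction_data_def by auto

text \<open>The function with index k is positive exactly on the open cells of dimension k, so these
  become its contractible pieces. The old functions are pulled back from the boundary and damped by
  \<open>ramp\<close>, which keeps the sum equal to one.\<close>

definition disk_f :: "nat \<Rightarrow> 'a set \<Rightarrow> (nat \<Rightarrow> real) \<Rightarrow> real" where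
  "disk_f i e y = (if i = k then 1 - ramp (radius k y) else ramp (radius k y) * f i (push e y))"

text \<open>The radial motion takes time 1 - radius k y, so that the path agrees with the given one for y in
  the sphere.\<close>

definition disk_p :: "nat \<Rightarrow> 'a set \<Rightarrow> (nat \<Rightarrow> real) \<Rightarrow> real \<Rightarrow> 'a" where
  "disk_p i e y t = (if i = k then \<Phi> e (scale (1 - t) y)
   else if t \<le> 1 - radius k y then \<Phi> e (scale ((radius k y + t) / radius k y) y)
   else p i (push e y) ((t - 1 + radius k y) / radius k y))"

definition next_f :: "nat \<Rightarrow> 'a \<Rightarrow> real" where
  "next_f i = extend k (f i) (disk_f i)"

definition next_g :: "nat \<Rightarrow> 'a \<Rightarrow> 'a set" where
  "next_g i = extend k (g i) (\<lambda>e y. if i = k then e else g i (push e y))"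

definition next_p :: "nat \<Rightarrow> 'a \<Rightarrow> real \<Rightarrow> 'a" where
  "next_p i = extend k (p i) (\<lambda>e y. restrict (disk_p i e y) {0..1})"

lemma sphere_point:
  assumes "e \<in> E" "d e = k" "y \<in> closed_disk k" "y \<notin> open_disk k"
  shows "radius k y = 1 \<and> \<Phi> e y \<in> skeleton_set k \<and> push e y = \<Phi> e y"
  using assms sphere_in_skeleton[of e y] push_sphere[of e y] by (auto simp: closed_disk_iff open_disk_iff)

lemma radius_le_1: "y \<in> closed_disk k \<Longrightarrow> radius k y \<le> 1"
  by (simp add: closed_disk_iff)

text \<open>On the sphere \<open>ramp\<close> is 1 and \<open>push\<close> is the attaching map, so
  the formula returns the old function; for i = k both sides are 0, since the old functions vanish
  from index k on.\<close>

lemma next_f_disk: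
  assumes e: "e \<in> E" "d e = k" "y \<in> closed_disk k"
  shows "next_f i (\<Phi> e y) = disk_f i e y"
proof (cases "y \<in> open_disk k")
  case True then show ?thesis using e by (simp add: next_f_def extend_new)
next
  case False
  then show ?thesis using sphere_point[OF e False] f_vanishes[of "\<Phi> e y" k] by (simp add: next_f_def extend_old disk_f_def ramp_def)
qed

lemma disk_f_pos_iff:
  assumes e: "e \<in> E" "d e = k" "y \<in> closed_disk k"
  shows "disk_f i e y > 0 \<longleftrightarrow> (if i = k then radius k y < 1 else 1 / 2 < radius k y \<and> 0 < f i (push e y))"
proof (cases "1 / 2 < radius k y")
  case True
  then have "ramp (radius k y) > 0" "ramp (radius k y) < 1 \<longleftrightarrow> radius k y < 1" by (auto simp: ramp_def)
  then show ?thesis using True by (auto simp: disk_f_def zero_less_mult_iff)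
qed (auto simp: disk_f_def ramp_def)

lemma next_g_disk:
  assumes e: "e \<in> E" "d e = k" "y \<in> closed_disk k" and pos': "disk_f i e y > 0"
  shows "next_g i (\<Phi> e y) = (if i = k then e else g i (push e y))"
proof (cases "y \<in> open_disk k")
  case True then show ?thesis using e by (simp add: next_g_def extend_new)
next
  case False
  then show ?thesis using sphere_point[OF e False] pos' disk_f_pos_iff[OF e, of i] by (auto simp: next_g_def extend_old)
qed

lemma next_p_disk:
  assumes e: "e \<in> E" "d e = k" "y \<in> closed_disk k" and pos': "disk_f i e y > 0"
  shows "next_p i (\<Phi> e y) = restrict (disk_p i e y) {0..1}"
proof (cases "y \<in> open_disk k")
  case True then show ?thesis using e by (simp add: next_p_def extend_new)
next
  case False
  note s = sphere_point[OF e False]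
  then have i: "i \<noteq> k" "0 < f i (\<Phi> e y)" using pos' disk_f_pos_iff[OF e, of i] by (auto split: if_splits)
  then have "p i (\<Phi> e y) \<in> extensional {0..1}"
    using continuous_p[of i] s by (auto simp: continuous_map_def Pi_iff topspace_path_space)
  then have "p i (\<Phi> e y) = restrict (disk_p i e y) {0..1}"
    using s i p_ends[of "\<Phi> e y" i] by (auto simp: disk_p_def extensional_def restrict_def fun_eq_iff)
  then show ?thesis using s by (simp add: next_p_def extend_old)
qed

lemma continuous_next_f: "continuous_map (skeleton (Suc k)) euclideanreal (next_f i)"
proof (rule continuous_map_from_skeleton_total)
  fix e assume e: "e \<in> E" "d e < Suc k"
  show "continuous_map (disk (d e)) euclideanreal (\<lambda>y. next_f i (\<Phi> e y))"
  proof (cases "d e = k")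
    case False
    then have "d e < k" using e by simp
    from continuous_map_compose[OF continuous_map_\<Phi>_skeleton[OF e(1) this] continuous_f[of i]]
    show ?thesis
      by (rule continuous_map_eq) (use disk_in_skeleton[OF e(1) \<open>d e < k\<close>] in \<open>auto simp: next_f_def extend_old\<close>)
  next
    case True
    have "continuous_map (disk k) euclideanreal (disk_f i e)"
    proof (cases "i = k")
      case True
      have "continuous_map (disk k) euclideanreal (\<lambda>y. 1 - max 0 (2 * radius k y - 1))"
        by (intro continuous_map_diff continuous_map_real_max continuous_map_real_mult continuous_map_radius) auto
      then show ?thesis using True by (simp add: disk_f_def[abs_def] ramp_def)
    next
      case False
      \<comment> \<open>Cut at radius 1/2, where the factor vanishes, because continuity of
        \<open>push\<close> is available only off the centre.\<close>
      have "continuous_map (disk k) euclideanreal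
          (\<lambda>y. if radius k y \<le> 1 / 2 then 0 else (2 * radius k y - 1) * f i (push e y))"
      proof (rule continuous_map_cases_le[OF continuous_map_radius])
        let ?S = "subtopology (disk k) {y \<in> topspace (disk k). 1 / 2 \<le> radius k y}"
        have "continuous_map ?S (skeleton k) (push e)"
          using continuous_map_push[OF e(1)] unfolding \<open>d e = k\<close>
          by (rule continuous_map_from_subtopology_mono) auto
        from continuous_map_compose[OF this continuous_f[of i]]
        show "continuous_map ?S euclideanreal (\<lambda>y. (2 * radius k y - 1) * f i (push e y))"
          by (intro continuous_map_real_mult continuous_map_diff continuous_map_from_subtopology[OF continuous_map_radius])
            (auto simp: o_def)
      qed auto
      then show ?thesis
        by (rule continuous_map_eq) (use False in \<open>auto simp: disk_f_def ramp_def\<close>)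
    qed
    then show ?thesis unfolding True by (rule continuous_map_eq) (use next_f_disk[OF e(1) True] in auto)
  qed
qed

lemma openin_next_f_pos: "openin (skeleton (Suc k)) {x \<in> skeleton_set (Suc k). 0 < next_f i x}"
proof -
  have "openin (skeleton (Suc k)) {x \<in> topspace (skeleton (Suc k)). next_f i x \<in> {0<..}}"
    using continuous_next_f by (rule openin_continuous_map_preimage) auto
  then show ?thesis by simp
qed

text \<open>For i = k the condition on a new disk cuts out its interior or nothing. For other i,
  positivity forces the radius above 1/2, where the old open set can be pulled back along
  \<open>push\<close>.\<close>

lemma openin_next_g: "openin (skeleton (Suc k)) {x \<in> skeleton_set (Suc k). 0 < next_f i x \<and> next_g i x = c}"
  unfolding openin_skeleton
proof (intro conjI ballI impI)
  fix e assume e: "e \<in> E" "d e < Suc k"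
  let ?U = "{y \<in> closed_disk (d e). \<Phi> e y \<in> {x \<in> skeleton_set (Suc k). 0 < next_f i x \<and> next_g i x = c}}"
  show "openin (disk (d e)) ?U"
  proof (cases "d e = k")
    case False
    then have lt: "d e < k" using e by simp
    have "?U = {y \<in> closed_disk (d e). \<Phi> e y \<in> {x \<in> skeleton_set k. 0 < f i x \<and> g i x = c}}"
      using disk_in_skeleton[OF e(1) lt] skeleton_set_mono by (auto simp: next_f_def next_g_def extend_old)
    then show ?thesis using openin_g[of i c] e(1) lt by (simp add: openin_skeleton)
  next
    case True
    have "\<Phi> e y \<in> {x \<in> skeleton_set (Suc k). 0 < next_f i x \<and> next_g i x = c} \<longleftrightarrow>
        0 < disk_f i e y \<and> (if i = k then e else g i (push e y)) = c" if "y \<in> closed_disk k" for y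
      using next_f_disk[OF e(1) True that, of i] next_g_disk[OF e(1) True that, of i] disk_in_skeleton[OF e, of y] that True
      by (cases "0 < disk_f i e y") simp_all
    then have U: "?U = {y \<in> closed_disk k. 0 < disk_f i e y \<and> (if i = k then e else g i (push e y)) = c}"
      using True by blast
    show ?thesis
    proof (cases "i = k")
      case True
      have "openin (disk k) {y \<in> topspace (disk k). radius k y \<in> {..<1}}"
        using continuous_map_radius by (rule openin_continuous_map_preimage) auto
      moreover have "?U = (if e = c then {y \<in> topspace (disk k). radius k y \<in> {..<1}} else {})"
        unfolding U using disk_f_pos_iff[OF e(1) \<open>d e = k\<close>, of _ i] True by auto
      ultimately show ?thesis using \<open>d e = k\<close> by simp
    next
      case False
      let ?A = "{y \<in> closed_disk k. 0 < radius k y}" and ?O = "{x \<in> skeleton_set k. 0 < f i x \<and> g i x = c}"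
      have "openin (disk k) {y \<in> topspace (disk k). radius k y \<in> {0<..}}"
        using continuous_map_radius by (rule openin_continuous_map_preimage) auto
      then have A: "openin (disk k) ?A" by simp
      have topA: "topspace (subtopology (disk k) ?A) = ?A" by auto
      have "continuous_map (subtopology (disk k) ?A) (skeleton k) (push e)"
        using continuous_map_push[OF e(1)] unfolding \<open>d e = k\<close>
        by (rule continuous_map_from_subtopology_mono) auto
      from openin_continuous_map_preimage[OF this openin_g[of i c]]
      have "openin (subtopology (disk k) ?A) {y \<in> ?A. push e y \<in> ?O}"
        unfolding topA .
      then have 1: "openin (disk k) {y \<in> ?A. push e y \<in> ?O}"
        using A by (rule openin_trans_full)
      have "openin (disk k) {y \<in> topspace (disk k). radius k y \<in> {1 / 2<..}}"
        using continuous_map_radius by (rule openin_continuous_map_preimage) auto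
      then have 2: "openin (disk k) {y \<in> closed_disk k. 1 / 2 < radius k y}" by simp
      have "(0 < disk_f i e y \<and> (if i = k then e else g i (push e y)) = c) \<longleftrightarrow>
          0 < radius k y \<and> push e y \<in> ?O \<and> 1 / 2 < radius k y" if "y \<in> closed_disk k" for y
        using disk_f_pos_iff[OF e(1) \<open>d e = k\<close> that, of i] False push_in_skeleton[OF e(1), of y] that \<open>d e = k\<close> by auto
      then have "?U = {y \<in> ?A. push e y \<in> ?O} \<inter> {y \<in> closed_disk k. 1 / 2 < radius k y}"
        unfolding U by blast
      then show ?thesis using openin_Int[OF 1 2] \<open>d e = k\<close> by simp
    qed
  qed
qed auto

text \<open>For i = k the disk is contracted radially to its centre. For other i the domain is split
  by time into an outward radial motion and the reparametrised old path; positivity of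
  \<open>disk_f\<close> keeps the radius above 1/2, so the divisions by it are continuous.\<close>

lemma continuous_map_disk_p:
  assumes e: "e \<in> E" "d e = k"
  shows "continuous_map (prod_topology (subtopology (disk k) {y \<in> closed_disk k. 0 < disk_f i e y}) unit_interval) X (\<lambda>(y, t). disk_p i e y t)"
proof -
  let ?D = "subtopology (disk k) {y \<in> closed_disk k. 0 < disk_f i e y}"
  let ?Q = "prod_topology ?D unit_interval"
  have fstD: "continuous_map ?Q (disk k) fst" and sndI: "continuous_map ?Q euclideanreal snd"
    using continuous_map_fst[of ?D unit_interval] continuous_map_snd[of ?D unit_interval]
    by (auto simp: continuous_map_in_subtopology)
  have rad: "continuous_map ?Q euclideanreal (\<lambda>z. radius k (fst z))"
    using continuous_map_compose[OF fstD continuous_map_radius] by (simp add: o_def)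
  have topQ: "topspace ?Q = {y \<in> closed_disk k. 0 < disk_f i e y} \<times> {0..1}" by auto
  have \<Phi>e: "continuous_map (disk k) X (\<Phi> e)" using continuous_\<Phi>[OF e(1)] e(2) by simp
  show ?thesis
  proof (cases "i = k")
    case True
    have "continuous_map ?Q (disk k) (\<lambda>z. scale (1 - snd z) (fst z))"
      by (rule continuous_map_disk_scale[OF fstD])
        (auto intro!: continuous_map_diff sndI mult_le_one radius_le_1 radius_nonneg simp: topQ simp del: topspace_prod_topology)
    from continuous_map_compose[OF this \<Phi>e] show ?thesis
      using True by (simp add: disk_p_def case_prod_unfold o_def)
  next
    case False
    have half: "1 / 2 < radius k (fst z)" "0 < f i (push e (fst z))" "fst z \<in> closed_disk k" "0 \<le> snd z" "snd z \<le> 1" if "z \<in> topspace ?Q" for z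
      using that disk_f_pos_iff[OF e(1) e(2), of "fst z" i] False unfolding topQ by auto
    have "continuous_map ?Q X (\<lambda>z. if snd z \<le> 1 - radius k (fst z)
       then \<Phi> e (scale ((radius k (fst z) + snd z) / radius k (fst z)) (fst z))
       else p i (push e (fst z)) ((snd z - 1 + radius k (fst z)) / radius k (fst z)))"
    proof (rule continuous_map_cases_le[OF sndI continuous_map_diff[OF continuous_map_canonical_const rad]])
      let ?S = "subtopology ?Q {z \<in> topspace ?Q. snd z \<le> 1 - radius k (fst z)}"
      have "continuous_map ?S (disk k) (\<lambda>z. scale ((radius k (fst z) + snd z) / radius k (fst z)) (fst z))"
      proof (rule continuous_map_disk_scale)
        show "continuous_map ?S euclideanreal (\<lambda>z. (radius k (fst z) + snd z) / radius k (fst z))"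
          by (intro continuous_map_real_divide continuous_map_add continuous_map_from_subtopology[OF rad] continuous_map_from_subtopology[OF sndI])
            (use half(1) in fastforce)
        show "\<bar>(radius k (fst z) + snd z) / radius k (fst z)\<bar> * radius k (fst z) \<le> 1" if "z \<in> topspace ?S" for z
          using that half[of z] by (auto simp: abs_divide)
      qed (rule continuous_map_from_subtopology[OF fstD])
      from continuous_map_compose[OF this \<Phi>e]
      show "continuous_map ?S X (\<lambda>z. \<Phi> e (scale ((radius k (fst z) + snd z) / radius k (fst z)) (fst z)))"
        by (simp add: o_def)
    next
      let ?S = "subtopology ?Q {z \<in> topspace ?Q. 1 - radius k (fst z) \<le> snd z}"
      have S: "z \<in> topspace ?Q" if "z \<in> topspace ?S" for z
        using that by (simp only: topspace_subtopology Int_iff)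
      have "0 < radius k (fst z)" if "z \<in> topspace ?S" for z
        using half(1)[OF S[OF that]] by simp
      then have "continuous_map ?S (subtopology (disk k) {y. 0 < radius k y}) fst"
        by (intro continuous_map_into_subtopology continuous_map_from_subtopology[OF fstD]) auto
      from continuous_map_compose[OF this continuous_map_push[OF e(1), unfolded e(2)]]
      have push: "continuous_map ?S (skeleton k) (\<lambda>z. push e (fst z))"
        by (simp only: o_def)
      have "push e (fst z) \<in> {x \<in> skeleton_set k. 0 < f i x}" if "z \<in> topspace ?S" for z
        using half[OF S[OF that]] push_in_skeleton[OF e(1), of "fst z"] e(2) by simp
      then have "continuous_map ?S (subtopology (skeleton k) {x \<in> skeleton_set k. 0 < f i x}) (\<lambda>z. push e (fst z))"
        by (intro continuous_map_into_subtopology push) blast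
      from continuous_map_compose[OF this continuous_p[of i]]
      have "continuous_map ?S (path_space X) (\<lambda>z. p i (push e (fst z)))" by (simp add: o_def)
      moreover have "continuous_map ?S unit_interval (\<lambda>z. (snd z - 1 + radius k (fst z)) / radius k (fst z))"
      proof -
        have "continuous_map ?S euclideanreal (\<lambda>z. (snd z - 1 + radius k (fst z)) / radius k (fst z))"
        proof (intro continuous_map_real_divide continuous_map_add continuous_map_diff continuous_map_from_subtopology[OF rad] continuous_map_from_subtopology[OF sndI])
          show "radius k (fst z) \<noteq> 0" if "z \<in> topspace ?S" for z using half(1)[OF S[OF that]] by simp
        qed simp
        moreover have "(snd z - 1 + radius k (fst z)) / radius k (fst z) \<in> {0..1}" if "z \<in> topspace ?S" for z
        proof -
          have "1 - radius k (fst z) \<le> snd z" using that by (simp only: topspace_subtopology Int_iff mem_Collect_eq)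
          then show ?thesis using half[OF S[OF that]] by (auto simp: divide_simps)
        qed
        ultimately show ?thesis by (intro continuous_map_into_subtopology) blast+
      qed
      ultimately have "continuous_map ?S (prod_topology (path_space X) unit_interval)
         (\<lambda>z. (p i (push e (fst z)), (snd z - 1 + radius k (fst z)) / radius k (fst z)))"
        by (rule continuous_map_pairedI)
      from continuous_map_compose[OF this continuous_map_path_eval]
      show "continuous_map ?S X (\<lambda>z. p i (push e (fst z)) ((snd z - 1 + radius k (fst z)) / radius k (fst z)))"
        by (simp add: o_def)
    next
      \<comment> \<open>At the switching time both formulas give \<open>push\<close>: the scaling
        factor has become 1 / radius, and the old path is at its start.\<close>
      fix z assume z: "z \<in> topspace ?Q" "snd z = 1 - radius k (fst z)"
      have "p i (push e (fst z)) 0 = push e (fst z)"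
        using half[OF z(1)] p_ends push_in_skeleton[OF e(1), of "fst z"] e(2) by auto
      then show "\<Phi> e (scale ((radius k (fst z) + snd z) / radius k (fst z)) (fst z)) =
         p i (push e (fst z)) ((snd z - 1 + radius k (fst z)) / radius k (fst z))"
        using z(2) e(2) by (simp add: push_def)
    qed
    then show ?thesis using False by (simp add: disk_p_def case_prod_unfold)
  qed
qed

lemma continuous_next_p: "continuous_map (subtopology (skeleton (Suc k)) {x \<in> skeleton_set (Suc k). 0 < next_f i x}) (path_space X) (next_p i)"
proof (rule continuous_map_from_skeleton[OF openin_next_f_pos])
  fix e assume e: "e \<in> E" "d e < Suc k"
  let ?U = "{y \<in> closed_disk (d e). \<Phi> e y \<in> {x \<in> skeleton_set (Suc k). 0 < next_f i x}}"
  show "continuous_map (subtopology (disk (d e)) ?U) (path_space X) (\<lambda>y. next_p i (\<Phi> e y))"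
  proof (cases "d e = k")
    case False
    then have lt: "d e < k" using e by simp
    have U: "?U = {y \<in> closed_disk (d e). \<Phi> e y \<in> {x \<in> skeleton_set k. 0 < f i x}}"
      using disk_in_skeleton[OF e(1) lt] skeleton_set_mono by (auto simp: next_f_def extend_old)
    have "continuous_map (subtopology (disk (d e)) ?U) (subtopology (skeleton k) {x \<in> skeleton_set k. 0 < f i x}) (\<Phi> e)"
      unfolding U using continuous_map_from_subtopology[OF continuous_map_\<Phi>_skeleton[OF e(1) lt]]
      by (auto simp: continuous_map_in_subtopology)
    from continuous_map_compose[OF this continuous_p[of i]]
    show ?thesis
      by (rule continuous_map_eq) (use disk_in_skeleton[OF e(1) lt] in \<open>auto simp: next_p_def extend_old\<close>)
  next
    case True
    have U: "?U = {y \<in> closed_disk k. 0 < disk_f i e y}"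
      using next_f_disk[OF e(1) True] disk_in_skeleton[OF e] unfolding True by auto
    have "continuous_map (subtopology (disk k) {y \<in> closed_disk k. 0 < disk_f i e y}) (path_space X) (\<lambda>y. restrict (disk_p i e y) {0..1})"
      using continuous_map_disk_p[OF e(1) True] by (rule continuous_map_into_path_space)
    then show ?thesis
      unfolding U unfolding True by (rule continuous_map_eq) (use next_p_disk[OF e(1) True] in auto)
  qed
qed

lemma next_data:
  assumes x: "x \<in> skeleton_set (Suc k)"
  shows "(\<forall>i. 0 \<le> next_f i x) \<and> (\<forall>i\<ge>Suc k. next_f i x = 0) \<and> (\<Sum>i<Suc k. next_f i x) = 1 \<and>
  (\<forall>i. 0 < next_f i x \<longrightarrow> next_g i x \<in> E \<and> next_p i x 0 = x \<and> next_p i x 1 = \<Phi> (next_g i x) (\<lambda>_. 0))"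
proof (cases "x \<in> skeleton_set k")
  case True
  then show ?thesis using f_nonneg f_vanishes sum_f p_ends by (simp add: next_f_def next_g_def next_p_def extend_old)
next
  case False
  obtain e y where e: "e \<in> E" "d e = k" "y \<in> open_disk k" and xy: "x = \<Phi> e y"
    using skeleton_set_Suc[OF x False] .
  have y: "y \<in> closed_disk k" using e(3) open_disk_subset by blast
  have F_eq: "next_f i x = disk_f i e y" for i unfolding xy by (rule next_f_disk[OF e(1,2) y])
  have r: "0 \<le> ramp (radius k y)" "ramp (radius k y) \<le> 1" using radius_le_1[OF y] by (auto simp: ramp_def)
  have push: "push e y \<in> skeleton_set k" if "ramp (radius k y) \<noteq> 0"
    using push_in_skeleton[OF e(1)] y e(2) that radius_nonneg[of k y] by (auto simp: ramp_def max_def split: if_splits)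
  have nonneg: "0 \<le> disk_f i e y" for i
    using r f_nonneg[OF push] by (cases "ramp (radius k y) = 0") (auto simp: disk_f_def)
  have zero: "disk_f i e y = 0" if "i \<ge> Suc k" for i
    using that f_vanishes[OF push, of i] by (cases "ramp (radius k y) = 0") (auto simp: disk_f_def)
  have "(\<Sum>i<k. disk_f i e y) = ramp (radius k y) * (\<Sum>i<k. f i (push e y))"
    unfolding sum_distrib_left by (rule sum.cong) (auto simp: disk_f_def)
  also have "\<dots> = ramp (radius k y)"
    using sum_f[OF push] by (cases "ramp (radius k y) = 0") auto
  finally have sum: "(\<Sum>i<Suc k. disk_f i e y) = 1" by (simp add: disk_f_def)
  have "next_g i x \<in> E \<and> next_p i x 0 = x \<and> next_p i x 1 = \<Phi> (next_g i x) (\<lambda>_. 0)" if i: "0 < disk_f i e y" for i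
  proof (cases "i = k")
    case True
    have "scale 0 y = (\<lambda>_. 0)" by (simp add: scale_def)
    then show ?thesis
      unfolding xy next_p_disk[OF e(1,2) y i] next_g_disk[OF e(1,2) y i] using True e(1) by (simp add: disk_p_def)
  next
    case False
    then have h: "1 / 2 < radius k y" "0 < f i (push e y)" using i disk_f_pos_iff[OF e(1,2) y, of i] by auto
    have "push e y \<in> skeleton_set k" using push_in_skeleton[OF e(1)] y e(2) h(1) by auto
    then show ?thesis
      unfolding xy next_p_disk[OF e(1,2) y i] next_g_disk[OF e(1,2) y i] using False h p_ends[of "push e y" i] radius_le_1[OF y] by (simp add: disk_p_def)
  qed
  then show ?thesis using nonneg zero sum unfolding F_eq by blast
qed

lemma contraction_data_step: "contraction_data (Suc k) next_f next_g next_p"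
  unfolding contraction_data_def using continuous_next_f openin_next_g continuous_next_p next_data by blast

end

context cw
begin

lemma contraction_data_exists: "\<exists>f g p. contraction_data k f g p"
proof (induction k)
  case 0
  \<comment> \<open>On the empty skeleton all conditions hold vacuously, even the one that an empty
    sum be one.\<close>
  have [simp]: "skeleton_set 0 = {}" by (simp add: skeleton_set_def)
  have "skeleton 0 = trivial_topology" by (metis \<open>skeleton_set 0 = {}\<close> null_topspace_iff_trivial topspace_skeleton)
  then show ?case by (simp add: contraction_data_def)
next
  case (Suc k)
  then obtain f g p where "contraction_data k f g p" by blast
  then interpret contraction_step X E d \<Phi> k f g p by unfold_locales
  show ?case using contraction_data_step by blast
qed

end

section \<open>The upper bound\<close>

text \<open>The motion planner on one piece: contract the first point along a, cross over along the
  fixed path c, and undo the contraction b of the second point, one third of the time for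
  each.\<close>

lemma continuous_map_three_paths:
  assumes a: "continuous_map Y (path_space X) a" and b: "continuous_map Y (path_space X) b"
    and c: "pathin X c"
    and ends: "\<And>w. w \<in> topspace Y \<Longrightarrow> a w 1 = c 0" "\<And>w. w \<in> topspace Y \<Longrightarrow> b w 1 = c 1"
  shows "continuous_map Y (path_space X) (\<lambda>w. restrict (\<lambda>t. if t \<le> 1 / 3 then a w (3 * t)
     else if t \<le> 2 / 3 then c (3 * t - 1) else b w (3 - 3 * t)) {0..1})"
proof (rule continuous_map_into_path_space)
  let ?Q = "prod_topology Y unit_interval"
  have snd: "continuous_map ?Q euclideanreal snd"
    using continuous_map_snd[of Y unit_interval] by (auto simp: continuous_map_in_subtopology)
  have piece: "continuous_map (subtopology ?Q S) X (\<lambda>z. h (fst z) (r (snd z)))"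
    if h: "continuous_map Y (path_space X) h" and r: "continuous_map euclideanreal euclideanreal r"
      and S: "\<And>z. z \<in> topspace ?Q \<inter> S \<Longrightarrow> r (snd z) \<in> {0..1}" for h S and r :: "real \<Rightarrow> real"
  proof -
    have "continuous_map (subtopology ?Q S) euclideanreal (\<lambda>z. r (snd z))"
      using continuous_map_compose[OF continuous_map_from_subtopology[OF snd] r] by (simp only: o_def)
    then have "continuous_map (subtopology ?Q S) unit_interval (\<lambda>z. r (snd z))"
      by (rule continuous_map_into_subtopology) (use S in \<open>simp only: topspace_subtopology Pi_iff, blast\<close>)
    moreover have "continuous_map (subtopology ?Q S) (path_space X) (\<lambda>z. h (fst z))"
      using continuous_map_compose[OF continuous_map_from_subtopology[OF continuous_map_fst] h] by (simp only: o_def)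
    ultimately have "continuous_map (subtopology ?Q S) (prod_topology (path_space X) unit_interval) (\<lambda>z. (h (fst z), r (snd z)))"
      by (intro continuous_map_pairedI)
    from continuous_map_compose[OF this continuous_map_path_eval] show ?thesis by (simp add: o_def)
  qed
  have c': "continuous_map Y (path_space X) (\<lambda>_. restrict c {0..1})"
  proof -
    have "restrict c {0..1} \<in> topspace (path_space X)"
      using c by (auto simp: topspace_path_space pathin_def intro: continuous_map_eq)
    then show ?thesis by simp
  qed
  have inner: "continuous_map (subtopology ?Q {z \<in> topspace ?Q. 1 / 3 \<le> snd z}) X
     (\<lambda>z. if snd z \<le> 2 / 3 then c (3 * snd z - 1) else b (fst z) (3 - 3 * snd z))"
  proof (rule continuous_map_cases_le)
    let ?R = "subtopology ?Q {z \<in> topspace ?Q. 1 / 3 \<le> snd z}"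
    show "continuous_map ?R euclideanreal snd" by (rule continuous_map_from_subtopology[OF snd])
    have "continuous_map (subtopology ?Q ({z \<in> topspace ?Q. 1 / 3 \<le> snd z} \<inter> {z \<in> topspace ?R. snd z \<le> 2 / 3})) X
        (\<lambda>z. restrict c {0..1} (3 * snd z - 1))"
      by (rule piece[OF c', of "\<lambda>t. 3 * t - 1"]) (auto intro!: continuous_intros)
    then show "continuous_map (subtopology ?R {z \<in> topspace ?R. snd z \<le> 2 / 3}) X (\<lambda>z. c (3 * snd z - 1))"
      unfolding subtopology_subtopology by (rule continuous_map_eq) auto
    show "continuous_map (subtopology ?R {z \<in> topspace ?R. 2 / 3 \<le> snd z}) X (\<lambda>z. b (fst z) (3 - 3 * snd z))"
      unfolding subtopology_subtopology by (rule piece[OF b, of "\<lambda>t. 3 - 3 * t"]) (auto intro!: continuous_intros)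
    show "c (3 * snd z - 1) = b (fst z) (3 - 3 * snd z)" if z: "z \<in> topspace ?R" "snd z = 2 / 3" for z
    proof -
      have "3 * snd z - 1 = 1" "3 - 3 * snd z = 1" using z(2) by auto
      then show ?thesis using ends(2)[of "fst z"] z(1) by auto
    qed
  qed simp
  have "continuous_map ?Q X (\<lambda>z. if snd z \<le> 1 / 3 then a (fst z) (3 * snd z)
     else if snd z \<le> 2 / 3 then c (3 * snd z - 1) else b (fst z) (3 - 3 * snd z))"
  proof (rule continuous_map_cases_le[OF snd _ _ inner])
    show "continuous_map (subtopology ?Q {z \<in> topspace ?Q. snd z \<le> 1 / 3}) X (\<lambda>z. a (fst z) (3 * snd z))"
      by (rule piece[OF a, of "\<lambda>t. 3 * t"]) (auto intro!: continuous_intros)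
    show "a (fst z) (3 * snd z) = (if snd z \<le> 2 / 3 then c (3 * snd z - 1) else b (fst z) (3 - 3 * snd z))"
      if z: "z \<in> topspace ?Q" "snd z = 1 / 3" for z
    proof -
      have "3 * snd z = 1" "snd z \<le> 2 / 3" using z(2) by auto
      then show ?thesis using ends(1)[of "fst z"] z(1) by auto
    qed
  qed simp
  then show "continuous_map ?Q X (\<lambda>(w, t). if t \<le> 1 / 3 then a w (3 * t)
     else if t \<le> 2 / 3 then c (3 * t - 1) else b w (3 - 3 * t))"
    by (simp add: case_prod_unfold)
qed

text \<open>The overlap of the i-th and the j-th interval of the subdivisions of the unit interval
  into intervals of lengths f 0, f 1, ... at the two points. As two positive overlaps are
  comparable in the product order, the index i is determined by i + j.\<close>

definition overlap :: "(nat \<Rightarrow> 'a \<Rightarrow> real) \<Rightarrow> nat \<Rightarrow> nat \<Rightarrow> 'a \<times> 'a \<Rightarrow> real" where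
  "overlap f i j z = min (\<Sum>l<Suc i. f l (fst z)) (\<Sum>l<Suc j. f l (snd z)) - max (\<Sum>l<i. f l (fst z)) (\<Sum>l<j. f l (snd z))"

lemma overlap_pos_imp: "0 < overlap f i j z \<Longrightarrow> 0 < f i (fst z) \<and> 0 < f j (snd z)"
  by (auto simp: overlap_def)

text \<open>For i < i', and so j' < j, positive overlaps would give a cycle of inequalities: start
  of j < end of i \<le> start of i' < end of j' \<le> start of j.\<close>

lemma overlap_unique:
  assumes nonneg: "\<And>l. 0 \<le> f l (fst z)" "\<And>l. 0 \<le> f l (snd z)"
    and "0 < overlap f i j z" "0 < overlap f i' j' z" "i + j = i' + j'"
  shows "i = i'"
proof -
  have False if "0 < overlap f i j z" "0 < overlap f i' j' z" "i + j = i' + j'" "i < i'" for i j i' j'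
  proof -
    have "(\<Sum>l<Suc i. f l (fst z)) \<le> (\<Sum>l<i'. f l (fst z))" using that nonneg by (intro sum_mono2) auto
    moreover have "(\<Sum>l<Suc j'. f l (snd z)) \<le> (\<Sum>l<j. f l (snd z))" using that nonneg by (intro sum_mono2) auto
    ultimately show False using that(1,2) by (auto simp: overlap_def)
  qed
  then show ?thesis using assms(3-5) by (metis linorder_neqE_nat)
qed

context cw
begin

lemma motion_planners_exist:
  assumes conn: "connected_space X" and dim: "\<And>e. e \<in> E \<Longrightarrow> d e \<le> m"
  obtains U :: "nat \<Rightarrow> ('a \<times> 'a) set" where "(\<Union>l\<le>2 * m. U l) = topspace (prod_topology X X)"
    "\<And>l. openin (prod_topology X X) (U l)"
    "\<And>l. \<exists>s. continuous_map (subtopology (prod_topology X X) (U l)) (path_space X) s \<and> (\<forall>z\<in>U l. path_ends (s z) = z)"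
proof -
  let ?Z = "prod_topology X X"
  obtain f g p where data: "contraction_data (Suc m) f g p" using contraction_data_exists by blast
  have sk: "skeleton (Suc m) = X" using dim by (intro skeleton_eq) (simp add: le_imp_less_Suc)
  then have sks: "skeleton_set (Suc m) = topspace X" by (metis topspace_skeleton)
  have f: "\<And>i. continuous_map X euclideanreal (f i)"
    and f0: "\<And>i x. x \<in> topspace X \<Longrightarrow> 0 \<le> f i x"
    and fsum: "\<And>x. x \<in> topspace X \<Longrightarrow> (\<Sum>i<Suc m. f i x) = 1"
    and ends: "\<And>i x. x \<in> topspace X \<Longrightarrow> 0 < f i x \<Longrightarrow> g i x \<in> E \<and> p i x 0 = x \<and> p i x 1 = \<Phi> (g i x) (\<lambda>_. 0)"
    and g: "\<And>i c. openin X {x \<in> topspace X. 0 < f i x \<and> g i x = c}"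
    and p: "\<And>i. continuous_map (subtopology X {x \<in> topspace X. 0 < f i x}) (path_space X) (p i)"
    using data unfolding contraction_data_def sk sks by auto
  have "\<exists>\<alpha>. pathin X \<alpha> \<and> \<alpha> 0 = \<Phi> c (\<lambda>_. 0) \<and> \<alpha> 1 = \<Phi> c' (\<lambda>_. 0)" if "c \<in> E" "c' \<in> E" for c c'
  proof -
    have "(\<lambda>_. 0) \<in> closed_disk j" for j by (simp add: closed_disk_iff radius_def)
    then have "\<Phi> c (\<lambda>_. 0) \<in> topspace X" "\<Phi> c' (\<lambda>_. 0) \<in> topspace X"
      using continuous_\<Phi>[OF that(1)] continuous_\<Phi>[OF that(2)] by (auto simp: continuous_map_def Pi_iff)
    then show ?thesis
      using connected_imp_path_connected[OF conn] unfolding path_connected_space_def by blast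
  qed
  then obtain \<alpha> where \<alpha>: "\<And>c c'. c \<in> E \<Longrightarrow> c' \<in> E \<Longrightarrow>
      pathin X (\<alpha> c c') \<and> \<alpha> c c' 0 = \<Phi> c (\<lambda>_. 0) \<and> \<alpha> c c' 1 = \<Phi> c' (\<lambda>_. 0)" by metis
  define W where "W i j = {z \<in> topspace ?Z. 0 < overlap f i j z}" for i j
  define U where "U l = (\<Union>i\<le>l. W i (l - i))" for l
  have W: "openin ?Z (W i j)" for i j
  proof -
    have 1: "continuous_map ?Z euclideanreal (\<lambda>z. f l (fst z))" "continuous_map ?Z euclideanreal (\<lambda>z. f l (snd z))" for l
      using continuous_map_compose[OF continuous_map_fst f] continuous_map_compose[OF continuous_map_snd f] by (simp_all add: o_def)
    have "continuous_map ?Z euclideanreal (overlap f i j)"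
      unfolding overlap_def[abs_def]
      by (intro continuous_map_diff continuous_map_real_min continuous_map_real_max continuous_map_sum 1) auto
    then have "openin ?Z {z \<in> topspace ?Z. overlap f i j z \<in> {0<..}}"
      by (rule openin_continuous_map_preimage) auto
    then show ?thesis by (simp add: W_def)
  qed
  then have U: "openin ?Z (U l)" for l unfolding U_def by (intro openin_Union) auto
  have sect: "\<exists>s. continuous_map (subtopology ?Z (U l)) (path_space X) s \<and> (\<forall>z\<in>U l. path_ends (s z) = z)" for l
  proof -
    \<comment> \<open>\<open>U l\<close> falls apart into disjoint open pieces: the index i is
      unique by \<open>overlap_unique\<close>, and the labels g are locally constant. On one piece
      both contractions end at fixed centres of cells, so a single path \<open>\<alpha> c c'\<close>
      joins them and the sections can be pasted.\<close>
    define I where "I = {(i, c, c'). i \<le> l \<and> c \<in> E \<and> c' \<in> E}"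
    define T where "T = (\<lambda>(i, c, c'). {z \<in> W i (l - i). g i (fst z) = c \<and> g (l - i) (snd z) = c'})"
    define S where "S = (\<lambda>(i, c, c') z. restrict (\<lambda>t. if t \<le> 1 / 3 then p i (fst z) (3 * t)
     else if t \<le> 2 / 3 then \<alpha> c c' (3 * t - 1) else p (l - i) (snd z) (3 - 3 * t)) {0..1})"
    have Wpos: "fst z \<in> topspace X \<and> snd z \<in> topspace X \<and> 0 < f i (fst z) \<and> 0 < f j (snd z)" if "z \<in> W i j" for i j z
      using that overlap_pos_imp[of f i j z] by (auto simp: W_def)
    have TU: "T q \<subseteq> U l" if "q \<in> I" for q using that by (auto simp: I_def T_def U_def)
    have cover: "\<exists>q\<in>I. z \<in> T q" if z: "z \<in> U l" for z
    proof -
      obtain i where i: "i \<le> l" "z \<in> W i (l - i)" using z by (auto simp: U_def)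
      then show ?thesis using Wpos[OF i(2)] ends
        by (intro bexI[of _ "(i, g i (fst z), g (l - i) (snd z))"]) (auto simp: I_def T_def)
    qed
    have Topen: "openin ?Z (T q)" if "q \<in> I" for q
    proof -
      obtain i c c' where q: "q = (i, c, c')" by (cases q)
      let ?O = "\<lambda>i c. {x \<in> topspace X. 0 < f i x \<and> g i x = c}"
      have "T q = W i (l - i) \<inter> (?O i c \<times> ?O (l - i) c')"
        unfolding q T_def using Wpos by (auto simp: mem_Times_iff)
      then show ?thesis using W g by (simp add: openin_Int openin_prod_Times_iff)
    qed
    have Tuniq: "q = q'" if q: "q \<in> I" "q' \<in> I" "z \<in> T q" "z \<in> T q'" for q q' z
    proof -
      obtain i c c' i' e e' where qq: "q = (i, c, c')" "q' = (i', e, e')" by (cases q; cases q')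
      have w: "z \<in> W i (l - i)" "z \<in> W i' (l - i')" "i \<le> l" "i' \<le> l" using q by (auto simp: qq T_def I_def)
      then have "i = i'" using Wpos[OF w(1)] f0
        by (intro overlap_unique[of f z i "l - i" i' "l - i'"]) (auto simp: W_def)
      then show ?thesis using q by (auto simp: qq T_def)
    qed
    have Scont: "continuous_map (subtopology ?Z (T q)) (path_space X) (S q)" if q: "q \<in> I" for q
    proof -
      obtain i c c' where qq: "q = (i, c, c')" by (cases q)
      have cE: "c \<in> E" "c' \<in> E" using q by (auto simp: qq I_def)
      have Tq: "z \<in> W i (l - i) \<and> g i (fst z) = c \<and> g (l - i) (snd z) = c'" if "z \<in> topspace (subtopology ?Z (T q))" for z
        using that by (auto simp: qq T_def)
      have "continuous_map (subtopology ?Z (T q)) (subtopology X {x \<in> topspace X. 0 < f i x}) fst"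
        by (intro continuous_map_into_subtopology continuous_map_from_subtopology[OF continuous_map_fst]) (use Tq Wpos in blast)
      from continuous_map_compose[OF this p[of i]]
      have a: "continuous_map (subtopology ?Z (T q)) (path_space X) (\<lambda>z. p i (fst z))" by (simp add: o_def)
      have "continuous_map (subtopology ?Z (T q)) (subtopology X {x \<in> topspace X. 0 < f (l - i) x}) snd"
        by (intro continuous_map_into_subtopology continuous_map_from_subtopology[OF continuous_map_snd]) (use Tq Wpos in blast)
      from continuous_map_compose[OF this p[of "l - i"]]
      have b: "continuous_map (subtopology ?Z (T q)) (path_space X) (\<lambda>z. p (l - i) (snd z))" by (simp add: o_def)
      show ?thesis
        unfolding S_def qq case_prod_conv
        by (rule continuous_map_three_paths[OF a[unfolded qq] b[unfolded qq]])
          (use Tq[unfolded qq] Wpos ends \<alpha>[OF cE] in \<open>metis+\<close>)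
    qed
    obtain s where s: "continuous_map (subtopology ?Z (U l)) (path_space X) s"
      "\<And>z q. q \<in> I \<Longrightarrow> z \<in> topspace (subtopology ?Z (U l)) \<inter> T q \<Longrightarrow> s z = S q z"
    proof (rule pasting_lemma_exists[of "subtopology ?Z (U l)" T I "path_space X" S])
      show "topspace (subtopology ?Z (U l)) \<subseteq> (\<Union>i\<in>I. T i)" using cover by auto
      show "openin (subtopology ?Z (U l)) (T q)" if "q \<in> I" for q
        using Topen[OF that] TU[OF that] U by (simp add: openin_open_subtopology)
      show "continuous_map (subtopology (subtopology ?Z (U l)) (T q)) (path_space X) (S q)" if "q \<in> I" for q
        using Scont[OF that] TU[OF that] by (simp add: subtopology_subtopology Int_absorb1)
      show "S i x = S j x" if "i \<in> I" "j \<in> I" "x \<in> topspace (subtopology ?Z (U l)) \<inter> T i \<inter> T j" for i j x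
        using Tuniq[of i j x] that by auto
    qed auto
    have "path_ends (s z) = z" if z: "z \<in> U l" for z
    proof -
      obtain q where q: "q \<in> I" "z \<in> T q" using cover[OF z] by blast
      obtain i c c' where qq: "q = (i, c, c')" by (cases q)
      have "z \<in> topspace (subtopology ?Z (U l))" using z openin_subset[OF U] by auto
      then have "s z = S q z" using s(2) q by blast
      moreover have "z \<in> W i (l - i)" using q by (simp add: qq T_def)
      then have "p i (fst z) 0 = fst z" "p (l - i) (snd z) 0 = snd z" using Wpos ends by blast+
      ultimately show ?thesis by (simp add: path_ends_def S_def qq)
    qed
    then show ?thesis using s(1) by blast
  qed
  \<comment> \<open>The first interval of positive length starts at 0. For two points these first
    intervals overlap, and their indices are at most m, so the sets \<open>U l\<close> with l \<le>
    2m cover.\<close>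
  have least: "\<exists>i\<le>m. (\<Sum>l<i. f l x) = 0 \<and> 0 < f i x" if x: "x \<in> topspace X" for x
  proof -
    have "\<exists>i<Suc m. 0 < f i x"
    proof (rule ccontr)
      assume "\<not> (\<exists>i<Suc m. 0 < f i x)"
      then have "\<And>i. i < Suc m \<Longrightarrow> f i x = 0" using f0[OF x] by (meson antisym not_less)
      then show False using fsum[OF x] by simp
    qed
    then obtain i where i: "i < Suc m" "0 < f i x" by blast
    define i0 where "i0 = (LEAST i. 0 < f i x)"
    have "0 < f i0 x" "i0 \<le> i" unfolding i0_def using i(2) by (rule LeastI, rule Least_le)
    moreover have "f l x = 0" if "l < i0" for l
      using not_less_Least[of l "\<lambda>i. 0 < f i x"] that f0[OF x, of l] by (auto simp: i0_def)
    ultimately show ?thesis using i(1) by (intro exI[of _ i0]) auto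
  qed
  have "(\<Union>l\<le>2 * m. U l) = topspace ?Z"
  proof
    show "topspace ?Z \<subseteq> (\<Union>l\<le>2 * m. U l)"
    proof
      fix z assume z: "z \<in> topspace ?Z"
      then have "fst z \<in> topspace X" "snd z \<in> topspace X" by auto
      then obtain i j where ij: "i \<le> m" "(\<Sum>l<i. f l (fst z)) = 0" "0 < f i (fst z)"
         "j \<le> m" "(\<Sum>l<j. f l (snd z)) = 0" "0 < f j (snd z)" using least by meson
      then have "z \<in> W i j" using z by (auto simp: W_def overlap_def)
      then have "z \<in> U (i + j)" unfolding U_def by (intro UN_I[of i]) auto
      then show "z \<in> (\<Union>l\<le>2 * m. U l)" using ij by auto
    qed
  qed (use openin_subset[OF U] in blast)
  then show ?thesis using U sect that by blast
qed

end

section \<open>The theorem\<close>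

lemma iterated_cup_cup_list:
  assumes "\<And>j. j \<in> {1..m} \<Longrightarrow> \<psi> j \<in> cocycles 2 X \<and> u j = cohomology_class 2 X (\<psi> j)"
  shows "iterated_cup 2 X u m = cohomology_class (2 * m) X (cup_list X (map \<psi> [1..<Suc m]))"
  using assms
proof (induction m)
  case (Suc m)
  let ?S = "map \<psi> [1..<Suc m]"
  have S: "set ?S \<subseteq> cocycles 2 X" using Suc.prems by auto
  have \<psi>: "\<psi> (Suc m) \<in> cocycles 2 X" "u (Suc m) = cohomology_class 2 X (\<psi> (Suc m))" using Suc.prems by auto
  have S': "cup_list X ?S \<in> cocycles (m * 2) X"
    using cup_list_cocycle[OF S] by (simp add: mult.commute del: upt_Suc)
  have "iterated_cup 2 X u (Suc m) = cup (m * 2) 2 X (cohomology_class (m * 2) X (cup_list X ?S)) (cohomology_class 2 X (\<psi> (Suc m)))"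
    using Suc.IH Suc.prems \<psi>(2) by (simp add: mult.commute del: upt_Suc)
  also have "\<dots> = cohomology_class (m * 2 + 2) X (cochain_cup (m * 2) 2 X (cup_list X ?S) (\<psi> (Suc m)))"
    by (rule cup_cohomology_class[OF S' \<psi>(1)])
  also have "cochain_cup (m * 2) 2 X (cup_list X ?S) (\<psi> (Suc m)) = cup_list X (?S @ [\<psi> (Suc m)])"
    using \<psi>(1) cup_list_single[of "\<psi> (Suc m)" X] cup_list_append[of X ?S "[\<psi> (Suc m)]"]
    by (simp add: cocycles_def mult.commute del: cup_list.simps upt_Suc)
  finally show ?case by (simp add: mult.commute add.commute)
qed simp

lemma cohomology_class_eq_one_iff:
  "cohomology_class p X \<phi> = \<one>\<^bsub>cohomology_group p X\<^esub> \<longleftrightarrow> \<phi> \<in> coboundaries p X"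
proof
  assume "cohomology_class p X \<phi> = \<one>\<^bsub>cohomology_group p X\<^esub>"
  then have "\<phi> \<in> cohomology_class p X (\<lambda>_. 0)" using cohomology_class_self[of \<phi> p X] by (simp add: one_cohomology_group)
  then show "\<phi> \<in> coboundaries p X" by (simp add: mem_cohomology_class)
next
  assume "\<phi> \<in> coboundaries p X"
  then have "\<phi> \<in> cohomology_class p X (\<lambda>_. 0)" by (simp add: mem_cohomology_class)
  then show "cohomology_class p X \<phi> = \<one>\<^bsub>cohomology_group p X\<^esub>"
    unfolding one_cohomology_group by (rule cohomology_class_eq)
qed

lemma normalized2_representative:
  assumes "u \<in> carrier (cohomology_group 2 X)"
  obtains \<psi> where "\<psi> \<in> cocycles 2 X" "normalized2 X \<psi>" "u = cohomology_class 2 X \<psi>"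
proof -
  obtain \<phi> where \<phi>: "\<phi> \<in> cocycles 2 X" "u = cohomology_class 2 X \<phi>" using assms by (auto simp: carrier_cohomology_group)
  obtain \<beta> where \<beta>: "\<beta> \<in> singular_cochains 1 X" "normalized2 X (\<lambda>\<sigma>. \<phi> \<sigma> - coboundary 1 X \<beta> \<sigma>)"
    using normalized2_exists[OF \<phi>(1)] .
  let ?\<psi> = "\<lambda>\<sigma>. \<phi> \<sigma> - coboundary 1 X \<beta> \<sigma>"
  have b: "coboundary 1 X \<beta> \<in> coboundaries 2 X" using \<beta>(1) by (auto simp: coboundaries_def numeral_2_eq_2)
  then have "?\<psi> \<in> cohomology_class 2 X \<phi>" using coboundaries_uminus[OF b] by (simp add: mem_cohomology_class)
  then have "u = cohomology_class 2 X ?\<psi>" using \<phi>(2) cohomology_class_eq by metis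
  then show ?thesis using that[of ?\<psi>] cocycles_diff[OF \<phi>(1) b] \<beta>(2) by blast
qed

theorem theorem1p5:
  fixes n :: nat
    and X :: "'a topology"
    and E :: "'a set set"
    and d :: "'a set \<Rightarrow> nat"
    and \<Phi> :: "'a set \<Rightarrow> (nat \<Rightarrow> real) \<Rightarrow> 'a"
    and u :: "nat \<Rightarrow> ('a, 'f::field) cochain set"
  assumes "cw_complex X E d \<Phi>"
    and "connected_space X"
    and "cw_dim E d = enat (2 * n)"
    and "CHAR('f) \<noteq> 2"
    and "\<And>j. j \<in> {1..n} \<Longrightarrow> atoroidal 2 X (u j)"
    and "\<And>j. j \<in> {1..n} \<Longrightarrow> cup 2 2 X (u j) (u j) = \<one>\<^bsub>cohomology_group 4 X\<^esub>"
    and "iterated_cup 2 X u n \<noteq> \<one>\<^bsub>cohomology_group (2 * n) X\<^esub>"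
  shows "topological_complexity X = 2 * cw_dim E d"
proof -
  interpret cw X E d \<Phi> using assms(1) by unfold_locales
  have dim: "d e \<le> 2 * n" if "e \<in> E" for e
  proof -
    have "enat (d e) \<le> cw_dim E d" unfolding cw_dim_def using that by (rule SUP_upper)
    then show ?thesis using assms(3) by simp
  qed
  have "topological_complexity X \<le> enat (4 * n)"
    unfolding topological_complexity_def
  proof (rule Inf_lower, rule CollectI)
    \<comment> \<open>With m = 2n there are 4n + 1 sets, which is k = 4n in the reduced
      convention.\<close>
    obtain U where "(\<Union>l\<le>2 * (2 * n). U l) = topspace (prod_topology X X)"
      "\<And>l. openin (prod_topology X X) (U l)"
      "\<And>l. \<exists>s. continuous_map (subtopology (prod_topology X X) (U l)) (path_space X) s \<and> (\<forall>z\<in>U l. path_ends (s z) = z)"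
      using motion_planners_exist[OF assms(2) dim] by blast
    then show "\<exists>k. enat (4 * n) = enat k \<and> (\<exists>U :: nat \<Rightarrow> ('a \<times> 'a) set. (\<Union>j\<le>k. U j) = topspace (prod_topology X X) \<and>
            (\<forall>j\<le>k. openin (prod_topology X X) (U j) \<and>
                   (\<exists>s. continuous_map (subtopology (prod_topology X X) (U j)) (path_space X) s \<and>
                        (\<forall>z\<in>U j. path_ends (s z) = z))))"
      by (intro exI[of _ "4 * n"]) (auto intro!: exI[of _ U])
  qed
  moreover have "enat (4 * n) \<le> topological_complexity X"
    unfolding topological_complexity_def
  proof (rule Inf_greatest, clarify)
    fix k and U :: "nat \<Rightarrow> ('a \<times> 'a) set"
    assume cover: "(\<Union>j\<le>k. U j) = topspace (prod_topology X X)"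
      and U: "\<forall>j\<le>k. openin (prod_topology X X) (U j) \<and>
                   (\<exists>s. continuous_map (subtopology (prod_topology X X) (U j)) (path_space X) s \<and>
                        (\<forall>z\<in>U j. path_ends (s z) = z))"
    then obtain s where s: "\<And>j. j \<le> k \<Longrightarrow> continuous_map (subtopology (prod_topology X X) (U j)) (path_space X) (s j)"
      "\<And>j z. j \<le> k \<Longrightarrow> z \<in> U j \<Longrightarrow> path_ends (s j z) = z" by metis
    have "\<exists>\<psi>. \<psi> \<in> cocycles 2 X \<and> normalized2 X \<psi> \<and> u j = cohomology_class 2 X \<psi>" if "j \<in> {1..n}" for j
      using normalized2_representative[of "u j" X] assms(5)[OF that] unfolding atoroidal_def by metis
    then obtain \<psi> where \<psi>: "\<And>j. j \<in> {1..n} \<Longrightarrow> \<psi> j \<in> cocycles 2 X \<and> normalized2 X (\<psi> j) \<and> u j = cohomology_class 2 X (\<psi> j)"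
      by metis
    have "4 * n \<le> k"
    \<comment> \<open>The pairing argument works with cycles of positive degree; for n = 0 the claim
      is 0 \<le> k.\<close>
    proof (cases "n = 0")
      case False
      show ?thesis
      proof (rule topological_complexity_lower_bound[where xs = "map \<psi> [1..<Suc n]"])
        show "(2 :: 'f) \<noteq> 0"
        proof
          assume "(2 :: 'f) = 0"
          then have "CHAR('f) dvd 2" by (metis of_nat_eq_0_iff_char_dvd of_nat_numeral)
          then have "CHAR('f) \<le> 2" "0 < CHAR('f)"
            by (auto intro: dvd_imp_le dvd_pos_nat[of 2])
          then show False using assms(4) CHAR_not_1[where 'a = 'f] by linarith
        qed
        have in_xs: "\<exists>j\<in>{1..n}. \<phi> = \<psi> j" if "\<phi> \<in> set (map \<psi> [1..<Suc n])" for \<phi> using that by auto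
        show "\<phi> \<in> cocycles 2 X" "normalized2 X \<phi>" if "\<phi> \<in> set (map \<psi> [1..<Suc n])" for \<phi>
          using in_xs[OF that] \<psi> by auto
        show "atoroidal 2 X (cohomology_class 2 X \<phi>)" if "\<phi> \<in> set (map \<psi> [1..<Suc n])" for \<phi>
          using in_xs[OF that] \<psi> assms(5) by metis
        show "cochain_cup 2 2 X \<phi> \<phi> \<in> coboundaries 4 X" if \<phi>: "\<phi> \<in> set (map \<psi> [1..<Suc n])" for \<phi>
        proof -
          obtain j where j: "j \<in> {1..n}" "\<phi> = \<psi> j" using in_xs[OF \<phi>] by blast
          have "cohomology_class (2 + 2) X (cochain_cup 2 2 X \<phi> \<phi>) = \<one>\<^bsub>cohomology_group 4 X\<^esub>"
            using assms(6)[OF j(1)] \<psi>[OF j(1)] cup_cohomology_class[of \<phi> 2 X \<phi> 2] j(2) by metis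
          then show ?thesis by (simp add: cohomology_class_eq_one_iff)
        qed
        show "cup_list X (map \<psi> [1..<Suc n]) \<notin> coboundaries (2 * n) X"
          using assms(7) iterated_cup_cup_list[of n \<psi> X u] \<psi> cohomology_class_eq_one_iff by metis
      qed (use False cover U s in auto)
    qed simp
    then show "enat (4 * n) \<le> enat k" by simp
  qed
  ultimately have "topological_complexity X = enat (4 * n)" by (rule antisym)
  then show ?thesis using assms(3) by (simp add: numeral_eq_enat)
qed

end
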